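(* Let $n\geq 2$, let $\Omega\subset\mathbb{R}^n$ be a bounded domain with $C^\infty$ boundary $\partial\Omega$, and let $q_1,q_2\in C^\infty(\overline{\Omega})$. Let $\Lambda_{q_j}$, $j=1,2$, be the Dirichlet-to-Neumann maps of \[ \Delta u + q_j u^2 = 0 \text{ in } \Omega,\qquad u=f \text{ on } \partial\Omega . \] Suppose that $\Lambda_{q_1}(f)=\Lambda_{q_2}(f)$ for all $f\in C^s(\partial\Omega)$ with $\|f\|_{C^s(\partial\Omega)}<\delta$, where $\delta>0$ is any sufficiently small number (small enough that both maps are defined on this set). Then $q_1=q_2$ in $\Omega$.
   Context: $\Delta$ is the Euclidean Laplacian. Fix $s>1$ with $s\notin\mathbb{N}$; $C^s$ denotes the standard Hölder space ($C^{k,\alpha}$ with $s=k+\alpha$). Dirichlet-to-Neumann map: for $q\in C^\infty(\overline\Omega)$ there are $\delta_0,C>0$ such that for every $f\in C^s(\partial\Omega)$ with $\|f\|_{C^s(\partial\Omega)}<\delta_0$ the problem $\Delta u+qu^2=0$ in $\Omega$, $u|_{\partial\Omega}=f$, has a unique solution $u_f$ in the class $\{w\in C^s(\overline\Omega): \|w\|_{C^s(\overline\Omega)}\le C\delta_0\}$ (the "unique small solution"); then $\Lambda_q(f):=\partial_\nu u_f|_{\partial\Omega}\in C^{s-1}(\partial\Omega)$, where $\partial_\nu$ is the outward normal derivative. *)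

theory Defs
  imports "HOL-Analysis.Analysis"
begin

fun dpart :: "(real^'n \<Rightarrow> real) \<Rightarrow> 'n list \<Rightarrow> real^'n \<Rightarrow> real" where
  "dpart u [] = u"
| "dpart u (i # is) = (\<lambda>x. deriv (\<lambda>t. dpart u is (x + t *\<^sub>R axis i 1)) 0)"

definition grad :: "(real^'n \<Rightarrow> real) \<Rightarrow> real^'n \<Rightarrow> real^'n" where
  "grad u x = (\<chi> i. dpart u [i] x)"

definition laplacian :: "(real^'n \<Rightarrow> real) \<Rightarrow> real^'n \<Rightarrow> real" where
  "laplacian u x = (\<Sum>i\<in>UNIV. dpart u [i, i] x)"

definition Ck :: "nat \<Rightarrow> (real^'n) set \<Rightarrow> (real^'n \<Rightarrow> real) \<Rightarrow> bool" where
  "Ck k U u \<longleftrightarrow> (\<forall>\<beta>. length \<beta> \<le> k \<longrightarrow>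
      continuous_on U (dpart u \<beta>) \<and>
      (length \<beta> < k \<longrightarrow> (\<forall>i. \<forall>x\<in>U. (\<lambda>t. dpart u \<beta> (x + t *\<^sub>R axis i 1)) differentiable (at 0))))"

definition smooth_on :: "(real^'n) set \<Rightarrow> (real^'n \<Rightarrow> real) \<Rightarrow> bool" where
  "smooth_on U u \<longleftrightarrow> (\<forall>k. Ck k U u)"

definition smooth_closure :: "(real^'n) set \<Rightarrow> (real^'n \<Rightarrow> real) \<Rightarrow> bool" where
  "smooth_closure \<Omega> q \<longleftrightarrow> smooth_on \<Omega> q \<and> continuous_on (closure \<Omega>) q \<and>
     (\<forall>\<beta>. \<exists>g. continuous_on (closure \<Omega>) g \<and> (\<forall>x\<in>\<Omega>. g x = dpart q \<beta> x))"

definition local_defining :: "(real^'n) set \<Rightarrow> real^'n \<Rightarrow> real \<Rightarrow> (real^'n \<Rightarrow> real) \<Rightarrow> bool" where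
  "local_defining \<Omega> x r \<rho> \<longleftrightarrow> r > 0 \<and> smooth_on (ball x r) \<rho> \<and>
     (\<forall>y\<in>ball x r. grad \<rho> y \<noteq> 0) \<and> \<Omega> \<inter> ball x r = {y \<in> ball x r. \<rho> y < 0}"

definition smooth_boundary :: "(real^'n) set \<Rightarrow> bool" where
  "smooth_boundary \<Omega> \<longleftrightarrow> (\<forall>x\<in>frontier \<Omega>. \<exists>r \<rho>. local_defining \<Omega> x r \<rho>)"

definition outward_normal :: "(real^'n) set \<Rightarrow> real^'n \<Rightarrow> real^'n" where
  "outward_normal \<Omega> x = (SOME v. \<exists>r \<rho>. local_defining \<Omega> x r \<rho> \<and> v = grad \<rho> x /\<^sub>R norm (grad \<rho> x))"

definition normal_deriv :: "(real^'n) set \<Rightarrow> (real^'n \<Rightarrow> real) \<Rightarrow> real^'n \<Rightarrow> real" where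
  "normal_deriv \<Omega> u x =
     Lim (at_right 0) (\<lambda>t. (u x - u (x - t *\<^sub>R outward_normal \<Omega> x)) / t)"

definition hquot :: "real \<Rightarrow> (real^'n) set \<Rightarrow> (real^'n \<Rightarrow> real) \<Rightarrow> real set" where
  "hquot \<alpha> \<Omega> g = {\<bar>g x - g y\<bar> / (dist x y powr \<alpha>) | x y. x \<in> \<Omega> \<and> y \<in> \<Omega> \<and> x \<noteq> y}"

definition holder_space :: "real \<Rightarrow> (real^'n) set \<Rightarrow> (real^'n \<Rightarrow> real) set" where
  "holder_space s \<Omega> = {u. continuous_on (closure \<Omega>) u \<and> Ck (nat \<lfloor>s\<rfloor>) \<Omega> u \<and>
     (\<forall>\<beta>. length \<beta> \<le> nat \<lfloor>s\<rfloor> \<longrightarrow> bounded (dpart u \<beta> ` \<Omega>)) \<and>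
     (\<forall>\<beta>. length \<beta> = nat \<lfloor>s\<rfloor> \<longrightarrow> bdd_above (hquot (s - of_int \<lfloor>s\<rfloor>) \<Omega> (dpart u \<beta>)))}"

definition holder_norm :: "real \<Rightarrow> (real^'n) set \<Rightarrow> (real^'n \<Rightarrow> real) \<Rightarrow> real" where
  "holder_norm s \<Omega> u =
     (\<Sum>\<beta>\<in>{\<beta>. length \<beta> \<le> nat \<lfloor>s\<rfloor>}. (SUP x\<in>\<Omega>. \<bar>dpart u \<beta> x\<bar>)) +
     (\<Sum>\<beta>\<in>{\<beta>. length \<beta> = nat \<lfloor>s\<rfloor>}. Sup (hquot (s - of_int \<lfloor>s\<rfloor>) \<Omega> (dpart u \<beta>)))"

text \<open>C^s(boundary \<Omega>) realised as the trace space of C^s(closure \<Omega>) with the quotient norm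
  (equivalent to the chart-based norm for smooth bounded domains).\<close>
definition bdry_holder_space :: "real \<Rightarrow> (real^'n) set \<Rightarrow> (real^'n \<Rightarrow> real) set" where
  "bdry_holder_space s \<Omega> = {f. \<exists>F\<in>holder_space s \<Omega>. \<forall>x\<in>frontier \<Omega>. F x = f x}"

definition bdry_holder_norm :: "real \<Rightarrow> (real^'n) set \<Rightarrow> (real^'n \<Rightarrow> real) \<Rightarrow> real" where
  "bdry_holder_norm s \<Omega> f = Inf {holder_norm s \<Omega> F | F. F \<in> holder_space s \<Omega> \<and> (\<forall>x\<in>frontier \<Omega>. F x = f x)}"

definition small_sol :: "real \<Rightarrow> (real^'n) set \<Rightarrow> (real^'n \<Rightarrow> real) \<Rightarrow> real \<Rightarrow> real \<Rightarrow>
    (real^'n \<Rightarrow> real) \<Rightarrow> (real^'n \<Rightarrow> real) \<Rightarrow> bool" where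
  "small_sol s \<Omega> q C \<delta>0 f u \<longleftrightarrow> u \<in> holder_space s \<Omega> \<and> holder_norm s \<Omega> u \<le> C * \<delta>0 \<and>
     Ck 2 \<Omega> u \<and> (\<forall>x\<in>\<Omega>. laplacian u x + q x * (u x)\<^sup>2 = 0) \<and> (\<forall>x\<in>frontier \<Omega>. u x = f x)"

definition well_posed :: "real \<Rightarrow> (real^'n) set \<Rightarrow> (real^'n \<Rightarrow> real) \<Rightarrow> real \<Rightarrow> real \<Rightarrow> bool" where
  "well_posed s \<Omega> q \<delta>0 C \<longleftrightarrow> \<delta>0 > 0 \<and> C > 0 \<and>
     (\<forall>f\<in>bdry_holder_space s \<Omega>. bdry_holder_norm s \<Omega> f < \<delta>0 \<longrightarrow>
        (\<exists>u. small_sol s \<Omega> q C \<delta>0 f u) \<and>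
        (\<forall>u v. small_sol s \<Omega> q C \<delta>0 f u \<longrightarrow> small_sol s \<Omega> q C \<delta>0 f v \<longrightarrow> (\<forall>x\<in>closure \<Omega>. u x = v x)))"

definition DN_map :: "real \<Rightarrow> (real^'n) set \<Rightarrow> (real^'n \<Rightarrow> real) \<Rightarrow> real \<Rightarrow> real \<Rightarrow>
    (real^'n \<Rightarrow> real) \<Rightarrow> real^'n \<Rightarrow> real" where
  "DN_map s \<Omega> q \<delta>0 C f = normal_deriv \<Omega> (SOME u. small_sol s \<Omega> q C \<delta>0 f u)"

end

(* Linearise twice at the zero solution. With boundary data eps h, h harmonic, the small solutions
   are eps h + O(eps^2), and u1 - u2 has vanishing Cauchy data, so integrating its Laplacian gives
   int (q1 u1^2 - q2 u2^2) = 0 and hence int (q1 - q2) h^2 = 0. Polarisation with products of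
   harmonic functions exp(a.x) cos(b.x + c), where a is orthogonal to b and |a| = |b|, makes q1 - q2
   orthogonal to all plane waves, which are dense by Stone-Weierstrass.

   Well-posedness only bounds the solutions by a fixed constant. That they tend to 0 with the data
   follows by compactness: a limit of solutions is again a small solution (elliptic regularity from
   the interior gradient estimate), with data 0, and is therefore 0 by uniqueness. *)
theory Submission
  imports Defs "HOL-Complex_Analysis.Great_Picard"
begin

section \<open>Partial derivatives\<close>

text \<open>The quadratic term is read off from the order of the error:
  \<open>u^2 = eps^2 h^2 + O(eps^3)\<close> for both solutions, so the integral identity is divided
  by \<open>eps^2\<close> instead of differentiating the solution map. Two obstacles shape the
  proof.

  For \<open>s < 2\<close> the second derivatives of a solution may blow up at the boundary,
  although the equation keeps the Laplacian bounded. Integration by parts therefore rests on a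
  divergence theorem that bounds only the field and its divergence, and that controls the boundary
  term by the decay of the normal component near the boundary.

  Compactness gives smallness without any rate, and only along a subsequence. The maximum principle
  upgrades this smallness to the linear bound \<open>2 eps H\<close> by absorbing the quadratic
  term, and then to the error of order \<open>eps^2\<close>. A subsequence is good enough, because
  some sequence of scalings tending to 0 is all that the division by \<open>eps^2\<close> asks for.

  The regularity theory is kept elementary: comparison functions give the interior gradient
  estimate, and this estimate applied to difference quotients gives the second derivatives.\<close>

definition has_pd :: "(real^'n \<Rightarrow> real) \<Rightarrow> real \<Rightarrow> 'n \<Rightarrow> real^'n \<Rightarrow> bool" where
  "has_pd u D i x \<longleftrightarrow> ((\<lambda>t. u (x + t *\<^sub>R axis i 1)) has_real_derivative D) (at 0)"

lemma has_pd_line: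
  assumes "has_pd u D i (x + t *\<^sub>R axis i 1)"
  shows "((\<lambda>t. u (x + t *\<^sub>R axis i 1)) has_real_derivative D) (at t)"
proof -
  have "((\<lambda>s. u (x + (s + t) *\<^sub>R axis i 1)) has_real_derivative D) (at 0)"
    using assms by (simp add: has_pd_def algebra_simps)
  then show ?thesis
    using DERIV_shift[of "\<lambda>s. u (x + s *\<^sub>R axis i 1)" D 0 t] by simp
qed

lemma has_pd_imp_deriv:
  "has_pd u D i x \<Longrightarrow> deriv (\<lambda>t. u (x + t *\<^sub>R axis i 1)) 0 = D"
  by (simp add: has_pd_def DERIV_imp_deriv)

lemma dpart_Cons_eq: "has_pd (dpart u \<beta>) D i x \<Longrightarrow> dpart u (i # \<beta>) x = D"
  by (simp add: has_pd_imp_deriv)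

lemma has_pd_dpartI:
  "(\<lambda>t. dpart u \<beta> (x + t *\<^sub>R axis i 1)) differentiable (at 0)
    \<Longrightarrow> has_pd (dpart u \<beta>) (dpart u (i # \<beta>) x) i x"
  by (simp add: has_pd_def DERIV_deriv_iff_real_differentiable)

lemma Ck_has_pd:
  "Ck k U u \<Longrightarrow> length \<beta> < k \<Longrightarrow> x \<in> U \<Longrightarrow> has_pd (dpart u \<beta>) (dpart u (i # \<beta>) x) i x"
  by (rule has_pd_dpartI) (auto simp: Ck_def)

lemma Ck_continuous: "Ck k U u \<Longrightarrow> length \<beta> \<le> k \<Longrightarrow> continuous_on U (dpart u \<beta>)"
  by (auto simp: Ck_def)

lemma CkI:
  assumes "\<And>\<beta>. length \<beta> \<le> k \<Longrightarrow> continuous_on U (dpart u \<beta>)"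
    and "\<And>\<beta> i x. length \<beta> < k \<Longrightarrow> x \<in> U \<Longrightarrow> \<exists>D. has_pd (dpart u \<beta>) D i x"
  shows "Ck k U u"
  using assms by (auto simp: Ck_def has_pd_def real_differentiable_def)

lemma Ck_mono: "Ck k U u \<Longrightarrow> l \<le> k \<Longrightarrow> Ck l U u"
  by (auto simp: Ck_def)

lemma Ck_subset: "Ck k U u \<Longrightarrow> V \<subseteq> U \<Longrightarrow> Ck k V u"
  by (auto simp: Ck_def intro: continuous_on_subset)

lemma eventually_line_in_open:
  assumes "open U" "x \<in> U"
  shows "eventually (\<lambda>t. x + t *\<^sub>R (e::'a::real_normed_vector) \<in> U) (nhds (0::real))"
proof -
  have "((\<lambda>t::real. x + t *\<^sub>R e) \<longlongrightarrow> x + 0 *\<^sub>R e) (nhds 0)"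
    by (intro tendsto_intros filterlim_ident)
  then show ?thesis
    using topological_tendstoD[of _ "x + 0 *\<^sub>R e" "nhds 0" U] assms by auto
qed

lemma has_pd_cong_open:
  assumes "open U" "x \<in> U" "\<And>y. y \<in> U \<Longrightarrow> u y = v y"
  shows "has_pd u D i x \<longleftrightarrow> has_pd v D i x"
proof -
  have "eventually (\<lambda>t. u (x + t *\<^sub>R axis i 1) = v (x + t *\<^sub>R axis i 1)) (nhds (0::real))"
    using eventually_line_in_open[OF assms(1,2), of "axis i 1"]
    by eventually_elim (use assms(3) in auto)
  then show ?thesis
    unfolding has_pd_def by (intro DERIV_cong_ev) auto
qed

lemma has_pd_const [simp]: "has_pd (\<lambda>x. c) 0 i x"
  by (simp add: has_pd_def)

lemma has_pd_add: "has_pd u D i x \<Longrightarrow> has_pd v E i x \<Longrightarrow> has_pd (\<lambda>x. u x + v x) (D + E) i x"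
  unfolding has_pd_def by (rule DERIV_add)

lemma has_pd_diff: "has_pd u D i x \<Longrightarrow> has_pd v E i x \<Longrightarrow> has_pd (\<lambda>x. u x - v x) (D - E) i x"
  unfolding has_pd_def by (rule DERIV_diff)

lemma has_pd_cmult: "has_pd u D i x \<Longrightarrow> has_pd (\<lambda>x. c * u x) (c * D) i x"
  unfolding has_pd_def by (rule DERIV_cmult)

lemma has_pd_mult:
  "has_pd u D i x \<Longrightarrow> has_pd v E i x \<Longrightarrow> has_pd (\<lambda>x. u x * v x) (D * v x + E * u x) i x"
  unfolding has_pd_def by (drule (1) DERIV_mult) simp

lemma has_pd_chain:
  "has_pd u D i x \<Longrightarrow> (f has_real_derivative E) (at (u x)) \<Longrightarrow> has_pd (\<lambda>x. f (u x)) (E * D) i x"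
  unfolding has_pd_def
  by (rule DERIV_chain2[where g = "\<lambda>t. u (x + t *\<^sub>R axis i 1)" and x = 0]) auto

lemma has_pd_translate: "has_pd u D i (x + a) \<Longrightarrow> has_pd (\<lambda>x. u (x + a)) D i x"
  by (simp add: has_pd_def algebra_simps)

lemma has_pd_unique: "has_pd u D i x \<Longrightarrow> has_pd u E i x \<Longrightarrow> D = E"
  unfolding has_pd_def by (rule DERIV_unique)

text \<open>Openness of \<open>U\<close> carries the induction: a partial derivative at a point only
  sees nearby values, so an identity known on all of \<open>U\<close> can be differentiated there
  once more.\<close>

lemma dpart_combination:
  assumes "open U" "Ck k U u" "Ck k U v" "length \<beta> \<le> k" "x \<in> U"
  shows "dpart (\<lambda>x. a * u x + b * v x) \<beta> x = a * dpart u \<beta> x + b * dpart v \<beta> x"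
  using assms(4,5)
proof (induction \<beta> arbitrary: x)
  case (Cons i \<beta>)
  have "has_pd (\<lambda>x. a * dpart u \<beta> x + b * dpart v \<beta> x) (a * dpart u (i#\<beta>) x + b * dpart v (i#\<beta>) x) i x"
    using Cons.prems by (intro has_pd_add has_pd_cmult Ck_has_pd[OF assms(2)] Ck_has_pd[OF assms(3)]) auto
  then have "has_pd (dpart (\<lambda>x. a * u x + b * v x) \<beta>) (a * dpart u (i#\<beta>) x + b * dpart v (i#\<beta>) x) i x"
    using has_pd_cong_open[OF assms(1) Cons.prems(2), of "dpart (\<lambda>x. a * u x + b * v x) \<beta>"
         "\<lambda>x. a * dpart u \<beta> x + b * dpart v \<beta> x"]
      Cons.IH Cons.prems by auto
  then show ?case by (rule dpart_Cons_eq)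
qed auto

lemma Ck_combination:
  assumes "open U" "Ck k U u" "Ck k U v"
  shows "Ck k U (\<lambda>x. a * u x + b * v x)"
proof (rule CkI)
  fix \<beta> :: "'a list" assume "length \<beta> \<le> k"
  then have "continuous_on U (\<lambda>x. a * dpart u \<beta> x + b * dpart v \<beta> x)"
    by (intro continuous_intros Ck_continuous[OF assms(2)] Ck_continuous[OF assms(3)])
  then show "continuous_on U (dpart (\<lambda>x. a * u x + b * v x) \<beta>)"
    by (rule continuous_on_eq) (simp add: dpart_combination[OF assms] \<open>length \<beta> \<le> k\<close>)
next
  fix \<beta> :: "'a list" and i x assume *: "length \<beta> < k" "x \<in> U"
  have "has_pd (\<lambda>x. a * dpart u \<beta> x + b * dpart v \<beta> x) (a * dpart u (i#\<beta>) x + b * dpart v (i#\<beta>) x) i x"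
    using * by (intro has_pd_add has_pd_cmult Ck_has_pd[OF assms(2)] Ck_has_pd[OF assms(3)]) auto
  then show "\<exists>D. has_pd (dpart (\<lambda>x. a * u x + b * v x) \<beta>) D i x"
    using has_pd_cong_open[OF assms(1) *(2), of "dpart (\<lambda>x. a * u x + b * v x) \<beta>"
         "\<lambda>x. a * dpart u \<beta> x + b * dpart v \<beta> x"]
      dpart_combination[OF assms] * by auto
qed

text \<open>Besides the mean value, the distance of the intermediate point is recorded; the
  interpolation between orders of derivatives later compares the value there with the value at
  \<open>x\<close> by a Hoelder bound.\<close>

lemma has_pd_mvt:
  assumes "convex S" "x \<in> S" "x + t *\<^sub>R axis i 1 \<in> S"
    and "\<And>y. y \<in> S \<Longrightarrow> has_pd u (D y) i y"
  shows "\<exists>y\<in>S. norm (y - x) \<le> \<bar>t\<bar> \<and> u (x + t *\<^sub>R axis i 1) - u x = t * D y"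
proof -
  let ?f = "\<lambda>s. u (x + s *\<^sub>R axis i 1)"
  have inS: "x + s *\<^sub>R axis i 1 \<in> S" if "s \<in> closed_segment 0 t" for s
  proof -
    obtain c where c: "0 \<le> c" "c \<le> 1" "s = c * t"
      using \<open>s \<in> closed_segment 0 t\<close> by (auto simp: in_segment)
    have "(1 - c) *\<^sub>R x + c *\<^sub>R (x + t *\<^sub>R axis i 1) \<in> S"
      using assms c by (intro convexD) auto
    then show ?thesis using c by (simp add: algebra_simps)
  qed
  have d: "(?f has_real_derivative D (x + s *\<^sub>R axis i 1)) (at s)" if "s \<in> closed_segment 0 t" for s
    using has_pd_line[OF assms(4)[OF inS[OF that]]] .
  show ?thesis
  proof (cases t "0::real" rule: linorder_cases)
    case equal then show ?thesis using assms by auto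
  next
    case less
    then obtain z where z: "z > t" "z < 0" "?f 0 - ?f t = (0 - t) * D (x + z *\<^sub>R axis i 1)"
      using MVT2[of t 0 ?f "\<lambda>s. D (x + s *\<^sub>R axis i 1)"] d by (auto simp: closed_segment_eq_real_ivl)
    have m: "z \<in> closed_segment 0 t" using less z by (auto simp: closed_segment_eq_real_ivl)
    from z less have "norm ((x + z *\<^sub>R axis i 1) - x) \<le> \<bar>t\<bar>" by simp
    moreover have "u (x + t *\<^sub>R axis i 1) - u x = t * D (x + z *\<^sub>R axis i 1)"
      using z(3) by simp
    ultimately show ?thesis using inS[OF m] by blast
  next
    case greater
    then obtain z where z: "z > 0" "z < t" "?f t - ?f 0 = (t - 0) * D (x + z *\<^sub>R axis i 1)"
      using MVT2[of 0 t ?f "\<lambda>s. D (x + s *\<^sub>R axis i 1)"] d by (auto simp: closed_segment_eq_real_ivl)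
    have m: "z \<in> closed_segment 0 t" using greater z by (auto simp: closed_segment_eq_real_ivl)
    from z greater have "norm ((x + z *\<^sub>R axis i 1) - x) \<le> \<bar>t\<bar>" by simp
    moreover have "u (x + t *\<^sub>R axis i 1) - u x = t * D (x + z *\<^sub>R axis i 1)"
      using z(3) by simp
    ultimately show ?thesis using inS[OF m] by blast
  qed
qed

lemma norm_partial_vec_le:
  fixes v :: "real^'n"
  shows "norm (\<chi> j. if j \<in> S then v $ j else 0) \<le> norm v"
  unfolding norm_vec_def L2_set_def
  by (intro real_sqrt_le_mono sum_mono) auto

text \<open>The increment is built up one coordinate at a time. Each step is a one-dimensional mean
  value, and continuity of the partial derivatives replaces the intermediate point by
  \<open>x\<close> at the cost of \<open>e'\<close>.\<close>

lemma has_derivative_of_pd: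
  fixes u :: "real^'n \<Rightarrow> real"
  assumes "open U" "x \<in> U"
    and pd: "\<And>i y. y \<in> U \<Longrightarrow> has_pd u (D i y) i y"
    and cont: "\<And>i. continuous_on U (D i)"
  shows "(u has_derivative (\<lambda>v. \<Sum>i\<in>UNIV. D i x * v $ i)) (at x)"
  unfolding has_derivative_at_alt
proof (intro conjI allI impI)
  show "bounded_linear (\<lambda>v. \<Sum>i\<in>UNIV. D i x * v $ i)"
    by (intro bounded_linear_sum bounded_linear_const_mult bounded_linear_vec_nth)
  fix e :: real assume e: "e > 0"
  \<comment> \<open>Each of the \<open>CARD('n)\<close> coordinate steps may contribute an error
    \<open>e' * norm v\<close>.\<close>
  define e' where "e' = e / CARD('n)"
  have e': "e' > 0" using e by (simp add: e'_def)
  have "\<forall>i. \<exists>d>0. \<forall>y. dist y x < d \<longrightarrow> y \<in> U \<and> \<bar>D i y - D i x\<bar> < e'"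
  proof
    fix i
    have "isCont (D i) x" using cont assms(1,2) by (simp add: continuous_on_eq_continuous_at)
    then obtain d1 where d1: "d1 > 0" "\<forall>y. dist y x < d1 \<longrightarrow> dist (D i y) (D i x) < e'"
      using e' unfolding continuous_at_eps_delta by blast
    obtain d2 where d2: "d2 > 0" "ball x d2 \<subseteq> U" using assms(1,2) openE by blast
    show "\<exists>d>0. \<forall>y. dist y x < d \<longrightarrow> y \<in> U \<and> \<bar>D i y - D i x\<bar> < e'"
      using d1 d2 by (intro exI[of _ "min d1 d2"]) (auto simp: dist_real_def subset_eq dist_commute)
  qed
  then obtain d where d: "\<And>i. d i > 0" "\<And>i y. dist y x < d i \<Longrightarrow> y \<in> U \<and> \<bar>D i y - D i x\<bar> < e'"
    by metis
  define r where "r = Min (range d)"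
  have r: "r > 0" unfolding r_def using d(1) by (subst Min_gr_iff) auto
  have rd: "r \<le> d i" for i unfolding r_def by (rule Min_le) auto
  have near: "y \<in> U \<and> \<bar>D i y - D i x\<bar> < e'" if "dist y x < r" for i y
    using d(2)[of y i] rd[of i] that by auto
  show "\<exists>d>0. \<forall>y. norm (y - x) < d \<longrightarrow>
     norm (u y - u x - (\<Sum>i\<in>UNIV. D i x * (y - x) $ i)) \<le> e * norm (y - x)"
  proof (intro exI[of _ r] conjI allI impI r)
    fix y assume y: "norm (y - x) < r"
    define v where "v = y - x"
    \<comment> \<open>Coordinates in \<open>S\<close> are those of \<open>v\<close>, the others
      vanish. Inserting \<open>k\<close> thus moves parallel to the axis \<open>k\<close> and, by
      \<open>norm_partial_vec_le\<close>, never leaves the ball.\<close>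
    define p where "p S = (\<chi> j. if j \<in> S then v $ j else 0)" for S
    have step: "\<bar>u (x + p S) - u x - (\<Sum>i\<in>S. D i x * v $ i)\<bar> \<le> card S * (e' * norm v)"
      if "finite S" for S
      using that
    proof (induction S)
      case empty
      have "p {} = 0" by (simp add: p_def vec_eq_iff)
      then show ?case by simp
    next
      case (insert k S)
      have pk: "p (insert k S) = p S + (v $ k) *\<^sub>R axis k 1"
        using insert.hyps by (auto simp: p_def vec_eq_iff axis_def)
      have pn: "norm (p T) < r" for T
        using norm_partial_vec_le[of T v] y unfolding p_def v_def by linarith
      have "x + p S \<in> ball x r" "(x + p S) + (v $ k) *\<^sub>R axis k 1 \<in> ball x r"
        using pn[of S] pn[of "insert k S"]
        by (simp_all only: mem_ball dist_norm pk add.assoc[symmetric]) 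
          (simp_all only: norm_minus_commute[of x] add_diff_cancel_left' add.assoc)
      moreover have "has_pd u (D k z) k z" if "z \<in> ball x r" for z
        using near[of z] pd that by (auto simp: dist_commute)
      ultimately obtain z where z: "z \<in> ball x r"
        "u ((x + p S) + (v $ k) *\<^sub>R axis k 1) - u (x + p S) = v $ k * D k z"
        using has_pd_mvt[of "ball x r" "x + p S" "v $ k" k u "D k"] by auto
      have "\<bar>v $ k * D k z - D k x * v $ k\<bar> = \<bar>v $ k\<bar> * \<bar>D k z - D k x\<bar>"
        by (simp add: abs_mult[symmetric] algebra_simps)
      also have "\<dots> \<le> norm v * e'"
        using near[of z k] z(1) component_le_norm_cart[of v k]
        by (intro mult_mono) (auto simp: dist_commute)
      finally have "\<bar>v $ k * D k z - D k x * v $ k\<bar> \<le> e' * norm v" by (simp add: mult.commute)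
      then show ?case
        using insert z(2) by (simp add: pk add.assoc algebra_simps)
    qed
    have "p UNIV = v" by (simp add: p_def vec_eq_iff)
    then have "\<bar>u y - u x - (\<Sum>i\<in>UNIV. D i x * v $ i)\<bar> \<le> CARD('n) * (e' * norm v)"
      using step[of UNIV] by (simp add: v_def)
    then show "norm (u y - u x - (\<Sum>i\<in>UNIV. D i x * (y - x) $ i)) \<le> e * norm (y - x)"
      by (simp add: v_def e'_def)
  qed
qed

lemma Ck_has_derivative:
  assumes "open U" "Ck k U u" "length \<beta> < k" "x \<in> U"
  shows "(dpart u \<beta> has_derivative (\<lambda>v. \<Sum>i\<in>UNIV. dpart u (i#\<beta>) x * v $ i)) (at x)"
  using assms by (intro has_derivative_of_pd[OF assms(1,4), where D = "\<lambda>i. dpart u (i#\<beta>)"])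
    (auto simp del: dpart.simps intro!: Ck_has_pd Ck_continuous)

text \<open>The operator norm of the gradient is bounded by the sum of its entries, hence the factor
  \<open>CARD('n)\<close>.\<close>

lemma Ck_lipschitz:
  fixes u :: "real^'n \<Rightarrow> real" and B :: real
  assumes "open U" "Ck k U u" "length \<beta> < k" "convex S" "S \<subseteq> U" "x \<in> S" "y \<in> S"
    and B: "\<And>i z. z \<in> S \<Longrightarrow> \<bar>dpart u (i#\<beta>) z\<bar> \<le> B"
  shows "\<bar>dpart u \<beta> x - dpart u \<beta> y\<bar> \<le> CARD('n) * B * norm (x - y)"
proof -
  have B0: "0 \<le> B" using B[OF assms(6)] by (meson abs_ge_zero order_trans)
  have "norm (dpart u \<beta> x - dpart u \<beta> y) \<le> (CARD('n) * B) * norm (x - y)"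
  proof (rule differentiable_bound[OF assms(4) _ _ assms(6,7)])
    fix z assume z: "z \<in> S"
    show "(dpart u \<beta> has_derivative (\<lambda>v. \<Sum>i\<in>UNIV. dpart u (i#\<beta>) z * v $ i)) (at z within S)"
      using Ck_has_derivative[OF assms(1-3)] z assms(5) has_derivative_at_withinI by blast
    show "onorm (\<lambda>v. \<Sum>i\<in>UNIV. dpart u (i#\<beta>) z * v $ i) \<le> CARD('n) * B"
    proof (rule onorm_bound)
      show "0 \<le> CARD('n) * B" using B0 by simp
      fix v :: "real^'n"
      have "norm (\<Sum>i\<in>UNIV. dpart u (i#\<beta>) z * v $ i) \<le> (\<Sum>i\<in>(UNIV::'n set). B * norm v)"
      proof (rule sum_norm_le)
        fix i
        show "norm (dpart u (i#\<beta>) z * v $ i) \<le> B * norm v"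
          unfolding real_norm_def abs_mult using B[OF z, of i] component_le_norm_cart[of v i] B0
          by (intro mult_mono) auto
      qed
      then show "norm (\<Sum>i\<in>UNIV. dpart u (i#\<beta>) z * v $ i) \<le> CARD('n) * B * norm v" by simp
    qed
  qed
  then show ?thesis by simp
qed

section \<open>The maximum principle and the interior gradient estimate\<close>

text \<open>A second derivative along one line only, with the first derivative \<open>D\<close> as a
  function of the parameter near 0. Barriers and reflected functions obtain theirs by calculus
  rules, without going through \<open>dpart\<close>.\<close>

definition has_pd2 :: "(real^'n \<Rightarrow> real) \<Rightarrow> real \<Rightarrow> 'n \<Rightarrow> real^'n \<Rightarrow> bool" where
  "has_pd2 u L i x \<longleftrightarrow> (\<exists>D. (\<forall>\<^sub>F t in nhds 0. ((\<lambda>t. u (x + t *\<^sub>R axis i 1)) has_real_derivative D t) (at t))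
      \<and> (D has_real_derivative L) (at 0))"

lemma has_pd2_add: "has_pd2 u L i x \<Longrightarrow> has_pd2 v K i x \<Longrightarrow> has_pd2 (\<lambda>x. u x + v x) (L + K) i x"
  unfolding has_pd2_def
proof (elim exE conjE)
  fix D E
  assume *: "\<forall>\<^sub>F t in nhds 0. ((\<lambda>t. u (x + t *\<^sub>R axis i 1)) has_real_derivative D t) (at t)"
    "\<forall>\<^sub>F t in nhds 0. ((\<lambda>t. v (x + t *\<^sub>R axis i 1)) has_real_derivative E t) (at t)"
    "(D has_real_derivative L) (at 0)" "(E has_real_derivative K) (at 0)"
  show "\<exists>D. (\<forall>\<^sub>F t in nhds 0. ((\<lambda>t. u (x + t *\<^sub>R axis i 1) + v (x + t *\<^sub>R axis i 1)) has_real_derivative D t) (at t))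
      \<and> (D has_real_derivative L + K) (at 0)"
    using eventually_conj[OF *(1,2)]
    by (intro exI[of _ "\<lambda>t. D t + E t"] conjI DERIV_add *(3,4))
      (auto elim!: eventually_mono intro: DERIV_add)
qed

lemma has_pd2_cmult: "has_pd2 u L i x \<Longrightarrow> has_pd2 (\<lambda>x. c * u x) (c * L) i x"
  unfolding has_pd2_def
proof (elim exE conjE)
  fix D
  assume *: "\<forall>\<^sub>F t in nhds 0. ((\<lambda>t. u (x + t *\<^sub>R axis i 1)) has_real_derivative D t) (at t)"
    "(D has_real_derivative L) (at 0)"
  show "\<exists>D. (\<forall>\<^sub>F t in nhds 0. ((\<lambda>t. c * u (x + t *\<^sub>R axis i 1)) has_real_derivative D t) (at t))
      \<and> (D has_real_derivative c * L) (at 0)"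
    using *(1)
    by (intro exI[of _ "\<lambda>t. c * D t"] conjI DERIV_cmult *(2))
      (auto elim!: eventually_mono intro: DERIV_cmult)
qed

lemma has_pd2_diff: "has_pd2 u L i x \<Longrightarrow> has_pd2 v K i x \<Longrightarrow> has_pd2 (\<lambda>x. u x - v x) (L - K) i x"
  using has_pd2_add[OF _ has_pd2_cmult[of v K i x "-1"], of u L] by simp

lemma has_pd2_const: "has_pd2 (\<lambda>x. c) 0 i x"
  unfolding has_pd2_def by (intro exI[of _ "\<lambda>t. 0"]) auto

lemma has_pd2_component:
  "has_pd2 (\<lambda>x. x $ k - c) 0 i x"
  unfolding has_pd2_def
  by (intro exI[of _ "\<lambda>t. axis i 1 $ k"] conjI always_eventually allI)
    (auto intro!: derivative_eq_intros)

lemma has_pd2_component_sq: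
  "has_pd2 (\<lambda>x. (x $ k - c)\<^sup>2) (if i = k then 2 else 0) i x"
  unfolding has_pd2_def
  by (intro exI[of _ "\<lambda>t. 2 * (x $ k + t * axis i 1 $ k - c) * (axis i 1 $ k)"] conjI always_eventually allI)
    (auto intro!: derivative_eq_intros simp: axis_def)

lemma has_pd2_norm_sq:
  "has_pd2 (\<lambda>x. (x - a) \<bullet> (x - a)) 2 i x"
proof -
  have *: "(x + t *\<^sub>R axis i 1 - a) \<bullet> (x + t *\<^sub>R axis i 1 - a)
     = (x - a) \<bullet> (x - a) + 2 * t * ((x - a) $ i) + t\<^sup>2" for t
    by (simp add: inner_axis inner_axis' algebra_simps power2_eq_square inner_commute inner_axis_axis)
  show ?thesis
    unfolding has_pd2_def *
    by (intro exI[of _ "\<lambda>t. 2 * ((x - a) $ i) + 2 * t"] conjI always_eventually allI)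
      (auto intro!: derivative_eq_intros)
qed

lemma Ck_has_pd2:
  assumes "open U" "Ck 2 U u" "x \<in> U"
  shows "has_pd2 u (dpart u [i, i] x) i x"
  unfolding has_pd2_def
proof (intro exI conjI)
  show "\<forall>\<^sub>F t in nhds 0. ((\<lambda>t. u (x + t *\<^sub>R axis i 1)) has_real_derivative dpart u [i] (x + t *\<^sub>R axis i 1)) (at t)"
    using eventually_line_in_open[OF assms(1,3), of "axis i 1"]
  proof eventually_elim
    case (elim t)
    then show ?case
      using has_pd_line[OF Ck_has_pd[OF assms(2), of "[]" _ i]] by simp
  qed
  show "((\<lambda>t. dpart u [i] (x + t *\<^sub>R axis i 1)) has_real_derivative dpart u [i, i] x) (at 0)"
    using Ck_has_pd[OF assms(2), of "[i]" x i] assms(3) unfolding has_pd_def by simp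
qed

text \<open>Reflection in the hyperplane where coordinate \<open>k\<close> equals \<open>c\<close>
  carries lines in the other directions to parallel ones and reverses lines in direction
  \<open>k\<close>; there the two sign changes of the derivatives cancel.\<close>

lemma has_pd2_reflect:
  assumes "has_pd2 u L i (x - (2 * (x $ k - c)) *\<^sub>R axis k 1)"
  shows "has_pd2 (\<lambda>x. u (x - (2 * (x $ k - c)) *\<^sub>R axis k 1)) L i x"
proof -
  define y where "y = x - (2 * (x $ k - c)) *\<^sub>R axis k 1"
  obtain D where D: "\<forall>\<^sub>F t in nhds 0. ((\<lambda>t. u (y + t *\<^sub>R axis i 1)) has_real_derivative D t) (at t)"
    "(D has_real_derivative L) (at 0)"
    using assms unfolding has_pd2_def y_def by blast
  show ?thesis
  proof (cases "i = k")
    case False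
    have "x + t *\<^sub>R axis i 1 - (2 * ((x + t *\<^sub>R axis i 1) $ k - c)) *\<^sub>R axis k 1 = y + t *\<^sub>R axis i 1" for t
      using False by (simp add: y_def axis_def vec_eq_iff)
    then show ?thesis using D unfolding has_pd2_def by (simp only:) blast
  next
    case True
    have *: "x + t *\<^sub>R axis i 1 - (2 * ((x + t *\<^sub>R axis i 1) $ k - c)) *\<^sub>R axis k 1 = y + (- t) *\<^sub>R axis i 1" for t
      using True by (simp add: y_def axis_def vec_eq_iff)
    have "filterlim (\<lambda>t. - t) (nhds (- 0::real)) (nhds 0)"
      by (intro tendsto_intros filterlim_ident)
    then have "\<forall>\<^sub>F t in nhds 0. ((\<lambda>t. u (y + t *\<^sub>R axis i 1)) has_real_derivative D (- t)) (at (- t))"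
      using eventually_compose_filterlim[OF D(1), of uminus "nhds 0"] by simp
    then have "\<forall>\<^sub>F t in nhds 0. ((\<lambda>t. u (y + (- t) *\<^sub>R axis i 1)) has_real_derivative - D (- t)) (at t)"
      by eventually_elim (drule DERIV_mirror[THEN iffD1], simp)
    moreover have "((\<lambda>t. - D (- t)) has_real_derivative L) (at 0)"
      using DERIV_minus[of "\<lambda>t. D (- t)" "- L" 0] DERIV_mirror[of D L 0] D(2) by simp
    ultimately show ?thesis unfolding has_pd2_def * by (intro exI[of _ "\<lambda>t. - D (- t)"] conjI)
  qed
qed

text \<open>A positive \<open>L\<close> would make \<open>D\<close>, which vanishes at the maximum,
  positive just to the right of 0, and \<open>f\<close> would increase there.\<close>

lemma second_deriv_at_local_max:
  fixes f :: "real \<Rightarrow> real"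
  assumes d: "\<forall>\<^sub>F t in nhds 0. (f has_real_derivative D t) (at t)"
    and L: "(D has_real_derivative L) (at 0)"
    and max: "\<forall>\<^sub>F t in nhds 0. f t \<le> f 0"
  shows "L \<le> 0"
proof (rule ccontr)
  assume "\<not> L \<le> 0"
  obtain r where r: "r > 0" "\<And>t. \<bar>t\<bar> < r \<Longrightarrow> (f has_real_derivative D t) (at t)" "\<And>t. \<bar>t\<bar> < r \<Longrightarrow> f t \<le> f 0"
    using eventually_conj[OF d max] unfolding eventually_nhds_metric by (auto simp: dist_real_def)
  have D0: "D 0 = 0"
    using r by (intro DERIV_local_max[of f "D 0" 0 r]) auto
  obtain e where e: "e > 0" "\<And>h. 0 < h \<Longrightarrow> h < e \<Longrightarrow> D 0 < D (0 + h)"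
    using DERIV_pos_inc_right[OF L] \<open>\<not> L \<le> 0\<close> by auto
  define h where "h = min r e / 2"
  have h: "0 < h" "h < r" "h < e" using r(1) e(1) by (auto simp: h_def)
  obtain z where z: "0 < z" "z < h" "f h - f 0 = (h - 0) * D z"
    using MVT2[of 0 h f D] h r(2) by auto
  have "D z > 0" using e(2)[of z] z h D0 by simp
  then have "f h > f 0" using z(3) h(1) by (simp add: algebra_simps)
  then show False using r(3)[of h] h by simp
qed

text \<open>The sign of the Laplacian is only weak, so a small multiple of the squared norm is
  added: the perturbed function has a strictly positive Laplacian and cannot have an interior
  maximum.\<close>

lemma weak_maximum_principle:
  fixes g :: "real^'n \<Rightarrow> real"
  assumes U: "open U" "bounded U" and cont: "continuous_on (closure U) g"
    and L: "\<And>i x. x \<in> U \<Longrightarrow> has_pd2 g (L i x) i x"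
    and sub: "\<And>x. x \<in> U \<Longrightarrow> (\<Sum>i\<in>UNIV. L i x) \<ge> 0"
    and bd: "\<And>x. x \<in> frontier U \<Longrightarrow> g x \<le> 0"
    and x: "x \<in> closure U"
  shows "g x \<le> 0"
proof (rule ccontr)
  assume "\<not> g x \<le> 0"
  then have pos: "g x > 0" by simp
  have comp: "compact (closure U)" using U by simp
  then obtain R where R: "\<And>y. y \<in> closure U \<Longrightarrow> norm y \<le> R" "R > 0"
    using compact_imp_bounded bounded_pos by metis
  \<comment> \<open>\<open>e * R\<^sup>2\<close> is half of \<open>g x\<close>, so the perturbation
    cannot lift a boundary value, which is at most 0, up to \<open>g x\<close>.\<close>
  define e where "e = g x / (2 * R\<^sup>2)"
  have e: "e > 0" using pos R(2) by (simp add: e_def)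
  \<comment> \<open>\<open>y - 0\<close> rather than \<open>y\<close> fits the shape of
    \<open>has_pd2_norm_sq\<close>.\<close>
  define G where "G y = g y + e * ((y - 0) \<bullet> (y - 0))" for y
  have "continuous_on (closure U) G"
    unfolding G_def by (intro continuous_intros cont)
  moreover have "closure U \<noteq> {}" using x by (metis empty_iff)
  ultimately obtain z where z: "z \<in> closure U" "\<And>y. y \<in> closure U \<Longrightarrow> G y \<le> G z"
    using continuous_attains_sup[OF comp] by metis
  have "z \<notin> frontier U"
  proof
    assume "z \<in> frontier U"
    then have "G z \<le> e * (norm z)\<^sup>2" using bd by (simp add: G_def power2_norm_eq_inner)
    also have "\<dots> \<le> e * R\<^sup>2" using R(1)[OF z(1)] e by (intro mult_left_mono power_mono) auto
    also have "\<dots> < g x" using R(2) pos by (simp add: e_def)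
    also have "\<dots> \<le> G x" using e by (simp add: G_def)
    finally show False using z(2)[OF x] by simp
  qed
  then have zU: "z \<in> U" using z(1) U(1) by (simp add: frontier_def interior_open)
  have "L i z + e * 2 \<le> 0" for i
  proof -
    have "has_pd2 G (L i z + e * 2) i z"
      unfolding G_def by (intro has_pd2_add has_pd2_cmult has_pd2_norm_sq L zU)
    then obtain D where D: "\<forall>\<^sub>F t in nhds 0. ((\<lambda>t. G (z + t *\<^sub>R axis i 1)) has_real_derivative D t) (at t)"
      "(D has_real_derivative L i z + e * 2) (at 0)" unfolding has_pd2_def by blast
    show ?thesis
      using eventually_line_in_open[OF U(1) zU, of "axis i 1"] z(2) closure_subset[of U]
      by (intro second_deriv_at_local_max[OF D]) (auto elim!: eventually_mono)
  qed
  then have "(\<Sum>i\<in>(UNIV::'n set). L i z + e * 2) \<le> 0" by (intro sum_nonpos) auto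
  then have "(\<Sum>i\<in>UNIV. L i z) + CARD('n) * (e * 2) \<le> 0" by (simp add: sum.distrib)
  moreover have "CARD('n) * (e * 2) > 0" using e by simp
  ultimately show False using sub[OF zU] by linarith
qed

text \<open>Both \<open>v\<close> and \<open>- v\<close> are compared with the paraboloid
  \<open>N / 2 * (R\<^sup>2 - x \<bullet> x)\<close>, which is non-negative on the closure and whose
  Laplacian is at most \<open>- N\<close>.\<close>

lemma maximum_principle_bound:
  fixes v :: "real^'n \<Rightarrow> real"
  assumes U: "open U" "bounded U" and cont: "continuous_on (closure U) v"
    and L: "\<And>i x. x \<in> U \<Longrightarrow> has_pd2 v (L i x) i x"
    and N: "\<And>x. x \<in> U \<Longrightarrow> \<bar>\<Sum>i\<in>UNIV. L i x\<bar> \<le> N"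
    and bd: "\<And>x. x \<in> frontier U \<Longrightarrow> v x = 0"
    and R: "\<And>x. x \<in> closure U \<Longrightarrow> norm x \<le> R"
    and N0: "N \<ge> 0"
    and x: "x \<in> closure U"
  shows "\<bar>v x\<bar> \<le> N * R\<^sup>2"
proof -
  have psi: "(x - 0) \<bullet> (x - 0) \<le> R\<^sup>2" if "x \<in> closure U" for x
    using R[OF that] power_mono[of "norm x" R 2] by (simp add: power2_norm_eq_inner)
  have "c * v x + N / 2 * ((x - 0) \<bullet> (x - 0)) + (- N / 2 * R\<^sup>2) \<le> 0" if c: "c = 1 \<or> c = -1" for c
  proof (rule weak_maximum_principle[OF U _ _ _ _ x])
    show "continuous_on (closure U) (\<lambda>x. c * v x + N / 2 * ((x - 0) \<bullet> (x - 0)) + (- N / 2 * R\<^sup>2))"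
      by (intro continuous_intros cont)
    show "has_pd2 (\<lambda>x. c * v x + N / 2 * ((x - 0) \<bullet> (x - 0)) + (- N / 2 * R\<^sup>2)) (c * L i x + N / 2 * 2 + 0) i x"
      if "x \<in> U" for i x
      by (intro has_pd2_add has_pd2_cmult has_pd2_norm_sq has_pd2_const L that)
    show "0 \<le> (\<Sum>i\<in>UNIV. c * L i x + N / 2 * 2 + 0)" if "x \<in> U" for x
    proof -
      have "1 * N \<le> CARD('n) * N" using N0 by (intro mult_right_mono) (auto simp: Suc_leI)
      then show ?thesis
        using abs_le_D1[OF N[OF that]] abs_le_D2[OF N[OF that]] c by (auto simp: sum.distrib sum_negf)
    qed
    show "c * v x + N / 2 * ((x - 0) \<bullet> (x - 0)) + (- N / 2 * R\<^sup>2) \<le> 0" if "x \<in> frontier U" for x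
      using bd[OF that] psi[of x] that N0 mult_left_mono[of "(x - 0) \<bullet> (x - 0)" "R\<^sup>2" "N/2"]
      by (auto simp: frontier_def)
  qed
  from this[of 1] this[of "-1"] have "\<bar>v x\<bar> + N / 2 * (x \<bullet> x) \<le> N / 2 * R\<^sup>2" by auto
  moreover have "N / 2 * (x \<bullet> x) \<ge> 0" using N0 by simp
  moreover have "N / 2 * R\<^sup>2 \<le> N * R\<^sup>2" using N0 by simp
  ultimately show ?thesis by linarith
qed

text \<open>Comparison on a half cube with the odd part of \<open>v\<close> under reflection
  (Gilbarg--Trudinger, Section 3.4).\<close>
lemma interior_gradient_estimate:
  fixes v :: "real^'n \<Rightarrow> real" and M N d :: real
  assumes U: "open U" "Ck 2 U v" and d: "d > 0"
    and cube: "\<And>x. (\<And>i. \<bar>x $ i - a $ i\<bar> \<le> d) \<Longrightarrow> x \<in> U \<and> \<bar>v x\<bar> \<le> M \<and> \<bar>laplacian v x\<bar> \<le> N"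
  shows "\<bar>dpart v [k] a\<bar> \<le> CARD('n) * M / d + N * d / 2"
proof -
  define n where "n = real CARD('n)"
  define y where "y x = x $ k - a $ k" for x :: "real^'n"
  define R where "R x = x - (2 * (x $ k - a $ k)) *\<^sub>R axis k 1" for x :: "real^'n"
  \<comment> \<open>With this \<open>A\<close> the barrier \<open>psi\<close>, which is \<open>M /
    d\<^sup>2 * ((x - a) \<bullet> (x - a)) + A * y * (d - y)\<close> for
    \<open>y = x $ k - a $ k\<close>, has Laplacian
    \<open>2 * n * M / d\<^sup>2 - 2 * A = - N\<close>.\<close>
  define A where "A = n * M / d\<^sup>2 + N / 2"
  define psi where "psi x = M / d\<^sup>2 * ((x - a) \<bullet> (x - a)) + A * d * (x $ k - a $ k) + (- A) * (x $ k - a $ k)\<^sup>2"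
    for x :: "real^'n"
  define V where "V = {x. (\<forall>i. \<bar>x $ i - a $ i\<bar> < d) \<and> x $ k > a $ k}"
  define W where "W = {x. (\<forall>i. \<bar>x $ i - a $ i\<bar> \<le> d) \<and> x $ k \<ge> a $ k}"
  have M0: "M \<ge> 0" and N0: "N \<ge> 0"
    using cube[of a] d by auto
  have n1: "n \<ge> 1" by (simp add: n_def Suc_leI)
  have A0: "A \<ge> 0" using M0 N0 n1 by (simp add: A_def)
  have Vo: "open V"
    unfolding V_def Collect_conj_eq Collect_all_eq
    by (intro open_Int open_INT finite ballI open_Collect_less continuous_intros)
  have Wc: "closed W"
    unfolding W_def by (intro closed_Collect_conj closed_Collect_all closed_Collect_le continuous_intros)
  have VW: "closure V \<subseteq> W"
    by (intro closure_minimal Wc) (auto simp: V_def W_def less_imp_le)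
  have Rin: "\<bar>R x $ i - a $ i\<bar> \<le> d" if "x \<in> W" for x i
  proof (cases "i = k")
    case True
    then have "R x $ i - a $ i = - (x $ k - a $ k)" by (simp add: R_def)
    then show ?thesis using that True unfolding W_def by (metis (mono_tags, lifting) abs_minus_cancel mem_Collect_eq)
  next
    case False
    then have "R x $ i = x $ i" by (simp add: R_def axis_def)
    then show ?thesis using that by (simp add: W_def)
  qed
  have xin: "\<bar>x $ i - a $ i\<bar> \<le> d" if "x \<in> W" for x i using that by (simp add: W_def)
  have Vb: "bounded V"
  proof -
    have "V \<subseteq> cbox (\<chi> i. a $ i - d) (\<chi> i. a $ i + d)"
    proof
      fix x assume "x \<in> V"
      then have "\<bar>x $ i - a $ i\<bar> < d" for i by (simp add: V_def)
      then have "a $ i - d \<le> x $ i \<and> x $ i \<le> a $ i + d" for i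
        by (smt (verit))
      then show "x \<in> cbox (\<chi> i. a $ i - d) (\<chi> i. a $ i + d)"
        by (simp add: mem_box_cart)
    qed
    then show ?thesis using bounded_cbox bounded_subset by blast
  qed
  have vc: "continuous_on U v" using Ck_continuous[OF U(2), of "[]"] by simp
  \<comment> \<open>The sign \<open>c\<close> treats the odd part \<open>(v x - v (R x)) / 2\<close>
    and its negative at once. On the face in the mirror hyperplane the odd part vanishes and
    \<open>psi\<close> is non-negative; on the outer faces \<open>psi\<close> is at least
    \<open>M\<close>.\<close>
  have key: "c * ((v x - v (R x)) / 2) \<le> psi x" if c: "c = 1 \<or> c = -1" and x: "x \<in> closure V" for c x
  proof -
    have "(c / 2) * v x + (- c / 2) * v (R x) - psi x \<le> 0"
    proof (rule weak_maximum_principle[OF Vo Vb _ _ _ _ x])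
      have "continuous_on (closure V) R" unfolding R_def by (intro continuous_intros)
      moreover have "R ` closure V \<subseteq> U" using VW Rin cube by blast
      ultimately have "continuous_on (closure V) (\<lambda>x. v (R x))"
        using continuous_on_compose2[OF vc] by blast
      moreover have "continuous_on (closure V) v"
        using VW xin cube by (intro continuous_on_subset[OF vc]) blast
      ultimately show "continuous_on (closure V) (\<lambda>x. (c / 2) * v x + (- c / 2) * v (R x) - psi x)"
        unfolding psi_def by (intro continuous_intros)
    next
      fix i x assume "x \<in> V"
      then have xW: "x \<in> W" using VW closure_subset by blast
      have xU: "x \<in> U" and RU: "R x \<in> U" using cube xin[OF xW] Rin[OF xW] by blast+
      show "has_pd2 (\<lambda>x. (c / 2) * v x + (- c / 2) * v (R x) - psi x)
        ((c / 2) * dpart v [i,i] x + (- c / 2) * dpart v [i,i] (R x)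
          - (M / d\<^sup>2 * 2 + A * d * 0 + (- A) * (if i = k then 2 else 0))) i x"
        unfolding psi_def R_def
        by (intro has_pd2_diff has_pd2_add has_pd2_cmult has_pd2_norm_sq has_pd2_component
            has_pd2_component_sq has_pd2_reflect Ck_has_pd2[OF U] xU RU[unfolded R_def])
    next
      fix x assume "x \<in> V"
      then have xW: "x \<in> W" using VW closure_subset by blast
      have l1: "\<bar>laplacian v x\<bar> \<le> N" and l2: "\<bar>laplacian v (R x)\<bar> \<le> N" using cube xin[OF xW] Rin[OF xW] by blast+
      have "(\<Sum>i\<in>UNIV. (c / 2) * dpart v [i,i] x + (- c / 2) * dpart v [i,i] (R x)
          - (M / d\<^sup>2 * 2 + A * d * 0 + (- A) * (if i = k then 2 else 0)))
        = (c / 2) * laplacian v x + (- c / 2) * laplacian v (R x) - (n * (M / d\<^sup>2 * 2) - A * 2)"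
        unfolding laplacian_def n_def sum_subtractf sum.distrib sum_distrib_left[symmetric]
        by simp
      also have "n * (M / d\<^sup>2 * 2) - A * 2 = - N" by (simp add: A_def field_simps)
      finally show "0 \<le> (\<Sum>i\<in>UNIV. (c / 2) * dpart v [i,i] x + (- c / 2) * dpart v [i,i] (R x)
          - (M / d\<^sup>2 * 2 + A * d * 0 + (- A) * (if i = k then 2 else 0)))"
        using l1 l2 c by auto
    next
      fix x assume xf: "x \<in> frontier V"
      then have xW: "x \<in> W" and xV: "x \<notin> V" using VW Vo by (auto simp: frontier_def interior_open)
      have psi': "psi x = M / d\<^sup>2 * ((x - a) \<bullet> (x - a)) + A * (y x * (d - y x))"
        unfolding psi_def y_def by (simp add: power2_eq_square algebra_simps)
      have y0: "0 \<le> y x" "y x \<le> d" using xW xin[OF xW, of k] by (auto simp: W_def y_def)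
      have i1: "A * (y x * (d - y x)) \<ge> 0" using A0 y0 by simp
      show "(c / 2) * v x + (- c / 2) * v (R x) - psi x \<le> 0"
      proof (cases "y x = 0")
        case True
        then have "R x = x" by (simp add: R_def y_def)
        then show ?thesis using True M0 by (simp add: psi')
      next
        case False
        then have "x $ k > a $ k" using y0 by (simp add: y_def)
        then obtain i where "\<not> \<bar>x $ i - a $ i\<bar> < d" using xV by (auto simp: V_def)
        then have "\<bar>(x - a) $ i\<bar> \<ge> d" by simp
        then have "norm (x - a) \<ge> d" using component_le_norm_cart[of "x - a" i] by linarith
        then have "(x - a) \<bullet> (x - a) \<ge> d\<^sup>2" using d power_mono[of d "norm (x - a)" 2]
          by (simp add: power2_norm_eq_inner)
        then have "M / d\<^sup>2 * ((x - a) \<bullet> (x - a)) \<ge> M / d\<^sup>2 * d\<^sup>2" using M0 by (intro mult_left_mono) auto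
        then have "psi x \<ge> M" using i1 d by (simp add: psi')
        moreover have "\<bar>v x\<bar> \<le> M" "\<bar>v (R x)\<bar> \<le> M" using cube xin[OF xW] Rin[OF xW] by blast+
        ultimately show ?thesis using c by auto
      qed
    qed
    then show ?thesis by (simp add: algebra_simps diff_divide_distrib)
  qed
  let ?f = "\<lambda>t. v (a + t *\<^sub>R axis k 1)"
  have aU: "a \<in> U" using cube[of a] d by auto
  have fd: "(?f has_real_derivative dpart v [k] a) (at 0)"
    using Ck_has_pd[OF U(2), of "[]" a k] aU unfolding has_pd_def by simp
  have fdm: "((\<lambda>t. ?f (- t)) has_real_derivative - dpart v [k] a) (at 0)"
    using DERIV_mirror[of ?f "dpart v [k] a" 0] fd by simp
  \<comment> \<open>The odd part has the same derivative at \<open>a\<close> as \<open>v\<close>, so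
    it is bounded by the slope of the barrier there, which is \<open>A * d\<close>.\<close>
  have "((\<lambda>t. (?f t - ?f (- t)) / 2) has_real_derivative (dpart v [k] a - (- dpart v [k] a)) / 2) (at 0)"
    by (intro DERIV_cdivide DERIV_diff fd fdm)
  then have lim: "((\<lambda>t. ((?f t - ?f (- t)) / 2) / t) \<longlongrightarrow> dpart v [k] a) (at_right 0)"
    unfolding DERIV_def using tendsto_within_subset by fastforce
  have ev: "\<forall>\<^sub>F t in at_right 0. \<bar>((?f t - ?f (- t)) / 2) / t\<bar> \<le> M / d\<^sup>2 * t + A * (d - t)"
    unfolding eventually_at_right_field
  proof (intro exI[of _ d] conjI d allI impI)
    fix t assume t: "0 < t" "t < d"
    let ?x = "a + t *\<^sub>R axis k 1"
    have "?x \<in> V" using t d by (auto simp: V_def axis_def)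
    then have xc: "?x \<in> closure V" using closure_subset by blast
    have Rx: "R ?x = a + (- t) *\<^sub>R axis k 1" by (simp add: R_def algebra_simps flip: scaleR_add_left)
    have px: "psi ?x = t * (M / d\<^sup>2 * t + A * (d - t))"
      unfolding psi_def
      by (simp add: inner_axis_axis power2_eq_square) (simp add: algebra_simps)
    have "\<bar>(?f t - ?f (- t)) / 2\<bar> \<le> t * (M / d\<^sup>2 * t + A * (d - t))"
      using key[of 1, OF _ xc] key[of "-1", OF _ xc] unfolding Rx px by linarith
    then have "\<bar>(?f t - ?f (- t)) / 2\<bar> / t \<le> M / d\<^sup>2 * t + A * (d - t)"
      using t by (simp add: field_simps)
    then show "\<bar>((?f t - ?f (- t)) / 2) / t\<bar> \<le> M / d\<^sup>2 * t + A * (d - t)"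
      using t by (simp add: abs_divide)
  qed
  have "\<bar>dpart v [k] a\<bar> \<le> M / d\<^sup>2 * 0 + A * (d - 0)"
  proof (rule tendsto_le[OF _ _ tendsto_rabs[OF lim] ev])
    show "((\<lambda>t. M / d\<^sup>2 * t + A * (d - t)) \<longlongrightarrow> M / d\<^sup>2 * 0 + A * (d - 0)) (at_right 0)"
      by (intro tendsto_intros)
  qed simp
  also have "\<dots> = CARD('n) * M / d + N * d / 2"
    using d by (simp add: A_def n_def field_simps power2_eq_square)
  finally show ?thesis .
qed

section \<open>Integration by parts and cutoff functions\<close>

lemma has_pd_zero_open:
  assumes "open U" "x \<in> U" "\<And>y. y \<in> U \<Longrightarrow> F y = 0"
  shows "has_pd F 0 i x"
  using has_pd_cong_open[OF assms(1,2), of F "\<lambda>_. 0"] assms(3) by simp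

lemma continuous_bounded_set_integrable:
  fixes f :: "real^'n \<Rightarrow> real"
  assumes "open U" "bounded U" "continuous_on U f" "\<And>x. x \<in> U \<Longrightarrow> \<bar>f x\<bar> \<le> B"
  shows "set_integrable lborel U f"
  unfolding set_integrable_def
proof (rule Bochner_Integration.integrable_bound)
  have "emeasure lborel U < \<infinity>"
    using emeasure_bounded_finite[OF assms(2)] by simp
  then show "integrable lborel (\<lambda>x. indicator U x * B)"
    using assms(1) by simp
  show "(\<lambda>x. indicator U x *\<^sub>R f x) \<in> borel_measurable lborel"
    using borel_measurable_continuous_on_indicator[of U f] assms(1,3) by simp
  show "AE x in lborel. norm (indicator U x *\<^sub>R f x) \<le> norm (indicator U x * B)"
  proof (intro AE_I2)
    fix x show "norm (indicator U x *\<^sub>R f x) \<le> norm (indicator U x * B)"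
      using assms(4)[of x] by (auto simp: indicator_def)
  qed
qed

lemma integral_lborel_translate:
  fixes F :: "'a::euclidean_space \<Rightarrow> real"
  assumes "F \<in> borel_measurable borel"
  shows "(\<integral>x. F (x + c) \<partial>lborel) = (\<integral>x. F x \<partial>lborel)"
proof -
  have "(\<integral>x. F x \<partial>lborel) = (\<integral>x. F x \<partial>(distr lborel borel ((+) c)))"
    by (simp add: lborel_distr_plus)
  also have "\<dots> = (\<integral>x. F (c + x) \<partial>lborel)"
    using assms by (intro integral_distr) auto
  finally show ?thesis by (simp add: add.commute)
qed

text \<open>By translation invariance every difference quotient integrates to 0; dominated
  convergence passes to the derivative.\<close>

lemma integral_pd_eq_0:
  fixes F :: "real^'n \<Rightarrow> real"
  assumes pd: "\<And>x. has_pd F (D x) i x" and cF: "continuous_on UNIV F" and cD: "continuous_on UNIV D"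
    and K: "compact K" and supp: "\<And>x. x \<notin> K \<Longrightarrow> F x = 0"
  shows "(\<integral>x. D x \<partial>lborel) = 0"
proof -
  have D0: "D x = 0" if "x \<notin> K" for x
    using has_pd_unique[OF pd has_pd_zero_open[of "- K" x F i]] that supp
      open_Compl[OF compact_imp_closed[OF K]] by auto
  obtain R where R: "\<And>x. x \<in> K \<Longrightarrow> norm x \<le> R" "R > 0"
    using compact_imp_bounded[OF K] bounded_pos by metis
  have "bounded (D ` K)"
    using compact_imp_bounded[OF compact_continuous_image[OF continuous_on_subset[OF cD] K]] by simp
  then obtain M where M: "M > 0" "\<And>x. x \<in> K \<Longrightarrow> \<bar>D x\<bar> \<le> M"
    unfolding bounded_pos by (auto simp: image_iff)
  have DM: "\<bar>D x\<bar> \<le> M" for x using D0[of x] M by (cases "x \<in> K") auto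
  define h where "h m = inverse (real (Suc m))" for m
  have h: "h m > 0" "h m \<le> 1" for m by (auto simp: h_def field_simps)
  have hlim: "h \<longlonglongrightarrow> 0" unfolding h_def by (rule LIMSEQ_inverse_real_of_nat)
  define g where "g m x = (F (x + h m *\<^sub>R axis i 1) - F x) / h m" for m x
  have mF: "F \<in> borel_measurable borel"
    using cF by (rule borel_measurable_continuous_onI)
  have "integrable lborel (\<lambda>x. indicator K x *\<^sub>R F x)"
    using borel_integrable_compact[OF K continuous_on_subset[OF cF]] by simp
  moreover have "(\<lambda>x. indicator K x *\<^sub>R F x) = F"
    by (rule ext) (use supp in \<open>auto split: split_indicator\<close>)
  ultimately have iF: "integrable lborel F" by simp
  have iFt: "integrable lborel (\<lambda>x. F (x + c))" for c
  proof -
    have "integrable (distr lborel borel ((+) c)) F"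
      using iF by (simp add: lborel_distr_plus)
    then have "integrable lborel (\<lambda>x. F (c + x))"
      using mF by (subst (asm) integrable_distr_eq) auto
    then show ?thesis by (simp add: add.commute)
  qed
  have g0: "(\<integral>x. g m x \<partial>lborel) = 0" for m
    unfolding g_def using iF iFt by (simp add: integral_lborel_translate[OF mF])
  have "(\<lambda>m. \<integral>x. g m x \<partial>lborel) \<longlonglongrightarrow> (\<integral>x. D x \<partial>lborel)"
  proof (rule integral_dominated_convergence)
    show "D \<in> borel_measurable lborel"
      using borel_measurable_continuous_onI[OF cD] by simp
    show "g m \<in> borel_measurable lborel" for m
      unfolding g_def using iF iFt by (intro borel_measurable_divide borel_measurable_diff) auto
    \<comment> \<open>The steps \<open>h m\<close> are at most 1, so all difference quotients vanish
      outside the ball of radius \<open>R + 1\<close>; inside, the mean value theorem bounds them by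
      \<open>M\<close>.\<close>
    have "emeasure lborel (cball (0::real^'n) (R + 1)) < \<infinity>"
      using emeasure_bounded_finite[OF bounded_cball] by simp
    then show "integrable lborel (\<lambda>x::real^'n. indicator (cball 0 (R + 1)) x * M)"
      by simp
    show "AE x in lborel. (\<lambda>m. g m x) \<longlonglongrightarrow> D x"
    proof (intro AE_I2)
      fix x
      have "((\<lambda>t. (F (x + t *\<^sub>R axis i 1) - F x) / t) \<longlongrightarrow> D x) (at 0)"
        using pd[of x] unfolding has_pd_def DERIV_def by simp
      moreover have "filterlim h (at 0) sequentially"
        using hlim h(1) by (auto simp: filterlim_at intro!: always_eventually) (metis less_irrefl)
      ultimately show "(\<lambda>m. g m x) \<longlonglongrightarrow> D x"
        unfolding g_def using filterlim_compose by blast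
    qed
    show "AE x in lborel. norm (g m x) \<le> indicator (cball 0 (R + 1)) x * M" for m
    proof (intro AE_I2)
      fix x
      show "norm (g m x) \<le> indicator (cball 0 (R + 1)) x * M"
      proof (cases "x \<in> cball 0 (R + 1)")
        case True
        obtain y where "F (x + h m *\<^sub>R axis i 1) - F x = h m * D y"
          using has_pd_mvt[of UNIV x "h m" i F D] pd by auto
        then have "g m x = D y" unfolding g_def using h(1)[of m] by simp
        then show ?thesis using True DM[of y] by simp
      next
        case False
        then have "norm x > R + 1" by simp
        then have "x \<notin> K" using R(1)[of x] by auto
        moreover have "x + h m *\<^sub>R axis i 1 \<notin> K"
        proof
          assume "x + h m *\<^sub>R axis i 1 \<in> K"
          then have "norm (x + h m *\<^sub>R axis i 1) \<le> R" by (rule R)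
          moreover have "norm (x + h m *\<^sub>R axis i 1) \<ge> norm x - norm (h m *\<^sub>R axis i 1 :: real^'n)"
            using norm_diff_ineq by blast
          moreover have "norm (h m *\<^sub>R axis i 1 :: real^'n) \<le> 1" using h[of m] by simp
          ultimately show False using \<open>norm x > R + 1\<close> by linarith
        qed
        ultimately show ?thesis using supp False by (simp add: g_def)
      qed
    qed
  qed
  then have "(\<lambda>m. 0::real) \<longlonglongrightarrow> (\<integral>x. D x \<partial>lborel)" by (simp add: g0)
  then show ?thesis using LIMSEQ_unique tendsto_const by blast
qed

text \<open>Extension by 0 reduces this to the whole space. As \<open>K\<close> is compact in
  \<open>U\<close>, the open sets \<open>U\<close> and \<open>- K\<close> cover everything, and
  regularity is checked on each.\<close>

lemma set_integral_pd_eq_0: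
  fixes F :: "real^'n \<Rightarrow> real"
  assumes U: "open U" and pd: "\<And>x. x \<in> U \<Longrightarrow> has_pd F (D x) i x"
    and cF: "continuous_on U F" and cD: "continuous_on U D"
    and K: "compact K" "K \<subseteq> U" and supp: "\<And>x. x \<in> U \<Longrightarrow> x \<notin> K \<Longrightarrow> F x = 0"
  shows "set_integrable lborel U D" "(LINT x:U|lborel. D x) = 0"
proof -
  have oK: "open (- K)" using K by (simp add: compact_imp_closed open_Compl)
  have UN: "U \<union> - K = UNIV" using K by auto
  define F' where "F' x = (if x \<in> U then F x else 0)" for x
  define D' where "D' x = (if x \<in> U then D x else 0)" for x
  have F'0: "F' x = 0" if "x \<notin> K" for x using that supp by (auto simp: F'_def)
  have pd': "has_pd F' (D' x) i x" for x
  proof (cases "x \<in> U")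
    case True
    then show ?thesis
      using has_pd_cong_open[OF U True, of F' F] pd[OF True] by (simp add: F'_def D'_def)
  next
    case False
    then have "x \<in> - K" using K by auto
    then show ?thesis using has_pd_zero_open[OF oK, of x F' i] F'0 False by (simp add: D'_def)
  qed
  have D'0: "D' x = 0" if "x \<notin> K" for x
    using has_pd_unique[OF pd' has_pd_zero_open[OF oK, of x F' i]] F'0 that by simp
  have "continuous_on (U \<union> - K) F'"
    using F'0 by (intro continuous_on_open_Un U oK continuous_on_eq[OF cF] continuous_on_eq[OF continuous_on_const[of _ 0]])
      (auto simp: F'_def)
  moreover have "continuous_on (U \<union> - K) D'"
    using D'0 by (intro continuous_on_open_Un U oK continuous_on_eq[OF cD] continuous_on_eq[OF continuous_on_const[of _ 0]])
      (auto simp: D'_def)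
  ultimately have cF': "continuous_on UNIV F'" and cD': "continuous_on UNIV D'"
    by (simp_all add: UN)
  have D'_eq: "D' = (\<lambda>x. indicator U x *\<^sub>R D x)" by (auto simp: D'_def indicator_def)
  show "(LINT x:U|lborel. D x) = 0"
    using integral_pd_eq_0[OF pd' cF' cD' K(1) F'0] by (simp add: set_lebesgue_integral_def D'_eq)
  have "integrable lborel (\<lambda>x. indicator K x *\<^sub>R D' x)"
    using borel_integrable_compact[OF K(1) continuous_on_subset[OF cD']] by simp
  moreover have "(\<lambda>x. indicator K x *\<^sub>R D' x) = D'"
    by (rule ext) (use D'0 in \<open>auto split: split_indicator\<close>)
  ultimately show "set_integrable lborel U D" by (simp add: set_integrable_def D'_eq)
qed

text \<open>The cubic \<open>3 t^2 - 2 t^3\<close> on the unit interval, continued by 0 and 1.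
  Truncated powers turn its C^1 regularity at the knots into the single rule
  \<open>DERIV_pos_part_power\<close>.\<close>

definition smoothstep :: "real \<Rightarrow> real" where
  "smoothstep t = 3 * (max 0 t)^2 - 2 * (max 0 t)^3 + 3 * (max 0 (t - 1))^2 + 2 * (max 0 (t - 1))^3"

definition smoothstep' :: "real \<Rightarrow> real" where
  "smoothstep' t = 6 * max 0 t - 6 * (max 0 t)^2 + 6 * max 0 (t - 1) + 6 * (max 0 (t - 1))^2"

lemma DERIV_pos_part_power:
  "((\<lambda>t::real. (max 0 t) ^ Suc (Suc n)) has_real_derivative real (Suc (Suc n)) * (max 0 t) ^ Suc n) (at t)"
proof (cases t "0::real" rule: linorder_cases)
  case less
  then have "\<forall>\<^sub>F s in nhds t. s < 0" by (intro order_tendstoD(2)[OF filterlim_ident]) auto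
  then have "\<forall>\<^sub>F s in nhds t. (max 0 s) ^ Suc (Suc n) = 0" by eventually_elim auto
  then have "((\<lambda>t::real. (max 0 t) ^ Suc (Suc n)) has_real_derivative 0) (at t)
      \<longleftrightarrow> ((\<lambda>t::real. 0) has_real_derivative 0) (at t)"
    by (intro DERIV_cong_ev) auto
  then show ?thesis using less by simp
next
  case greater
  then have "\<forall>\<^sub>F s in nhds t. s > 0" by (intro order_tendstoD(1)[OF filterlim_ident]) auto
  then have "\<forall>\<^sub>F s in nhds t. (max 0 s) ^ Suc (Suc n) = s ^ Suc (Suc n)" by eventually_elim (auto simp: max_def)
  then have "((\<lambda>t::real. (max 0 t) ^ Suc (Suc n)) has_real_derivative real (Suc (Suc n)) * t ^ Suc n) (at t)
      \<longleftrightarrow> ((\<lambda>t::real. t ^ Suc (Suc n)) has_real_derivative real (Suc (Suc n)) * t ^ Suc n) (at t)"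
    by (intro DERIV_cong_ev) auto
  moreover have "((\<lambda>t::real. t ^ Suc (Suc n)) has_real_derivative real (Suc (Suc n)) * t ^ Suc n) (at t)"
    using DERIV_pow[of "Suc (Suc n)" t UNIV] by (simp del: of_nat_Suc power_Suc)
  ultimately show ?thesis using greater by (simp add: max_def del: of_nat_Suc power_Suc)
next
  case equal
  have "((\<lambda>h::real. (max 0 h) ^ Suc (Suc n) / h) \<longlongrightarrow> 0) (at 0)"
  proof (rule Lim_null_comparison)
    show "\<forall>\<^sub>F h in at 0. norm ((max 0 h) ^ Suc (Suc n) / h) \<le> \<bar>h\<bar> ^ Suc n"
    proof (intro always_eventually allI)
      fix h :: real
      show "norm ((max 0 h) ^ Suc (Suc n) / h) \<le> \<bar>h\<bar> ^ Suc n"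
        using zero_le_power[OF abs_ge_zero, of h "Suc n"]
        by (cases "h > 0") (auto simp: max_def)
    qed
    have "((\<lambda>h::real. \<bar>h\<bar> ^ Suc n) \<longlongrightarrow> \<bar>0\<bar> ^ Suc n) (at 0)" by (intro tendsto_intros)
    then show "((\<lambda>h::real. \<bar>h\<bar> ^ Suc n) \<longlongrightarrow> 0) (at 0)" by simp
  qed
  then show ?thesis using equal by (simp add: DERIV_def)
qed

lemma DERIV_smoothstep: "(smoothstep has_real_derivative smoothstep' t) (at t)"
proof -
  have 2: "((\<lambda>t::real. (max 0 t)^2) has_real_derivative 2 * max 0 t) (at t)" for t
    using DERIV_pos_part_power[of 0 t] by (simp add: numeral_2_eq_2)
  have 3: "((\<lambda>t::real. (max 0 t)^3) has_real_derivative 3 * (max 0 t)^2) (at t)" for t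
    using DERIV_pos_part_power[of 1 t] by (simp add: numeral_3_eq_3 numeral_2_eq_2)
  have s2: "((\<lambda>t::real. (max 0 (t - 1))^2) has_real_derivative 2 * max 0 (t - 1)) (at t)"
    using DERIV_shift[of "\<lambda>t. (max 0 t)^2" "2 * max 0 (t - 1)" t "-1"] 2 by simp
  have s3: "((\<lambda>t::real. (max 0 (t - 1))^3) has_real_derivative 3 * (max 0 (t - 1))^2) (at t)"
    using DERIV_shift[of "\<lambda>t. (max 0 t)^3" "3 * (max 0 (t - 1))^2" t "-1"] 3 by simp
  have "((\<lambda>t. 3 * (max 0 t)^2 - 2 * (max 0 t)^3 + 3 * (max 0 (t - 1))^2 + 2 * (max 0 (t - 1))^3)
    has_real_derivative (3 * (2 * max 0 t) - 2 * (3 * (max 0 t)^2) + 3 * (2 * max 0 (t - 1)) + 2 * (3 * (max 0 (t - 1))^2))) (at t)"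
    by (intro DERIV_add DERIV_diff DERIV_cmult 2 3 s2 s3)
  then show ?thesis by (simp add: smoothstep_def[abs_def] smoothstep'_def)
qed

lemma smoothstep_eq_0: "t \<le> 0 \<Longrightarrow> smoothstep t = 0"
  by (simp add: smoothstep_def max_def)

lemma smoothstep_eq_1: "t \<ge> 1 \<Longrightarrow> smoothstep t = 1"
  by (simp add: smoothstep_def max_def power2_eq_square power3_eq_cube algebra_simps)

text \<open>That the derivative lives on the unit interval is what confines the boundary layer of
  the later cutoffs.\<close>

lemma smoothstep'_eq: "smoothstep' t = (if 0 \<le> t \<and> t \<le> 1 then 6 * (t * (1 - t)) else 0)"
  by (simp add: smoothstep'_def max_def power2_eq_square algebra_simps)

lemma smoothstep'_nonneg: "smoothstep' t \<ge> 0"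
  by (simp add: smoothstep'_eq)

lemma smoothstep'_le: "smoothstep' t \<le> 6"
proof (cases "0 \<le> t \<and> t \<le> 1")
  case True
  then have "t * (1 - t) \<le> 1 * 1" by (intro mult_mono) auto
  then show ?thesis by (simp add: smoothstep'_eq)
qed (auto simp: smoothstep'_eq)

lemma smoothstep_bounds: "0 \<le> smoothstep t" "smoothstep t \<le> 1"
proof -
  have mono: "s \<le> t \<Longrightarrow> smoothstep s \<le> smoothstep t" for s t
    by (rule DERIV_nonneg_imp_nondecreasing[of s t]) (use DERIV_smoothstep smoothstep'_nonneg in auto)
  show "0 \<le> smoothstep t" using mono[of "min t 0" t] by (simp add: smoothstep_eq_0)
  show "smoothstep t \<le> 1" using mono[of t "max t 1"] by (simp add: smoothstep_eq_1)
qed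

lemma continuous_on_smoothstep' [continuous_intros]:
  "continuous_on S f \<Longrightarrow> continuous_on S (\<lambda>x. smoothstep' (f x))"
  unfolding smoothstep'_def by (intro continuous_intros)

lemma continuous_on_smoothstep [continuous_intros]:
  "continuous_on S f \<Longrightarrow> continuous_on S (\<lambda>x. smoothstep (f x))"
  unfolding smoothstep_def by (intro continuous_intros)

text \<open>Test functions carry their partial derivatives \<open>D\<close> as an argument, so those
  of products and differences are written down rather than computed from
  \<open>dpart\<close>.\<close>

definition C1_fun :: "(real^'n \<Rightarrow> real) \<Rightarrow> ('n \<Rightarrow> real^'n \<Rightarrow> real) \<Rightarrow> bool" where
  "C1_fun \<phi> D \<longleftrightarrow> (\<forall>i x. has_pd \<phi> (D i x) i x) \<and> continuous_on UNIV \<phi> \<and> (\<forall>i. continuous_on UNIV (D i))"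

lemma C1_fun_const: "C1_fun (\<lambda>x. c) (\<lambda>i x. 0)"
  by (simp add: C1_fun_def)

lemma C1_fun_mult:
  "C1_fun f D \<Longrightarrow> C1_fun g E \<Longrightarrow> C1_fun (\<lambda>x. f x * g x) (\<lambda>i x. D i x * g x + E i x * f x)"
  unfolding C1_fun_def by (intro conjI allI has_pd_mult continuous_intros) auto

lemma C1_fun_diff:
  "C1_fun f D \<Longrightarrow> C1_fun g E \<Longrightarrow> C1_fun (\<lambda>x. f x - g x) (\<lambda>i x. D i x - E i x)"
  unfolding C1_fun_def by (intro conjI allI has_pd_diff continuous_intros) auto

lemma C1_bump:
  fixes c :: "real^'n"
  assumes "0 < r"
  obtains b D where "C1_fun b D" "\<And>x. norm (x - c) \<le> r \<Longrightarrow> b x = 1" "\<And>x. norm (x - c) \<ge> 2 * r \<Longrightarrow> b x = 0"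
    "\<And>x. 0 \<le> b x" "\<And>x. b x \<le> 1"
proof
  \<comment> \<open>In the squared distance the transition runs from \<open>r\<^sup>2\<close> to
    \<open>2 * r\<^sup>2\<close>, well inside the radius \<open>2 * r\<close>.\<close>
  let ?q = "\<lambda>x. 2 - ((x - c) \<bullet> (x - c)) / r\<^sup>2"
  let ?b = "\<lambda>x. smoothstep (?q x)"
  let ?D = "\<lambda>i x. smoothstep' (?q x) * (- (2 * ((x - c) $ i)) / r\<^sup>2)"
  show "C1_fun ?b ?D"
    unfolding C1_fun_def
  proof (intro conjI allI)
    fix i :: 'n and x :: "real^'n"
    have *: "(x + t *\<^sub>R axis i 1 - c) \<bullet> (x + t *\<^sub>R axis i 1 - c)
      = (x - c) \<bullet> (x - c) + 2 * t * ((x - c) $ i) + t\<^sup>2" for t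
      by (simp add: inner_axis inner_axis' algebra_simps power2_eq_square inner_commute inner_axis_axis)
    have "has_pd ?q (- (2 * ((x - c) $ i)) / r\<^sup>2) i x"
      unfolding has_pd_def * using assms by (auto intro!: derivative_eq_intros simp: field_simps)
    then show "has_pd ?b (?D i x) i x"
      by (rule has_pd_chain[OF _ DERIV_smoothstep])
  qed (use assms in \<open>auto intro!: continuous_intros\<close>)
  fix x
  show "?b x = 1" if "norm (x - c) \<le> r"
  proof (rule smoothstep_eq_1)
    have "(x - c) \<bullet> (x - c) \<le> r\<^sup>2" using power_mono[OF that, of 2] by (simp add: power2_norm_eq_inner)
    then show "?q x \<ge> 1" using assms by (simp add: field_simps)
  qed
  show "?b x = 0" if "norm (x - c) \<ge> 2 * r"
  proof (rule smoothstep_eq_0)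
    have "(x - c) \<bullet> (x - c) \<ge> (2 * r)\<^sup>2" using power_mono[OF that, of 2] assms by (simp add: power2_norm_eq_inner)
    then have "(x - c) \<bullet> (x - c) \<ge> 2 * r\<^sup>2" by (simp add: power2_eq_square) (use assms in \<open>smt (verit) mult_nonneg_nonneg\<close>)
    then show "?q x \<le> 0" using assms by (simp add: field_simps)
  qed
qed (auto simp: smoothstep_bounds)

section \<open>The divergence theorem for fields with vanishing flux\<close>

lemma C1_fun_zero_deriv:
  assumes "C1_fun \<phi> D" "open U" "x \<in> U" "\<And>y. y \<in> U \<Longrightarrow> \<phi> y = 0"
  shows "D i x = 0"
  using assms has_pd_unique[OF _ has_pd_zero_open[OF assms(2,3), of \<phi> i]] by (auto simp: C1_fun_def)

lemma continuous_on_bounded_set: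
  fixes f :: "real^'n \<Rightarrow> real"
  assumes "continuous_on UNIV f" "bounded U"
  obtains M where "M > 0" "\<And>x. x \<in> U \<Longrightarrow> \<bar>f x\<bar> \<le> M"
proof -
  have "compact (closure U)" using assms(2) by simp
  then have "bounded (f ` closure U)"
    by (intro compact_imp_bounded compact_continuous_image continuous_on_subset[OF assms(1)]) auto
  then obtain M where "M > 0" "\<And>y. y \<in> f ` closure U \<Longrightarrow> norm y \<le> M" using bounded_pos by metis
  then have "\<bar>f x\<bar> \<le> M" if "x \<in> U" for x
    using closure_subset[of U] that by (metis imageI real_norm_def subsetD)
  then show ?thesis using that \<open>M > 0\<close> by blast
qed

lemma set_integral_sum:
  fixes f :: "'i \<Rightarrow> 'a \<Rightarrow> real"
  assumes "\<And>i. i \<in> I \<Longrightarrow> set_integrable M A (f i)"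
  shows "set_integrable M A (\<lambda>x. \<Sum>i\<in>I. f i x)"
    and "(LINT x:A|M. \<Sum>i\<in>I. f i x) = (\<Sum>i\<in>I. LINT x:A|M. f i x)"
  using assms unfolding set_integrable_def set_lebesgue_integral_def scaleR_sum_right
  by (auto intro!: Bochner_Integration.integral_sum)

text \<open>The derivatives \<open>D i\<close> are continuous inside only, and a bound is imposed on
  their sum alone: second derivatives of a solution may be unbounded near the boundary, whereas the
  equation bounds its Laplacian.\<close>

locale vector_field =
  fixes \<Omega> :: "(real^'n) set" and V D :: "'n \<Rightarrow> real^'n \<Rightarrow> real" and B :: real
  assumes \<Omega>: "open \<Omega>" "bounded \<Omega>"
    and V: "\<And>i x. x \<in> \<Omega> \<Longrightarrow> has_pd (V i) (D i x) i x"
    and cV: "\<And>i. continuous_on \<Omega> (V i)" and cD: "\<And>i. continuous_on \<Omega> (D i)"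
    and bV: "\<And>i x. x \<in> \<Omega> \<Longrightarrow> \<bar>V i x\<bar> \<le> B"
    and bD: "\<And>x. x \<in> \<Omega> \<Longrightarrow> \<bar>\<Sum>i\<in>UNIV. D i x\<bar> \<le> B"
begin

text \<open>The divergence of the field \<open>V\<close> multiplied by \<open>\<phi>\<close>, with
  \<open>E\<close> standing for the gradient of \<open>\<phi>\<close>. It is bounded although the
  single \<open>D i\<close> need not be.\<close>

definition weak_div :: "(real^'n \<Rightarrow> real) \<Rightarrow> ('n \<Rightarrow> real^'n \<Rightarrow> real) \<Rightarrow> real^'n \<Rightarrow> real" where
  "weak_div \<phi> E x = (\<Sum>i\<in>UNIV. D i x) * \<phi> x + (\<Sum>i\<in>UNIV. V i x * E i x)"

lemma weak_div_bound:
  assumes "C1_fun \<phi> E"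
  obtains M where "M > 0" "\<And>x. x \<in> \<Omega> \<Longrightarrow> \<bar>weak_div \<phi> E x\<bar> \<le> M"
proof -
  obtain M0 where M0: "M0 > 0" "\<And>x. x \<in> \<Omega> \<Longrightarrow> \<bar>\<phi> x\<bar> \<le> M0"
    using continuous_on_bounded_set[of \<phi> \<Omega>] assms \<Omega> unfolding C1_fun_def by blast
  have "\<forall>i. \<exists>M>0. \<forall>x\<in>\<Omega>. \<bar>E i x\<bar> \<le> M"
  proof
    fix i show "\<exists>M>0. \<forall>x\<in>\<Omega>. \<bar>E i x\<bar> \<le> M"
      using continuous_on_bounded_set[of "E i" \<Omega>] assms \<Omega> unfolding C1_fun_def by metis
  qed
  then obtain M where M: "\<And>i. M i > 0" "\<And>i x. x \<in> \<Omega> \<Longrightarrow> \<bar>E i x\<bar> \<le> M i" by metis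
  show ?thesis
  proof
    show "\<bar>weak_div \<phi> E x\<bar> \<le> \<bar>B\<bar> * M0 + (\<Sum>i\<in>UNIV. \<bar>B\<bar> * M i) + 1" if x: "x \<in> \<Omega>" for x
    proof -
      have "\<bar>(\<Sum>i\<in>UNIV. D i x) * \<phi> x\<bar> \<le> \<bar>B\<bar> * M0"
        unfolding abs_mult using bD[OF x] M0(2)[OF x] by (intro mult_mono) auto
      moreover have "\<bar>\<Sum>i\<in>UNIV. V i x * E i x\<bar> \<le> (\<Sum>i\<in>UNIV. \<bar>B\<bar> * M i)"
      proof (rule order_trans[OF sum_abs sum_mono])
        fix i show "\<bar>V i x * E i x\<bar> \<le> \<bar>B\<bar> * M i"
          unfolding abs_mult using bV[OF x, of i] M(2)[OF x, of i] by (intro mult_mono) auto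
      qed
      ultimately show ?thesis unfolding weak_div_def by linarith
    qed
    show "\<bar>B\<bar> * M0 + (\<Sum>i\<in>UNIV. \<bar>B\<bar> * M i) + 1 > 0"
    proof -
      have "(\<Sum>i\<in>(UNIV::'n set). \<bar>B\<bar> * M i) \<ge> 0"
        using M(1) by (intro sum_nonneg mult_nonneg_nonneg) (simp_all add: less_imp_le)
      moreover have "\<bar>B\<bar> * M0 \<ge> 0" using M0 by simp
      ultimately show ?thesis by linarith
    qed
  qed
qed

lemma weak_div_continuous:
  assumes "C1_fun \<phi> E" shows "continuous_on \<Omega> (weak_div \<phi> E)"
  unfolding weak_div_def[abs_def]
  by (intro continuous_intros cV cD) (use assms in \<open>auto simp: C1_fun_def intro: continuous_on_subset\<close>)

lemma weak_div_integrable: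
  assumes "C1_fun \<phi> E" shows "set_integrable lborel \<Omega> (weak_div \<phi> E)"
proof -
  obtain M where "M > 0" "\<And>x. x \<in> \<Omega> \<Longrightarrow> \<bar>weak_div \<phi> E x\<bar> \<le> M" using weak_div_bound[OF assms] by blast
  then show ?thesis
    by (intro continuous_bounded_set_integrable[OF \<Omega> weak_div_continuous[OF assms]]) auto
qed

text \<open>The divergence theorem with vanishing boundary term, tested only on functions supported
  in one ball. Once known around every point of the closure, it is glued by a partition of
  unity.\<close>

definition locally_div_free_at :: "real^'n \<Rightarrow> real \<Rightarrow> bool" where
  "locally_div_free_at c R \<longleftrightarrow> (\<forall>\<phi> E. C1_fun \<phi> E \<longrightarrow> (\<forall>y. y \<notin> cball c R \<longrightarrow> \<phi> y = 0) \<longrightarrow>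
     (LINT x:\<Omega>|lborel. weak_div \<phi> E x) = 0)"

text \<open>Here the support is compact in \<Omega>, so each coordinate can be integrated by parts
  on its own, and integrability holds even where \<open>D i\<close> is unbounded near the
  boundary.\<close>

lemma interior_local:
  assumes "cball c R \<subseteq> \<Omega>"
  shows "locally_div_free_at c R"
  unfolding locally_div_free_at_def
proof (intro allI impI)
  fix \<phi> E assume \<phi>: "C1_fun \<phi> E" "\<forall>y. y \<notin> cball c R \<longrightarrow> \<phi> y = 0"
  have *: "set_integrable lborel \<Omega> (\<lambda>x. D i x * \<phi> x + E i x * V i x)"
    "(LINT x:\<Omega>|lborel. D i x * \<phi> x + E i x * V i x) = 0" for i
  proof -
    have 1: "has_pd (\<lambda>x. V i x * \<phi> x) (D i x * \<phi> x + E i x * V i x) i x" if "x \<in> \<Omega>" for x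
      using \<phi> V that by (intro has_pd_mult) (auto simp: C1_fun_def)
    have 2: "continuous_on \<Omega> (\<lambda>x. V i x * \<phi> x)"
      "continuous_on \<Omega> (\<lambda>x. D i x * \<phi> x + E i x * V i x)"
      using \<phi>(1) by (auto simp: C1_fun_def intro!: continuous_intros cV cD intro: continuous_on_subset)
    have 3: "V i x * \<phi> x = 0" if "x \<in> \<Omega>" "x \<notin> cball c R" for x using \<phi>(2) that by simp
    show "set_integrable lborel \<Omega> (\<lambda>x. D i x * \<phi> x + E i x * V i x)"
      "(LINT x:\<Omega>|lborel. D i x * \<phi> x + E i x * V i x) = 0"
      using set_integral_pd_eq_0[OF \<Omega>(1) 1 2 compact_cball assms 3] by auto
  qed
  have "(LINT x:\<Omega>|lborel. weak_div \<phi> E x) = (LINT x:\<Omega>|lborel. \<Sum>i\<in>UNIV. D i x * \<phi> x + E i x * V i x)"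
    by (simp add: weak_div_def sum.distrib sum_distrib_left mult.commute)
  also have "\<dots> = (\<Sum>i\<in>UNIV. LINT x:\<Omega>|lborel. D i x * \<phi> x + E i x * V i x)"
    by (rule set_integral_sum(2)) (rule *)
  finally show "(LINT x:\<Omega>|lborel. weak_div \<phi> E x) = 0" using * by simp
qed

text \<open>Cut off at distance about \<open>\<eta>\<close> from the boundary with \<open>\<kappa> \<eta>\<close>. The boundary layer
  \<open>\<integral> b \<theta> \<eta>\<close> stays bounded as \<open>\<eta> \<rightarrow> 0\<close> because \<open>\<theta> \<eta>\<close> is comparable to the
  derivative of \<open>\<kappa> \<eta>\<close> in a direction transversal to the boundary.\<close>
lemma boundary_local:
  assumes x0: "x0 \<in> frontier \<Omega>" and loc: "local_defining \<Omega> x0 r \<rho>"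
    and decay: "\<And>s e. s < r \<Longrightarrow> e > 0 \<Longrightarrow> \<exists>\<delta>>0. \<forall>x\<in>\<Omega> \<inter> cball x0 s.
       infdist x (frontier \<Omega>) < \<delta> \<longrightarrow> \<bar>\<Sum>i\<in>UNIV. V i x * dpart \<rho> [i] x\<bar> \<le> e"
  shows "\<exists>R>0. locally_div_free_at x0 R"
proof -
  define P where "P i x = dpart \<rho> [i] x" for i x
  have r: "r > 0" and \<rho>neg: "\<And>x. x \<in> ball x0 r \<Longrightarrow> x \<in> \<Omega> \<longleftrightarrow> \<rho> x < 0"
    and gr: "\<And>x. x \<in> ball x0 r \<Longrightarrow> grad \<rho> x \<noteq> 0" and Ck: "Ck 1 (ball x0 r) \<rho>"
    using loc unfolding local_defining_def smooth_on_def by auto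
  have pd\<rho>: "has_pd \<rho> (P i x) i x" if "x \<in> ball x0 r" for i x
    using Ck_has_pd[OF Ck, of "[]" x i] that by (simp add: P_def)
  have c\<rho>: "continuous_on (ball x0 r) \<rho>" using Ck_continuous[OF Ck, of "[]"] by simp
  have cP: "continuous_on (ball x0 r) (P i)" for i
    using Ck_continuous[OF Ck, of "[i]"] unfolding P_def[abs_def] by simp
  have "grad \<rho> x0 \<noteq> 0" using gr[of x0] r by simp
  \<comment> \<open>The direction \<open>j\<close> is transversal to the boundary near
    \<open>x0\<close>, and \<open>\<sigma>\<close> fixes its orientation.\<close>
  then obtain j where j: "P j x0 \<noteq> 0" unfolding grad_def P_def by (auto simp: vec_eq_iff)
  define \<sigma> where "\<sigma> = sgn (P j x0)"
  define c where "c = \<bar>P j x0\<bar> / 2"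
  have c: "c > 0" using j by (simp add: c_def)
  have "isCont (P j) x0" using cP r by (simp add: continuous_on_eq_continuous_at)
  then obtain r' where r': "r' > 0" "\<And>y. dist y x0 < r' \<Longrightarrow> dist (P j y) (P j x0) < c"
    using c unfolding continuous_at_eps_delta by metis
  \<comment> \<open>A third, so that the doubled ball, which will contain the support of the bump
    \<open>b\<close>, still lies within both radii.\<close>
  define R where "R = min r r' / 3"
  have R: "R > 0" "2 * R < r" "2 * R < r'" using r r' by (auto simp: R_def)
  have Pj: "\<sigma> * P j y \<ge> c" if "y \<in> cball x0 (2 * R)" for y
  proof -
    have "\<bar>P j y - P j x0\<bar> < c" using r'(2)[of y] that R by (simp add: dist_commute dist_real_def)
    then show ?thesis using j unfolding \<sigma>_def c_def by (cases "P j x0 > 0") (auto simp: abs_if split: if_splits)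
  qed
  have sub: "cball x0 (2 * R) \<subseteq> ball x0 r" using R by auto
  \<comment> \<open>With \<open>- \<rho>\<close> as a substitute for the distance to the boundary,
    \<open>\<kappa> \<eta>\<close> is 0 up to depth \<open>\<eta>\<close> and 1 from depth
    \<open>2 * \<eta>\<close> on; \<open>\<theta> \<eta>\<close> is minus its derivative with
    respect to \<open>\<rho>\<close>.\<close>
  define \<kappa> where "\<kappa> \<eta> x = smoothstep ((- 1 / \<eta>) * \<rho> x - 1)" for \<eta> x
  define \<theta> where "\<theta> \<eta> x = smoothstep' ((- 1 / \<eta>) * \<rho> x - 1) / \<eta>" for \<eta> x
  \<comment> \<open>\<open>\<rho>\<close>, and hence \<open>\<kappa> \<eta>\<close>, is regular only
    in the ball of radius \<open>r\<close>; outside the smaller ball every function in question is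
    0.\<close>
  have cont: "continuous_on \<Omega> g" if "continuous_on (\<Omega> \<inter> ball x0 r) g"
    "\<And>x. x \<in> \<Omega> \<Longrightarrow> x \<notin> cball x0 (2*R) \<Longrightarrow> g x = 0" for g :: "real^'n \<Rightarrow> real"
  proof -
    have "continuous_on (\<Omega> \<inter> ball x0 r \<union> (\<Omega> - cball x0 (2*R))) g"
      using that \<Omega> by (intro continuous_on_open_Un open_Int open_Diff
          continuous_on_eq[OF continuous_on_const[of "\<Omega> - cball x0 (2*R)" 0]]) auto
    moreover have "\<Omega> \<inter> ball x0 r \<union> (\<Omega> - cball x0 (2*R)) = \<Omega>" using sub by auto
    ultimately show ?thesis by simp
  qed
  have c\<kappa>: "continuous_on (\<Omega> \<inter> ball x0 r) (\<kappa> \<eta>)" and c\<theta>: "continuous_on (\<Omega> \<inter> ball x0 r) (\<theta> \<eta>)"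
    if "\<eta> > 0" for \<eta>
    unfolding \<kappa>_def[abs_def] \<theta>_def[abs_def]
    using that by (auto intro!: continuous_intros continuous_on_subset[OF c\<rho>])
  \<comment> \<open>Integration by parts for the product of \<open>a\<close>, \<open>f\<close> and
    the cutoff. It is used twice: with \<open>a = 1\<close> to bound the layer, and with
    \<open>a = V i\<close> for the flux itself.\<close>
  have gauss: "set_integrable lborel \<Omega> (\<lambda>x. (Da x * f x + E i x * a x) * \<kappa> \<eta> x + (- \<theta> \<eta> x * P i x) * (a x * f x))"
      "(LINT x:\<Omega>|lborel. (Da x * f x + E i x * a x) * \<kappa> \<eta> x + (- \<theta> \<eta> x * P i x) * (a x * f x)) = 0"
    if a: "\<And>x. x \<in> \<Omega> \<Longrightarrow> has_pd a (Da x) i x" "continuous_on \<Omega> a" "continuous_on \<Omega> Da"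
      and f: "C1_fun f E" "\<And>y. y \<notin> cball x0 (2*R) \<Longrightarrow> f y = 0" and \<eta>: "\<eta> > 0" for a Da f E i \<eta>
  proof -
    define K where "K = {x \<in> cball x0 (2*R). \<rho> x \<le> - \<eta>}"
    have K: "compact K"
    proof -
      have "closed K" unfolding K_def
        by (intro continuous_on_closed_Collect_le
            continuous_on_subset[OF c\<rho> sub] continuous_intros closed_cball)
      moreover have "bounded K" unfolding K_def by (rule bounded_subset[OF bounded_cball]) auto
      ultimately show ?thesis by (simp add: compact_eq_bounded_closed)
    qed
    have KO: "K \<subseteq> \<Omega>" using \<rho>neg sub \<eta> by (auto simp: K_def subset_eq)
    have E0: "E i y = 0" if "y \<notin> cball x0 (2*R)" for y
      using C1_fun_zero_deriv[OF f(1), of "- cball x0 (2*R)" y i] f(2) that by auto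
    have 1: "has_pd (\<lambda>x. (a x * f x) * \<kappa> \<eta> x)
        ((Da x * f x + E i x * a x) * \<kappa> \<eta> x + (- \<theta> \<eta> x * P i x) * (a x * f x)) i x" if x: "x \<in> \<Omega>" for x
    proof (cases "x \<in> ball x0 r")
      case True
      have "has_pd (\<lambda>x. (- 1 / \<eta>) * \<rho> x - 1) ((- 1 / \<eta>) * P i x - 0) i x"
        by (intro has_pd_diff has_pd_cmult pd\<rho> True has_pd_const)
      then have "has_pd (\<kappa> \<eta>) (smoothstep' ((- 1 / \<eta>) * \<rho> x - 1) * ((- 1 / \<eta>) * P i x - 0)) i x"
        unfolding \<kappa>_def[abs_def] by (rule has_pd_chain[OF _ DERIV_smoothstep])
      then have "has_pd (\<kappa> \<eta>) (- \<theta> \<eta> x * P i x) i x"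
        by (simp add: \<theta>_def)
      then show ?thesis
        using f(1) a(1)[OF x] by (intro has_pd_mult) (auto simp: C1_fun_def)
    next
      case False
      then have x': "x \<in> - cball x0 (2*R)" using sub by auto
      have "has_pd (\<lambda>x. (a x * f x) * \<kappa> \<eta> x) 0 i x"
        by (rule has_pd_zero_open[OF _ x']) (auto simp: f(2))
      then show ?thesis using x' f(2)[of x] E0[of x] by simp
    qed
    have 2: "continuous_on \<Omega> (\<lambda>x. (a x * f x) * \<kappa> \<eta> x)"
      "continuous_on \<Omega> (\<lambda>x. (Da x * f x + E i x * a x) * \<kappa> \<eta> x + (- \<theta> \<eta> x * P i x) * (a x * f x))"
    proof -
      have cf: "continuous_on S f" "continuous_on S (E i)" for S
        using f(1) by (auto simp: C1_fun_def intro: continuous_on_subset)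
      have ca: "continuous_on (\<Omega> \<inter> ball x0 r) a" "continuous_on (\<Omega> \<inter> ball x0 r) Da"
         "continuous_on (\<Omega> \<inter> ball x0 r) (P i)"
        using a(2,3) cP by (auto intro: continuous_on_subset)
      show "continuous_on \<Omega> (\<lambda>x. (a x * f x) * \<kappa> \<eta> x)"
        by (rule cont) (auto simp: f(2) intro!: continuous_intros cf ca c\<kappa> \<eta>)
      show "continuous_on \<Omega> (\<lambda>x. (Da x * f x + E i x * a x) * \<kappa> \<eta> x + (- \<theta> \<eta> x * P i x) * (a x * f x))"
        by (rule cont) (auto simp: f(2) E0 intro!: continuous_intros cf ca c\<kappa> c\<theta> \<eta>)
    qed
    have 3: "(a x * f x) * \<kappa> \<eta> x = 0" if "x \<in> \<Omega>" "x \<notin> K" for x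
    proof (cases "x \<in> cball x0 (2*R)")
      case True
      then have "\<rho> x > - \<eta>" using that by (auto simp: K_def)
      then have "(- 1 / \<eta>) * \<rho> x - 1 \<le> 0" using \<eta> by (simp add: field_simps)
      then show ?thesis by (simp add: \<kappa>_def smoothstep_eq_0)
    qed (simp add: f(2))
    show "set_integrable lborel \<Omega> (\<lambda>x. (Da x * f x + E i x * a x) * \<kappa> \<eta> x + (- \<theta> \<eta> x * P i x) * (a x * f x))"
      "(LINT x:\<Omega>|lborel. (Da x * f x + E i x * a x) * \<kappa> \<eta> x + (- \<theta> \<eta> x * P i x) * (a x * f x)) = 0"
      using set_integral_pd_eq_0[OF \<Omega>(1) 1 2 K KO 3] by auto
  qed
  obtain b Eb where b: "C1_fun b Eb" "\<And>x. norm (x - x0) \<le> R \<Longrightarrow> b x = 1"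
    "\<And>x. norm (x - x0) \<ge> 2 * R \<Longrightarrow> b x = 0" "\<And>x. 0 \<le> b x" "\<And>x. b x \<le> 1"
    using C1_bump[OF R(1), of x0] by metis
  have b0: "b y = 0" if "y \<notin> cball x0 (2*R)" for y
    using b(3)[of y] that by (simp add: dist_norm norm_minus_commute)
  have Eb0: "Eb j y = 0" if "y \<notin> cball x0 (2*R)" for y
    using C1_fun_zero_deriv[OF b(1), of "- cball x0 (2*R)" y j] b0 that by auto
  obtain Mb where Mb: "Mb > 0" "\<And>x. x \<in> \<Omega> \<Longrightarrow> \<bar>Eb j x\<bar> \<le> Mb"
    using continuous_on_bounded_set[of "Eb j" \<Omega>] b(1) \<Omega> unfolding C1_fun_def by blast
  have \<kappa>01: "0 \<le> \<kappa> \<eta> x" "\<kappa> \<eta> x \<le> 1" for \<eta> x by (auto simp: \<kappa>_def smoothstep_bounds)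
  have \<theta>0: "0 \<le> \<theta> \<eta> x" "\<theta> \<eta> x \<le> 6 / \<eta>" if "\<eta> > 0" for \<eta> x
    using that smoothstep'_nonneg smoothstep'_le by (auto simp: \<theta>_def divide_right_mono)
  have cb: "continuous_on S b" "continuous_on S (Eb j)" for S
    using b(1) by (auto simp: C1_fun_def intro: continuous_on_subset)
  have ib: "set_integrable lborel \<Omega> (\<lambda>x. b x * \<theta> \<eta> x)" if \<eta>: "\<eta> > 0" for \<eta>
  proof (rule continuous_bounded_set_integrable[OF \<Omega>])
    show "continuous_on \<Omega> (\<lambda>x. b x * \<theta> \<eta> x)"
      by (rule cont) (auto simp: b0 intro!: continuous_intros cb c\<theta> \<eta>)
    show "\<bar>b x * \<theta> \<eta> x\<bar> \<le> 1 * (6 / \<eta>)" for x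
      unfolding abs_mult using b(4,5)[of x] \<theta>0[OF \<eta>, of x] by (intro mult_mono) auto
  qed
  \<comment> \<open>From \<open>gauss\<close> for the bump \<open>b\<close> in direction
    \<open>j\<close>: \<open>c * b * \<theta>\<close> is at most
    \<open>\<sigma> * \<theta> * P j * b\<close>, whose integral equals that of
    \<open>\<sigma> * Eb j * \<kappa>\<close>. The latter is at most \<open>Mb\<close> times the
    volume, whatever \<open>\<eta>\<close> is.\<close>
  define C where "C = Mb * measure lborel \<Omega> / c"
  have fin: "emeasure lborel \<Omega> < \<infinity>" using emeasure_bounded_finite[OF \<Omega>(2)] by simp
  have layer: "(LINT x:\<Omega>|lborel. b x * \<theta> \<eta> x) \<le> C" if \<eta>: "\<eta> > 0" for \<eta>
  proof -
    have i1: "set_integrable lborel \<Omega> (\<lambda>x. Eb j x * \<kappa> \<eta> x)"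
    proof (rule continuous_bounded_set_integrable[OF \<Omega>])
      show "continuous_on \<Omega> (\<lambda>x. Eb j x * \<kappa> \<eta> x)"
        by (rule cont) (auto simp: Eb0 intro!: continuous_intros cb c\<kappa> \<eta>)
      show "\<bar>Eb j x * \<kappa> \<eta> x\<bar> \<le> Mb * 1" if "x \<in> \<Omega>" for x
        unfolding abs_mult using Mb(2)[OF that] Mb(1) \<kappa>01[of \<eta> x] by (intro mult_mono) auto
    qed
    have g: "set_integrable lborel \<Omega> (\<lambda>x. Eb j x * \<kappa> \<eta> x + (- \<theta> \<eta> x * P j x) * b x)"
       "(LINT x:\<Omega>|lborel. Eb j x * \<kappa> \<eta> x + (- \<theta> \<eta> x * P j x) * b x) = 0"
      using gauss[of "\<lambda>_. 1" "\<lambda>_. 0" j b Eb \<eta>] b(1) b0 \<eta> by auto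
    have i2: "set_integrable lborel \<Omega> (\<lambda>x. \<theta> \<eta> x * P j x * b x)"
      using set_integral_diff(1)[OF i1 g(1)] by simp
    have eq: "(LINT x:\<Omega>|lborel. \<theta> \<eta> x * P j x * b x) = (LINT x:\<Omega>|lborel. Eb j x * \<kappa> \<eta> x)"
      using set_integral_diff(2)[OF i1 g(1)] g(2) by simp
    have "c * (LINT x:\<Omega>|lborel. b x * \<theta> \<eta> x) = (LINT x:\<Omega>|lborel. c * (b x * \<theta> \<eta> x))" by simp
    also have "\<dots> \<le> (LINT x:\<Omega>|lborel. \<sigma> * (\<theta> \<eta> x * P j x * b x))"
    proof (rule set_integral_mono)
      fix x
      show "c * (b x * \<theta> \<eta> x) \<le> \<sigma> * (\<theta> \<eta> x * P j x * b x)"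
      proof (cases "x \<in> cball x0 (2*R)")
        case True
        have "c * (b x * \<theta> \<eta> x) \<le> (\<sigma> * P j x) * (b x * \<theta> \<eta> x)"
          using Pj[OF True] b(4)[of x] \<theta>0[OF \<eta>, of x] by (intro mult_right_mono) auto
        then show ?thesis by (simp add: mult_ac)
      qed (simp add: b0)
    qed (use i2 ib[OF \<eta>] in auto)
    also have "\<dots> = (LINT x:\<Omega>|lborel. \<sigma> * (Eb j x * \<kappa> \<eta> x))" using eq by simp
    also have "\<dots> \<le> (LINT x:\<Omega>|lborel. Mb)"
    proof (rule set_integral_mono)
      show "set_integrable lborel \<Omega> (\<lambda>x. Mb)"
        using fin \<Omega> by (simp add: set_integrable_def)
      fix x assume x: "x \<in> \<Omega>"
      have "\<bar>\<sigma> * (Eb j x * \<kappa> \<eta> x)\<bar> \<le> 1 * (Mb * 1)"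
        unfolding abs_mult using Mb(2)[OF x] Mb(1) \<kappa>01[of \<eta> x]
        by (intro mult_mono) (auto simp: \<sigma>_def abs_sgn_eq)
      then show "\<sigma> * (Eb j x * \<kappa> \<eta> x) \<le> Mb" by simp
    qed (use i1 in auto)
    also have "\<dots> = Mb * measure lborel \<Omega>"
      using fin \<Omega> by (simp add: set_lebesgue_integral_def)
    finally show ?thesis using c by (simp add: C_def field_simps)
  qed
  have C0: "C \<ge> 0" using Mb c by (simp add: C_def)
  have "locally_div_free_at x0 R"
    unfolding locally_div_free_at_def
  proof (intro allI impI)
    fix \<phi> E assume \<phi>: "C1_fun \<phi> E" and \<phi>0': "\<forall>y. y \<notin> cball x0 R \<longrightarrow> \<phi> y = 0"
    have \<phi>0: "\<phi> y = 0" if "y \<notin> cball x0 (2*R)" for y using \<phi>0' that R by auto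
    have E0: "E i y = 0" if "y \<notin> cball x0 (2*R)" for y i
      using C1_fun_zero_deriv[OF \<phi>, of "- cball x0 (2*R)" y i] \<phi>0 that by auto
    have A0: "weak_div \<phi> E y = 0" if "y \<notin> cball x0 (2*R)" for y
      using \<phi>0[OF that] E0[OF that] by (simp add: weak_div_def)
    obtain M where M: "M > 0" "\<And>x. x \<in> \<Omega> \<Longrightarrow> \<bar>weak_div \<phi> E x\<bar> \<le> M" using weak_div_bound[OF \<phi>] by blast
    obtain M\<phi> where M\<phi>: "M\<phi> > 0" "\<And>x. x \<in> \<Omega> \<Longrightarrow> \<bar>\<phi> x\<bar> \<le> M\<phi>"
      using continuous_on_bounded_set[of \<phi> \<Omega>] \<phi> \<Omega> unfolding C1_fun_def by blast
    \<comment> \<open>The field against the gradient of \<open>\<rho>\<close>: the flux density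
      through the level sets of \<open>\<rho>\<close>, up to normalisation.\<close>
    define W where "W x = (\<Sum>i\<in>UNIV. V i x * P i x)" for x
    have iA: "set_integrable lborel \<Omega> (\<lambda>x. weak_div \<phi> E x * \<kappa> \<eta> x)" if \<eta>: "\<eta> > 0" for \<eta>
    proof (rule continuous_bounded_set_integrable[OF \<Omega>])
      show "continuous_on \<Omega> (\<lambda>x. weak_div \<phi> E x * \<kappa> \<eta> x)"
        by (rule cont) (auto simp: A0 intro!: continuous_intros c\<kappa> \<eta> continuous_on_subset[OF weak_div_continuous[OF \<phi>]])
      show "\<bar>weak_div \<phi> E x * \<kappa> \<eta> x\<bar> \<le> M * 1" if "x \<in> \<Omega>" for x
        unfolding abs_mult using M(2)[OF that] M(1) \<kappa>01[of \<eta> x] by (intro mult_mono) auto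
    qed
    have split: "set_integrable lborel \<Omega> (\<lambda>x. \<theta> \<eta> x * W x * \<phi> x)"
      "(LINT x:\<Omega>|lborel. weak_div \<phi> E x * \<kappa> \<eta> x) = (LINT x:\<Omega>|lborel. \<theta> \<eta> x * W x * \<phi> x)" if \<eta>: "\<eta> > 0" for \<eta>
    proof -
      let ?t = "\<lambda>i x. (D i x * \<phi> x + E i x * V i x) * \<kappa> \<eta> x + (- \<theta> \<eta> x * P i x) * (V i x * \<phi> x)"
      have g: "set_integrable lborel \<Omega> (?t i)" "(LINT x:\<Omega>|lborel. ?t i x) = 0" for i
        using gauss[of "V i" "D i" i \<phi> E \<eta>] V cV cD \<phi> \<phi>0 \<eta> by auto
      have "(\<Sum>i\<in>UNIV. ?t i x) = weak_div \<phi> E x * \<kappa> \<eta> x - \<theta> \<eta> x * W x * \<phi> x" for x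
        unfolding weak_div_def W_def
        by (simp add: sum.distrib sum_distrib_left sum_distrib_right algebra_simps sum_subtractf)
      then have s: "set_integrable lborel \<Omega> (\<lambda>x. weak_div \<phi> E x * \<kappa> \<eta> x - \<theta> \<eta> x * W x * \<phi> x)"
        "(LINT x:\<Omega>|lborel. weak_div \<phi> E x * \<kappa> \<eta> x - \<theta> \<eta> x * W x * \<phi> x) = 0"
        using set_integral_sum[of UNIV lborel \<Omega> ?t] g by auto
      show i: "set_integrable lborel \<Omega> (\<lambda>x. \<theta> \<eta> x * W x * \<phi> x)"
        using set_integral_diff(1)[OF iA[OF \<eta>] s(1)] by simp
      show "(LINT x:\<Omega>|lborel. weak_div \<phi> E x * \<kappa> \<eta> x) = (LINT x:\<Omega>|lborel. \<theta> \<eta> x * W x * \<phi> x)"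
        using set_integral_diff(2)[OF iA[OF \<eta>] i] s(2) by simp
    qed
    define h where "h m = inverse (real (Suc m))" for m
    have h: "h m > 0" for m by (auto simp: h_def)
    have hlim: "h \<longlonglongrightarrow> 0" unfolding h_def by (rule LIMSEQ_inverse_real_of_nat)
    have lim: "(\<lambda>m. LINT x:\<Omega>|lborel. weak_div \<phi> E x * \<kappa> (h m) x) \<longlonglongrightarrow> (LINT x:\<Omega>|lborel. weak_div \<phi> E x)"
      unfolding set_lebesgue_integral_def
    proof (rule integral_dominated_convergence)
      show "(\<lambda>x. indicat_real \<Omega> x *\<^sub>R weak_div \<phi> E x) \<in> borel_measurable lborel"
        using weak_div_integrable[OF \<phi>] by (auto simp: set_integrable_def)
      show "(\<lambda>x. indicat_real \<Omega> x *\<^sub>R (weak_div \<phi> E x * \<kappa> (h m) x)) \<in> borel_measurable lborel" for m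
        using iA[OF h] by (auto simp: set_integrable_def)
      show "integrable lborel (\<lambda>x. indicat_real \<Omega> x * M)" using fin \<Omega> by simp
      show "AE x in lborel. norm (indicat_real \<Omega> x *\<^sub>R (weak_div \<phi> E x * \<kappa> (h m) x)) \<le> indicat_real \<Omega> x * M" for m
      proof (intro AE_I2)
        fix x
        have "\<bar>weak_div \<phi> E x * \<kappa> (h m) x\<bar> \<le> M * 1" if "x \<in> \<Omega>"
          unfolding abs_mult using M(2)[OF that] M(1) \<kappa>01[of "h m" x] by (intro mult_mono) auto
        then show "norm (indicat_real \<Omega> x *\<^sub>R (weak_div \<phi> E x * \<kappa> (h m) x)) \<le> indicat_real \<Omega> x * M"
          by (auto split: split_indicator)
      qed
      show "AE x in lborel. (\<lambda>m. indicat_real \<Omega> x *\<^sub>R (weak_div \<phi> E x * \<kappa> (h m) x)) \<longlonglongrightarrow> indicat_real \<Omega> x *\<^sub>R weak_div \<phi> E x"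
      proof (intro AE_I2)
        fix x
        show "(\<lambda>m. indicat_real \<Omega> x *\<^sub>R (weak_div \<phi> E x * \<kappa> (h m) x)) \<longlonglongrightarrow> indicat_real \<Omega> x *\<^sub>R weak_div \<phi> E x"
        proof (cases "x \<in> \<Omega> \<inter> cball x0 (2*R)")
          case True
          then have neg: "\<rho> x < 0" using \<rho>neg sub by auto
          have "\<forall>\<^sub>F m in sequentially. h m < - \<rho> x / 2"
            using neg by (intro order_tendstoD(2)[OF hlim]) auto
          then have "\<forall>\<^sub>F m in sequentially. indicat_real \<Omega> x *\<^sub>R (weak_div \<phi> E x * \<kappa> (h m) x) = indicat_real \<Omega> x *\<^sub>R weak_div \<phi> E x"
          proof eventually_elim
            case (elim m)
            then have "(- 1 / h m) * \<rho> x - 1 \<ge> 1" using h[of m] by (simp add: field_simps)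
            then show ?case by (simp add: \<kappa>_def smoothstep_eq_1)
          qed
          then show ?thesis by (rule tendsto_eventually)
        next
          case False
          then have "x \<notin> \<Omega> \<or> weak_div \<phi> E x = 0" using A0 by auto
          then show ?thesis by auto
        qed
      qed
    qed
    have small: "\<bar>LINT x:\<Omega>|lborel. weak_div \<phi> E x\<bar> \<le> e * (M\<phi> * C)" if e: "e > 0" for e
    proof -
      obtain \<delta> where \<delta>: "\<delta> > 0" "\<And>x. x \<in> \<Omega> \<Longrightarrow> x \<in> cball x0 R \<Longrightarrow> infdist x (frontier \<Omega>) < \<delta> \<Longrightarrow> \<bar>W x\<bar> \<le> e"
        using decay[of R e] R e unfolding W_def P_def by auto
      \<comment> \<open>On this compact set \<open>\<rho>\<close> is at most some
        \<open>- \<eta>0 < 0\<close>. The layer of \<open>\<theta> \<eta>\<close> has depth at most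
        \<open>2 * \<eta>\<close>, so for small \<open>\<eta>\<close> it misses \<open>S\<close>,
        and only points where \<open>decay\<close> applies remain.\<close>
      define S where "S = {x \<in> cball x0 R \<inter> closure \<Omega>. \<delta> \<le> infdist x (frontier \<Omega>)}"
      have "closed S" unfolding S_def
        by (intro continuous_on_closed_Collect_le continuous_intros closed_Int closed_cball closed_closure)
      moreover have "bounded S" unfolding S_def by (rule bounded_subset[OF bounded_cball]) auto
      ultimately have S: "compact S" by (simp add: compact_eq_bounded_closed)
      have Sb: "S \<subseteq> ball x0 r" using sub R by (auto simp: S_def)
      have S\<Omega>: "\<rho> x < 0" if "x \<in> S" for x
      proof -
        have "x \<notin> frontier \<Omega>" using that \<delta> by (auto simp: S_def)
        then have "x \<in> \<Omega>" using that \<Omega> by (auto simp: S_def frontier_def interior_open)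
        then show ?thesis using \<rho>neg Sb that by auto
      qed
      obtain \<eta>0 where \<eta>0: "\<eta>0 > 0" "\<And>x. x \<in> S \<Longrightarrow> \<rho> x \<le> - \<eta>0"
      proof (cases "S = {}")
        case True then show ?thesis using that[of 1] by auto
      next
        case False
        then obtain z where "z \<in> S" "\<And>y. y \<in> S \<Longrightarrow> \<rho> y \<le> \<rho> z"
          using continuous_attains_sup[OF S False continuous_on_subset[OF c\<rho> Sb]] by metis
        then show ?thesis using that[of "- \<rho> z"] S\<Omega> by auto
      qed
      have bnd: "\<bar>LINT x:\<Omega>|lborel. weak_div \<phi> E x * \<kappa> \<eta> x\<bar> \<le> e * (M\<phi> * C)" if \<eta>: "\<eta> > 0" "2 * \<eta> < \<eta>0" for \<eta>
      proof -
        have pt: "\<bar>\<theta> \<eta> x * W x * \<phi> x\<bar> \<le> (e * M\<phi>) * (b x * \<theta> \<eta> x)" if x: "x \<in> \<Omega>" for x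
        proof (cases "x \<in> cball x0 R \<and> \<theta> \<eta> x \<noteq> 0")
          case True
          then have "smoothstep' ((- 1 / \<eta>) * \<rho> x - 1) \<noteq> 0" by (auto simp: \<theta>_def)
          then have "(- 1 / \<eta>) * \<rho> x - 1 \<le> 1" by (auto simp: smoothstep'_eq split: if_splits)
          then have "- \<rho> x \<le> 2 * \<eta>" using \<eta> by (simp add: field_simps)
          then have "x \<notin> S" using \<eta>0(2)[of x] \<eta> by auto
          then have "infdist x (frontier \<Omega>) < \<delta>" using True x closure_subset[of \<Omega>] by (auto simp: S_def)
          then have W: "\<bar>W x\<bar> \<le> e" using \<delta>(2) x True by auto
          have b1: "b x = 1" using b(2)[of x] True by (simp add: dist_norm norm_minus_commute)
          have "\<theta> \<eta> x * \<bar>W x\<bar> * \<bar>\<phi> x\<bar> \<le> \<theta> \<eta> x * e * M\<phi>"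
            using W M\<phi>(2)[OF x] \<theta>0[OF \<eta>(1), of x] e by (intro mult_mono) auto
          then show ?thesis using \<theta>0[OF \<eta>(1), of x] b1 by (simp add: abs_mult mult_ac)
        next
          case False
          then have "\<bar>\<theta> \<eta> x * W x * \<phi> x\<bar> = 0" using \<phi>0' by auto
          moreover have "(e * M\<phi>) * (b x * \<theta> \<eta> x) \<ge> 0"
            using b(4)[of x] \<theta>0[OF \<eta>(1), of x] e M\<phi> by (intro mult_nonneg_nonneg) auto
          ultimately show ?thesis by linarith
        qed
        have "\<bar>LINT x:\<Omega>|lborel. \<theta> \<eta> x * W x * \<phi> x\<bar> \<le> (LINT x:\<Omega>|lborel. \<bar>\<theta> \<eta> x * W x * \<phi> x\<bar>)"
          using set_integral_norm_bound[OF split(1)[OF \<eta>(1)]] by simp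
        also have "\<dots> \<le> (LINT x:\<Omega>|lborel. (e * M\<phi>) * (b x * \<theta> \<eta> x))"
          using pt ib[OF \<eta>(1)] split(1)[OF \<eta>(1)] by (intro set_integral_mono set_integrable_abs) auto
        also have "\<dots> = (e * M\<phi>) * (LINT x:\<Omega>|lborel. b x * \<theta> \<eta> x)" by simp
        also have "\<dots> \<le> (e * M\<phi>) * C" using layer[OF \<eta>(1)] e M\<phi> by (intro mult_left_mono) auto
        finally show ?thesis by (simp add: split(2)[OF \<eta>(1)] mult.assoc)
      qed
      have "\<forall>\<^sub>F m in sequentially. h m < \<eta>0 / 2"
        using \<eta>0 by (intro order_tendstoD(2)[OF hlim]) auto
      then have "\<forall>\<^sub>F m in sequentially. \<bar>LINT x:\<Omega>|lborel. weak_div \<phi> E x * \<kappa> (h m) x\<bar> \<le> e * (M\<phi> * C)"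
        by eventually_elim (rule bnd, use h in auto)
      then show ?thesis
        by (intro tendsto_upperbound[OF tendsto_rabs[OF lim]]) auto
    qed
    show "(LINT x:\<Omega>|lborel. weak_div \<phi> E x) = 0"
    proof (rule ccontr)
      assume "(LINT x:\<Omega>|lborel. weak_div \<phi> E x) \<noteq> 0"
      then have p: "\<bar>LINT x:\<Omega>|lborel. weak_div \<phi> E x\<bar> > 0" by simp
      define e where "e = \<bar>LINT x:\<Omega>|lborel. weak_div \<phi> E x\<bar> / (2 * (M\<phi> * C + 1))"
      have k: "M\<phi> * C + 1 > 0" using M\<phi> C0 by (intro add_nonneg_pos) auto
      have e: "e > 0" using p k by (simp add: e_def)
      have "\<bar>LINT x:\<Omega>|lborel. weak_div \<phi> E x\<bar> = 2 * (e * (M\<phi> * C + 1))" using k by (simp add: e_def field_simps)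
      also have "\<dots> > e * (M\<phi> * C)" using mult_pos_pos[OF e k] e by (simp add: algebra_simps)
      finally show False using small[OF e] by simp
    qed
  qed
  then show ?thesis using R by auto
qed

text \<open>Partition of unity by peeling: multiplication by a bump splits off a piece supported in
  one ball of a finite cover, and the remainder vanishes on the corresponding half ball, so
  induction on the cover applies. The start is the constant function 1.\<close>

theorem divergence_integral_eq_0:
  assumes bd: "\<And>x0. x0 \<in> frontier \<Omega> \<Longrightarrow> \<exists>r \<rho>. local_defining \<Omega> x0 r \<rho> \<and>
     (\<forall>s e. s < r \<longrightarrow> e > 0 \<longrightarrow> (\<exists>\<delta>>0. \<forall>x\<in>\<Omega> \<inter> cball x0 s.
       infdist x (frontier \<Omega>) < \<delta> \<longrightarrow> \<bar>\<Sum>i\<in>UNIV. V i x * dpart \<rho> [i] x\<bar> \<le> e))"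
  shows "(LINT x:\<Omega>|lborel. \<Sum>i\<in>UNIV. D i x) = 0"
proof -
  have "\<exists>R>0. locally_div_free_at x R" if x: "x \<in> closure \<Omega>" for x
  proof (cases "x \<in> \<Omega>")
    case True
    then show ?thesis using interior_local \<Omega>(1) open_contains_cball by metis
  next
    case False
    then have "x \<in> frontier \<Omega>" using x \<Omega> by (simp add: frontier_def interior_open)
    then obtain r \<rho> where "local_defining \<Omega> x r \<rho>" and d: "\<forall>s e. s < r \<longrightarrow> e > 0 \<longrightarrow> (\<exists>\<delta>>0. \<forall>x\<in>\<Omega> \<inter> cball x s.
       infdist x (frontier \<Omega>) < \<delta> \<longrightarrow> \<bar>\<Sum>i\<in>UNIV. V i x * dpart \<rho> [i] x\<bar> \<le> e)"
      using bd by blast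
    with \<open>x \<in> frontier \<Omega>\<close> show ?thesis using boundary_local by blast
  qed
  then obtain R where R: "\<And>x. x \<in> closure \<Omega> \<Longrightarrow> R x > 0 \<and> locally_div_free_at x (R x)" by metis
  have comp: "compact (closure \<Omega>)" using \<Omega> by simp
  \<comment> \<open>Half radii: the bump for a centre \<open>c\<close> equals 1 on the ball of
    radius \<open>R c / 2\<close> and vanishes outside the ball of radius \<open>R c\<close>, to
    which \<open>locally_div_free_at\<close> refers.\<close>
  obtain T where T: "T \<subseteq> closure \<Omega>" "finite T" "closure \<Omega> \<subseteq> (\<Union>x\<in>T. ball x (R x / 2))"
  proof (rule compactE_image[OF comp, of "closure \<Omega>" "\<lambda>x. ball x (R x / 2)"])
    show "closure \<Omega> \<subseteq> (\<Union>x\<in>closure \<Omega>. ball x (R x / 2))" using R by force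
  qed auto
  have "(LINT x:\<Omega>|lborel. weak_div \<phi> E x) = 0"
    if "C1_fun \<phi> E" "\<And>y. y \<in> \<Omega> \<Longrightarrow> y \<notin> (\<Union>x\<in>T. ball x (R x / 2)) \<Longrightarrow> \<phi> y = 0" for \<phi> E
    using T(2,1) that
  proof (induction T arbitrary: \<phi> E)
    case empty
    have "weak_div \<phi> E x = 0" if "x \<in> \<Omega>" for x
      using empty.prems C1_fun_zero_deriv[OF empty.prems(2) \<Omega>(1) that] that by (simp add: weak_div_def)
    then have "(\<lambda>x. indicat_real \<Omega> x *\<^sub>R weak_div \<phi> E x) = (\<lambda>x. 0)"
      by (auto split: split_indicator)
    then show ?case by (simp add: set_lebesgue_integral_def)
  next
    case (insert c T)
    have Rc: "R c > 0" "locally_div_free_at c (R c)" using R insert.prems(1) by auto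
    obtain b Eb where b: "C1_fun b Eb" "\<And>x. norm (x - c) \<le> R c / 2 \<Longrightarrow> b x = 1"
      "\<And>x. norm (x - c) \<ge> 2 * (R c / 2) \<Longrightarrow> b x = 0"
      using C1_bump[of "R c / 2" c] Rc(1) by (metis half_gt_zero)
    let ?E1 = "\<lambda>i x. E i x * b x + Eb i x * \<phi> x"
    have 1: "C1_fun (\<lambda>x. \<phi> x * b x) ?E1"
      by (rule C1_fun_mult[OF insert.prems(2) b(1)])
    have 2: "C1_fun (\<lambda>x. \<phi> x - \<phi> x * b x) (\<lambda>i x. E i x - ?E1 i x)"
      by (rule C1_fun_diff[OF insert.prems(2) 1])
    have i1: "(LINT x:\<Omega>|lborel. weak_div (\<lambda>x. \<phi> x * b x) ?E1 x) = 0"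
    proof -
      have "\<phi> y * b y = 0" if "y \<notin> cball c (R c)" for y
        using b(3)[of y] that by (simp add: dist_norm norm_minus_commute)
      then show ?thesis using Rc(2) 1 unfolding locally_div_free_at_def by blast
    qed
    have i2: "(LINT x:\<Omega>|lborel. weak_div (\<lambda>x. \<phi> x - \<phi> x * b x) (\<lambda>i x. E i x - ?E1 i x) x) = 0"
    proof (rule insert.IH[OF _ 2])
      show "T \<subseteq> closure \<Omega>" using insert.prems by auto
      fix y assume y: "y \<in> \<Omega>" "y \<notin> (\<Union>x\<in>T. ball x (R x / 2))"
      show "\<phi> y - \<phi> y * b y = 0"
      proof (cases "y \<in> ball c (R c / 2)")
        case True
        then show ?thesis using b(2)[of y] by (simp add: dist_norm norm_minus_commute)
      next
        case False
        then show ?thesis using insert.prems(3)[of y] y by auto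
      qed
    qed
    have "weak_div \<phi> E x = weak_div (\<lambda>x. \<phi> x * b x) ?E1 x + weak_div (\<lambda>x. \<phi> x - \<phi> x * b x) (\<lambda>i x. E i x - ?E1 i x) x" for x
      unfolding weak_div_def by (simp add: algebra_simps sum.distrib sum_subtractf)
    then have "(LINT x:\<Omega>|lborel. weak_div \<phi> E x) = (LINT x:\<Omega>|lborel. weak_div (\<lambda>x. \<phi> x * b x) ?E1 x)
        + (LINT x:\<Omega>|lborel. weak_div (\<lambda>x. \<phi> x - \<phi> x * b x) (\<lambda>i x. E i x - ?E1 i x) x)"
      using set_integral_add(2)[OF weak_div_integrable[OF 1] weak_div_integrable[OF 2]] by simp
    then show ?case using i1 i2 by simp
  qed
  moreover have "y \<in> (\<Union>x\<in>T. ball x (R x / 2))" if "y \<in> \<Omega>" for y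
    using T(3) closure_subset[of \<Omega>] that by blast
  ultimately have "(LINT x:\<Omega>|lborel. weak_div (\<lambda>x. 1) (\<lambda>i x. 0) x) = 0"
    using C1_fun_const[of 1] by metis
  then show ?thesis by (simp add: weak_div_def)
qed

end

section \<open>Hoelder functions and normal derivatives\<close>

locale holder_domain =
  fixes \<Omega> :: "(real^'n) set" and s :: real
  assumes op: "open \<Omega>" and bd: "bounded \<Omega>" and ne: "\<Omega> \<noteq> {}" and s1: "s > 1" and sN: "s \<notin> \<nat>"
begin

section \<open>Hoelder norms and moduli of continuity\<close>

definition m :: nat where "m = nat \<lfloor>s\<rfloor>"
definition \<alpha> :: real where "\<alpha> = s - of_int \<lfloor>s\<rfloor>"

lemma m1: "m \<ge> 1" using s1 by (simp add: m_def le_nat_iff)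

text \<open>Positivity is where \<open>s\<close> not being a natural number enters; all boundary
  rates are powers with this exponent.\<close>

lemma \<alpha>: "0 < \<alpha>" "\<alpha> < 1"
proof -
  have "s \<noteq> of_int \<lfloor>s\<rfloor>"
  proof
    assume "s = of_int \<lfloor>s\<rfloor>"
    moreover have "of_int \<lfloor>s\<rfloor> = real (nat \<lfloor>s\<rfloor>)" using s1 by simp
    ultimately show False using sN by (metis of_nat_in_Nats)
  qed
  then show "0 < \<alpha>" using of_int_floor_le[of s] unfolding \<alpha>_def by linarith
  show "\<alpha> < 1" unfolding \<alpha>_def by linarith
qed

lemma finite_multi_indices: "finite {\<beta> :: 'n list. length \<beta> \<le> k}" "finite {\<beta> :: 'n list. length \<beta> = k}"
  using finite_lists_length_le[of "UNIV :: 'n set" k] finite_lists_length_eq[of "UNIV :: 'n set" k] by simp_all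

lemma hquot_nonneg: "z \<in> hquot a \<Omega> g \<Longrightarrow> z \<ge> 0"
  by (auto simp: hquot_def)

text \<open>A supremum over the empty set would carry no information, so a second point of \<Omega>
  is produced from its openness.\<close>

lemma hquot_nonempty: "hquot a \<Omega> g \<noteq> {}"
proof -
  obtain x where x: "x \<in> \<Omega>" using ne by blast
  then obtain e where e: "e > 0" "cball x e \<subseteq> \<Omega>" using op open_contains_cball by metis
  have "x + e *\<^sub>R axis undefined 1 \<in> \<Omega>" using e by (intro subsetD[OF e(2)]) (simp add: dist_norm)
  moreover have "x \<noteq> x + e *\<^sub>R axis undefined 1" using e by (simp add: axis_eq_0_iff)
  ultimately show ?thesis using x unfolding hquot_def by blast
qed

lemma holder_space_Ck: "u \<in> holder_space s \<Omega> \<Longrightarrow> Ck m \<Omega> u"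
  by (simp add: holder_space_def m_def)

lemma holder_space_bdd:
  assumes "u \<in> holder_space s \<Omega>" "length \<beta> \<le> m"
  shows "bdd_above ((\<lambda>x. \<bar>dpart u \<beta> x\<bar>) ` \<Omega>)"
proof -
  have "bounded (dpart u \<beta> ` \<Omega>)" using assms by (auto simp: holder_space_def m_def)
  then obtain M where "\<And>x. x \<in> \<Omega> \<Longrightarrow> \<bar>dpart u \<beta> x\<bar> \<le> M" unfolding bounded_iff by auto
  then show ?thesis by (intro bdd_aboveI[of _ M]) auto
qed

lemma holder_space_bdd_hquot:
  "u \<in> holder_space s \<Omega> \<Longrightarrow> length \<beta> = m \<Longrightarrow> bdd_above (hquot \<alpha> \<Omega> (dpart u \<beta>))"
  by (auto simp: holder_space_def m_def \<alpha>_def)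

lemma holder_norm_eq: "holder_norm s \<Omega> u =
     (\<Sum>\<beta>\<in>{\<beta>. length \<beta> \<le> m}. (SUP x\<in>\<Omega>. \<bar>dpart u \<beta> x\<bar>)) +
     (\<Sum>\<beta>\<in>{\<beta>. length \<beta> = m}. Sup (hquot \<alpha> \<Omega> (dpart u \<beta>)))"
  by (simp add: holder_norm_def m_def \<alpha>_def)

lemma SUP_dpart_nonneg:
  assumes "u \<in> holder_space s \<Omega>" "length \<beta> \<le> m"
  shows "0 \<le> (SUP x\<in>\<Omega>. \<bar>dpart u \<beta> x\<bar>)"
  using cSUP_upper2[OF holder_space_bdd[OF assms]] ne by (metis abs_ge_zero ex_in_conv)

lemma Sup_hquot_nonneg:
  assumes "u \<in> holder_space s \<Omega>" "length \<beta> = m"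
  shows "0 \<le> Sup (hquot \<alpha> \<Omega> (dpart u \<beta>))"
  using cSup_upper2[OF _ _ holder_space_bdd_hquot[OF assms]] hquot_nonempty hquot_nonneg by (metis ex_in_conv)

lemma holder_norm_nonneg:
  assumes "u \<in> holder_space s \<Omega>"
  shows "0 \<le> holder_norm s \<Omega> u"
  unfolding holder_norm_eq
  by (intro add_nonneg_nonneg sum_nonneg) (auto intro: SUP_dpart_nonneg[OF assms] Sup_hquot_nonneg[OF assms])

lemma dpart_le_holder_norm:
  assumes u: "u \<in> holder_space s \<Omega>" and \<beta>: "length \<beta> \<le> m" and x: "x \<in> \<Omega>"
  shows "\<bar>dpart u \<beta> x\<bar> \<le> holder_norm s \<Omega> u"
proof -
  have "\<bar>dpart u \<beta> x\<bar> \<le> (SUP x\<in>\<Omega>. \<bar>dpart u \<beta> x\<bar>)"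
    by (rule cSUP_upper[OF x holder_space_bdd[OF u \<beta>]])
  also have "\<dots> \<le> (\<Sum>\<beta>\<in>{\<beta>. length \<beta> \<le> m}. (SUP x\<in>\<Omega>. \<bar>dpart u \<beta> x\<bar>))"
    using \<beta> by (intro member_le_sum finite_multi_indices SUP_dpart_nonneg[OF u]) auto
  also have "\<dots> \<le> holder_norm s \<Omega> u"
  proof -
    have "0 \<le> (\<Sum>\<beta>\<in>{\<beta>. length \<beta> = m}. Sup (hquot \<alpha> \<Omega> (dpart u \<beta>)))"
      using Sup_hquot_nonneg[OF u] by (intro sum_nonneg) auto
    then show ?thesis unfolding holder_norm_eq by linarith
  qed
  finally show ?thesis .
qed

lemma hquot_le_holder_norm:
  assumes u: "u \<in> holder_space s \<Omega>" and \<beta>: "length \<beta> = m" and x: "x \<in> \<Omega>" "y \<in> \<Omega>"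
  shows "\<bar>dpart u \<beta> x - dpart u \<beta> y\<bar> \<le> holder_norm s \<Omega> u * dist x y powr \<alpha>"
proof (cases "x = y")
  case False
  then have "\<bar>dpart u \<beta> x - dpart u \<beta> y\<bar> / dist x y powr \<alpha> \<in> hquot \<alpha> \<Omega> (dpart u \<beta>)"
    using x unfolding hquot_def by blast
  then have "\<bar>dpart u \<beta> x - dpart u \<beta> y\<bar> / dist x y powr \<alpha> \<le> Sup (hquot \<alpha> \<Omega> (dpart u \<beta>))"
    by (rule cSup_upper[OF _ holder_space_bdd_hquot[OF u \<beta>]])
  also have "\<dots> \<le> (\<Sum>\<beta>\<in>{\<beta>. length \<beta> = m}. Sup (hquot \<alpha> \<Omega> (dpart u \<beta>)))"
    using \<beta> by (intro member_le_sum finite_multi_indices Sup_hquot_nonneg[OF u]) auto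
  also have "\<dots> \<le> holder_norm s \<Omega> u"
  proof -
    have "0 \<le> (\<Sum>\<beta>\<in>{\<beta>. length \<beta> \<le> m}. (SUP x\<in>\<Omega>. \<bar>dpart u \<beta> x\<bar>))"
      using SUP_dpart_nonneg[OF u] by (intro sum_nonneg) auto
    then show ?thesis unfolding holder_norm_eq by linarith
  qed
  finally show ?thesis using False by (simp add: field_simps)
qed simp

text \<open>Any bound on the distances, not the exact diameter; it is at least 1 so that the same
  factor serves both cases of \<open>dist_le_powr\<close>.\<close>

definition diam :: real where
  "diam = (SOME D. 1 \<le> D \<and> (\<forall>x\<in>\<Omega>. \<forall>y\<in>\<Omega>. dist x y \<le> D))"

lemma diam: "1 \<le> diam" "x \<in> \<Omega> \<Longrightarrow> y \<in> \<Omega> \<Longrightarrow> dist x y \<le> diam"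
proof -
  have "\<exists>D\<ge>1. \<forall>x\<in>\<Omega>. \<forall>y\<in>\<Omega>. dist x y \<le> D"
  proof (intro exI[of _ "max 1 (diameter \<Omega>)"] conjI ballI)
    fix x y assume "x \<in> \<Omega>" "y \<in> \<Omega>"
    then show "dist x y \<le> max 1 (diameter \<Omega>)" using diameter_bounded_bound[OF bd] by fastforce
  qed simp
  then have "1 \<le> diam \<and> (\<forall>x\<in>\<Omega>. \<forall>y\<in>\<Omega>. dist x y \<le> diam)"
    unfolding diam_def by (rule someI_ex)
  then show "1 \<le> diam" "x \<in> \<Omega> \<Longrightarrow> y \<in> \<Omega> \<Longrightarrow> dist x y \<le> diam" by auto
qed

text \<open>Distances up to 1 are below their power with exponent \<alpha> < 1; larger ones are
  below \<open>diam\<close>, and their power is at least 1. This turns Lipschitz bounds into Hoelder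
  bounds.\<close>

lemma dist_le_powr:
  assumes "x \<in> \<Omega>" "y \<in> \<Omega>" shows "dist x y \<le> diam * dist x y powr \<alpha>"
proof (cases "dist x y \<le> 1")
  case True
  show ?thesis
  proof (cases "x = y")
    case False
    then have "dist x y powr 1 \<le> dist x y powr \<alpha>"
      using True \<alpha> by (intro powr_mono') auto
    also have "\<dots> \<le> diam * dist x y powr \<alpha>"
      using mult_right_mono[OF diam(1), of "dist x y powr \<alpha>"] by simp
    finally show ?thesis using False by simp
  qed simp
next
  case False
  then have "1 \<le> dist x y powr \<alpha>" using \<alpha> by (intro ge_one_powr_ge_zero) auto
  then have "diam * 1 \<le> diam * dist x y powr \<alpha>" using diam(1) by (intro mult_left_mono) auto
  then show ?thesis using diam(2)[OF assms] by simp
qed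

text \<open>The factor of \<open>Ck_lipschitz\<close> times that of \<open>dist_le_powr\<close>, so
  that one constant serves all orders up to \<open>m\<close>.\<close>

definition K :: real where "K = CARD('n) * diam"

lemma K1: "K \<ge> 1"
proof -
  have "1 * 1 \<le> real CARD('n) * diam" using diam(1) by (intro mult_mono) (auto simp: Suc_leI)
  then show ?thesis by (simp add: K_def)
qed

text \<open>At top order this is the Hoelder quotient. Below it, the next derivatives are bounded,
  and such a bound gives a modulus along segments; hence the convex \<open>S\<close>.\<close>

lemma holder_modulus:
  assumes u: "u \<in> holder_space s \<Omega>" and N: "holder_norm s \<Omega> u \<le> N" and \<beta>: "length \<beta> \<le> m"
    and S: "convex S" "S \<subseteq> \<Omega>" "x \<in> S" "y \<in> S"
  shows "\<bar>dpart u \<beta> x - dpart u \<beta> y\<bar> \<le> K * N * dist x y powr \<alpha>"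
proof -
  have N0: "N \<ge> 0" using N holder_norm_nonneg[OF u] by simp
  have xy: "x \<in> \<Omega>" "y \<in> \<Omega>" using S by auto
  show ?thesis
  proof (cases "length \<beta> = m")
    case True
    have "\<bar>dpart u \<beta> x - dpart u \<beta> y\<bar> \<le> holder_norm s \<Omega> u * dist x y powr \<alpha>"
      by (rule hquot_le_holder_norm[OF u True xy])
    also have "\<dots> \<le> (K * N) * dist x y powr \<alpha>"
      using N N0 K1 mult_right_mono[OF K1 N0] by (intro mult_right_mono) auto
    finally show ?thesis .
  next
    case False
    then have l: "length \<beta> < m" using \<beta> by simp
    have "\<bar>dpart u \<beta> x - dpart u \<beta> y\<bar> \<le> CARD('n) * N * norm (x - y)"
    proof (rule Ck_lipschitz[OF op holder_space_Ck[OF u] l S])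
      fix i z assume "z \<in> S"
      then show "\<bar>dpart u (i # \<beta>) z\<bar> \<le> N"
        using dpart_le_holder_norm[OF u, of "i#\<beta>" z] l S N by (auto simp del: dpart.simps)
    qed
    also have "\<dots> \<le> CARD('n) * N * (diam * dist x y powr \<alpha>)"
      using dist_le_powr[OF xy] N0 by (intro mult_left_mono) (auto simp: dist_norm)
    finally show ?thesis by (simp add: K_def mult_ac)
  qed
qed

section \<open>Touching balls, outward normals and boundary flux\<close>

lemma frontier_nonempty: "frontier \<Omega> \<noteq> {}"
  using frontier_not_empty[OF ne] bd not_bounded_UNIV by blast

lemma frontier_disjoint: "x \<in> frontier \<Omega> \<Longrightarrow> x \<notin> \<Omega>"
  using op by (simp add: frontier_def interior_open)

lemma closure_cases: "x \<in> closure \<Omega> \<Longrightarrow> x \<notin> \<Omega> \<Longrightarrow> x \<in> frontier \<Omega>"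
  using op by (simp add: frontier_def interior_open)

lemma frontier_in_closure: "x \<in> frontier \<Omega> \<Longrightarrow> x \<in> closure \<Omega>"
  by (simp add: frontier_def)

text \<open>A ball around \<open>y\<close> that leaves \<Omega> is connected and so meets the
  frontier, which minimality of the distance forbids. The resulting ball touches the boundary from
  inside and is the convex set on which \<open>holder_modulus\<close> is used.\<close>

lemma nearest_frontier_point:
  assumes y: "y \<in> \<Omega>"
  obtains x where "x \<in> frontier \<Omega>" "dist y x = infdist y (frontier \<Omega>)" "dist y x > 0" "ball y (dist y x) \<subseteq> \<Omega>"
proof -
  obtain x where x: "x \<in> frontier \<Omega>" "infdist y (frontier \<Omega>) = dist y x"
    using infdist_attains_inf[OF frontier_closed frontier_nonempty, of y] by metis
  have pos: "dist y x > 0" using frontier_disjoint[OF x(1)] y by auto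
  have "ball y (dist y x) \<subseteq> \<Omega>"
  proof (rule ccontr)
    assume "\<not> ball y (dist y x) \<subseteq> \<Omega>"
    then have "ball y (dist y x) - \<Omega> \<noteq> {}" by blast
    moreover have "ball y (dist y x) \<inter> \<Omega> \<noteq> {}" using y pos by (metis IntI centre_in_ball empty_iff)
    ultimately have "ball y (dist y x) \<inter> frontier \<Omega> \<noteq> {}"
      using connected_Int_frontier[OF connected_ball] by metis
    then obtain z where "z \<in> frontier \<Omega>" "dist y z < dist y x" by auto
    then show False using infdist_le[of z "frontier \<Omega>" y] x by simp
  qed
  then show ?thesis using that x pos by auto
qed

text \<open>Every direction \<open>e\<close> with \<open>e \<bullet> \<nu> < 0\<close> leads from
  \<open>x\<close> into the touching ball, where \<open>\<rho>\<close> is negative, while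
  \<open>\<rho> x\<close> is not. So the gradient has non-positive product with a whole half space
  and must be a non-negative multiple of \<open>\<nu>\<close>.\<close>

lemma local_defining_normal:
  assumes x: "x \<in> frontier \<Omega>" and loc: "local_defining \<Omega> x r \<rho>"
    and ball: "ball y (dist y x) \<subseteq> \<Omega>" and d: "dist y x > 0"
  shows "grad \<rho> x = norm (grad \<rho> x) *\<^sub>R ((x - y) /\<^sub>R dist y x)"
proof -
  define g where "g = grad \<rho> x"
  define \<nu> where "\<nu> = (x - y) /\<^sub>R dist y x"
  have r: "r > 0" and \<rho>neg: "\<And>z. z \<in> ball x r \<Longrightarrow> z \<in> \<Omega> \<longleftrightarrow> \<rho> z < 0" and Ck: "Ck 1 (ball x r) \<rho>"
    using loc unfolding local_defining_def smooth_on_def by auto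
  have n\<nu>: "norm \<nu> = 1" using d by (simp add: \<nu>_def dist_norm norm_minus_commute)
  have der: "(\<rho> has_derivative (\<lambda>v. g \<bullet> v)) (at x)"
  proof -
    have "(dpart \<rho> [] has_derivative (\<lambda>v. \<Sum>i\<in>UNIV. dpart \<rho> [i] x * v $ i)) (at x)"
      using Ck_has_derivative[OF _ Ck, of "[]" x] r by auto
    then show ?thesis by (simp add: g_def grad_def inner_vec_def)
  qed
  have line: "((\<lambda>t. \<rho> (x + t *\<^sub>R e)) has_real_derivative g \<bullet> e) (at 0)" for e
  proof -
    have "((\<lambda>t. \<rho> (x + t *\<^sub>R e)) has_derivative (\<lambda>t. g \<bullet> (t *\<^sub>R e))) (at 0)"
      by (rule has_derivative_compose[of "\<lambda>t. x + t *\<^sub>R e", where g = \<rho>])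
        (auto intro!: derivative_eq_intros der)
    then show ?thesis by (simp add: has_field_derivative_def mult.commute[of _ "g \<bullet> e"])
  qed
  have \<rho>x: "\<rho> x \<ge> 0" using \<rho>neg[of x] frontier_disjoint[OF x] r by auto
  have neg: "g \<bullet> e \<le> 0" if e: "e \<bullet> \<nu> < 0" for e
  proof (rule ccontr)
    assume "\<not> g \<bullet> e \<le> 0"
    then obtain d1 where d1: "d1 > 0" "\<And>h. 0 < h \<Longrightarrow> h < d1 \<Longrightarrow> \<rho> x < \<rho> (x + h *\<^sub>R e)"
      using DERIV_pos_inc_right[OF line[of e]] by auto
    have ne0: "norm e > 0" using e by auto
    \<comment> \<open>The three bounds keep the step in the range where \<open>\<rho>\<close>
      increases, inside the ball where \<open>\<rho>\<close> describes \<Omega>, and inside the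
      touching ball.\<close>
    define h where "h = min (d1 / 2) (min (r / (2 * norm e)) (- dist y x * (e \<bullet> \<nu>) / (norm e)\<^sup>2))"
    have h0: "h > 0" unfolding h_def using d1 r ne0 d e by (simp add: divide_neg_pos mult_pos_neg)
    have h1: "h < d1" unfolding h_def using d1 by linarith
    have "h \<le> r / (2 * norm e)" unfolding h_def by linarith
    then have "h * norm e \<le> r / 2" using ne0 by (simp add: field_simps)
    then have inb: "x + h *\<^sub>R e \<in> ball x r" using h0 r by (simp add: dist_norm)
    have "h \<le> - dist y x * (e \<bullet> \<nu>) / (norm e)\<^sup>2" unfolding h_def by linarith
    then have h2: "h * (norm e)\<^sup>2 \<le> - dist y x * (e \<bullet> \<nu>)" using ne0 by (simp add: field_simps)
    have "x - y = dist y x *\<^sub>R \<nu>" using d by (simp add: \<nu>_def)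
    then have xe: "x + h *\<^sub>R e - y = dist y x *\<^sub>R \<nu> + h *\<^sub>R e" by simp
    have "(norm (x + h *\<^sub>R e - y))\<^sup>2 = (dist y x)\<^sup>2 * (norm \<nu>)\<^sup>2 + 2 * h * dist y x * (e \<bullet> \<nu>) + h\<^sup>2 * (norm e)\<^sup>2"
      unfolding xe power2_norm_eq_inner by (simp add: inner_add_left inner_add_right inner_commute power2_eq_square algebra_simps)
    also have "\<dots> = (dist y x)\<^sup>2 + h * (2 * dist y x * (e \<bullet> \<nu>) + h * (norm e)\<^sup>2)"
      by (simp add: n\<nu> power2_eq_square algebra_simps)
    also have "\<dots> < (dist y x)\<^sup>2"
    proof -
      have "dist y x * (e \<bullet> \<nu>) < 0" using d e by (rule mult_pos_neg)
      then have "2 * dist y x * (e \<bullet> \<nu>) + h * (norm e)\<^sup>2 < 0" using h2 by simp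
      then show ?thesis using h0 by (simp add: mult_pos_neg)
    qed
    finally have "norm (x + h *\<^sub>R e - y) < dist y x" using d by (simp add: power2_less_imp_less)
    then have "x + h *\<^sub>R e \<in> \<Omega>" using ball by (auto simp: dist_norm norm_minus_commute)
    then have "\<rho> (x + h *\<^sub>R e) < 0" using \<rho>neg[OF inb] by simp
    then show False using d1(2)[OF h0 h1] \<rho>x by simp
  qed
  \<comment> \<open>The bounding hyperplane of the half space is reached by perturbing
    \<open>e\<close> with \<open>- t *\<^sub>R \<nu>\<close> and letting \<open>t\<close> tend to
    0.\<close>
  have negc: "g \<bullet> e \<le> 0" if e: "e \<bullet> \<nu> \<le> 0" for e
  proof -
    have "((\<lambda>t. g \<bullet> (e - t *\<^sub>R \<nu>)) \<longlongrightarrow> g \<bullet> (e - 0 *\<^sub>R \<nu>)) (at_right 0)"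
      by (intro tendsto_intros)
    moreover have "\<forall>\<^sub>F t in at_right (0::real). g \<bullet> (e - t *\<^sub>R \<nu>) \<le> 0"
      unfolding eventually_at_right_field
    proof (intro exI[of _ 1] conjI allI impI)
      fix t :: real assume "0 < t" "t < 1"
      then show "g \<bullet> (e - t *\<^sub>R \<nu>) \<le> 0"
        using e n\<nu> by (intro neg) (simp add: inner_diff_left power2_norm_eq_inner[symmetric])
    qed simp
    ultimately have "g \<bullet> (e - 0 *\<^sub>R \<nu>) \<le> 0" by (intro tendsto_upperbound) auto
    then show ?thesis by simp
  qed
  \<comment> \<open>The tangential part of the gradient; \<open>negc\<close> applied to it yields
    \<open>e \<bullet> e \<le> 0\<close>.\<close>
  define e where "e = g - (g \<bullet> \<nu>) *\<^sub>R \<nu>"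
  have e\<nu>: "e \<bullet> \<nu> = 0" using n\<nu> by (simp add: e_def inner_diff_left power2_norm_eq_inner[symmetric])
  have "e \<bullet> e = g \<bullet> e - (g \<bullet> \<nu>) * (e \<bullet> \<nu>)" by (simp add: e_def inner_diff_left inner_commute)
  then have "e \<bullet> e \<le> 0" using negc[of e] e\<nu> by simp
  then have "e = 0" using inner_ge_zero[of e] by (metis antisym inner_eq_zero_iff)
  then have g: "g = (g \<bullet> \<nu>) *\<^sub>R \<nu>" by (simp add: e_def)
  have "g \<bullet> (- \<nu>) \<le> 0" using n\<nu> by (intro negc) simp
  then have "norm ((g \<bullet> \<nu>) *\<^sub>R \<nu>) = g \<bullet> \<nu>" using n\<nu> by simp
  then have "norm g = g \<bullet> \<nu>" using g by simp
  then show ?thesis using g by (simp add: g_def \<nu>_def)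
qed

text \<open>The choice in \<open>outward_normal\<close> does no harm: by
  \<open>local_defining_normal\<close> the normalised gradient of any defining function is the
  direction from the centre of the touching ball.\<close>

lemma outward_normal_eq:
  assumes sb: "smooth_boundary \<Omega>" and x: "x \<in> frontier \<Omega>"
    and ball: "ball y (dist y x) \<subseteq> \<Omega>" and d: "dist y x > 0"
  shows "outward_normal \<Omega> x = (x - y) /\<^sub>R dist y x"
proof -
  have "\<exists>v r \<rho>. local_defining \<Omega> x r \<rho> \<and> v = grad \<rho> x /\<^sub>R norm (grad \<rho> x)"
    using sb x unfolding smooth_boundary_def by blast
  then have "\<exists>r \<rho>. local_defining \<Omega> x r \<rho> \<and> outward_normal \<Omega> x = grad \<rho> x /\<^sub>R norm (grad \<rho> x)"
    unfolding outward_normal_def by (rule someI_ex)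
  then obtain r \<rho> where loc: "local_defining \<Omega> x r \<rho>" and o: "outward_normal \<Omega> x = grad \<rho> x /\<^sub>R norm (grad \<rho> x)"
    by blast
  have "grad \<rho> x \<noteq> 0" using loc by (simp add: local_defining_def)
  then show ?thesis
    using local_defining_normal[OF x loc ball d] unfolding o
    by (metis (no_types, lifting) divideR_right norm_eq_zero)
qed

text \<open>Along the normal segment the derivative of \<open>u\<close> is Hoelder continuous with a constant
  depending only on the Hoelder norm, so it has a limit at the boundary, attained at a uniform rate.\<close>
lemma normal_derivative_limit:
  assumes sb: "smooth_boundary \<Omega>" and x: "x \<in> frontier \<Omega>"
    and ball: "ball y (dist y x) \<subseteq> \<Omega>" and d: "dist y x > 0"
    and u: "u \<in> holder_space s \<Omega>" and N: "holder_norm s \<Omega> u \<le> N"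
  shows "\<bar>(\<Sum>i\<in>UNIV. outward_normal \<Omega> x $ i * dpart u [i] y) - normal_deriv \<Omega> u x\<bar>
    \<le> CARD('n) * (K * N) * dist y x powr \<alpha>"
proof -
  define d where "d = dist y x"
  define \<nu> where "\<nu> = outward_normal \<Omega> x"
  have d0: "d > 0" using d by (simp add: d_def)
  have \<nu>: "\<nu> = (x - y) /\<^sub>R d" unfolding \<nu>_def d_def by (rule outward_normal_eq[OF sb x ball d])
  have n\<nu>: "norm \<nu> = 1" using d0 by (simp add: \<nu> d_def dist_norm norm_minus_commute)
  have N0: "N \<ge> 0" using N holder_norm_nonneg[OF u] by simp
  \<comment> \<open>The derivative of \<open>u\<close> in direction \<open>\<nu>\<close> along the
    normal segment, \<open>t\<close> being the distance to \<open>x\<close>.\<close>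
  define p where "p t = (\<Sum>i\<in>UNIV. \<nu> $ i * dpart u [i] (x - t *\<^sub>R \<nu>))" for t
  define C where "C = CARD('n) * (K * N)"
  have C0: "C \<ge> 0" using K1 N0 by (simp add: C_def)
  have xy: "x - d *\<^sub>R \<nu> = y" using d0 by (simp add: \<nu>)
  have seg: "x - t *\<^sub>R \<nu> \<in> ball y d" if "0 < t" "t \<le> d" for t
  proof -
    have "y - (x - t *\<^sub>R \<nu>) = (t - d) *\<^sub>R \<nu>" using xy by (simp add: algebra_simps)
    then show ?thesis using that n\<nu> by (simp add: dist_norm)
  qed
  have bO: "ball y d \<subseteq> \<Omega>" using ball by (simp add: d_def)
  have Ck: "Ck m \<Omega> u" by (rule holder_space_Ck[OF u])
  have hp: "\<bar>p t - p t'\<bar> \<le> C * \<bar>t - t'\<bar> powr \<alpha>" if "t \<in> {0<..d}" "t' \<in> {0<..d}" for t t'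
  proof -
    have "\<bar>p t - p t'\<bar> = \<bar>\<Sum>i\<in>UNIV. \<nu> $ i * (dpart u [i] (x - t *\<^sub>R \<nu>) - dpart u [i] (x - t' *\<^sub>R \<nu>))\<bar>"
      by (simp add: p_def sum_subtractf right_diff_distrib)
    also have "\<dots> \<le> (\<Sum>i\<in>(UNIV::'n set). K * N * \<bar>t - t'\<bar> powr \<alpha>)"
    proof (rule order_trans[OF sum_abs sum_mono])
      fix i
      have "dist (x - t *\<^sub>R \<nu>) (x - t' *\<^sub>R \<nu>) = norm ((t - t') *\<^sub>R \<nu>)"
        by (simp add: dist_norm norm_minus_commute algebra_simps)
      then have di: "dist (x - t *\<^sub>R \<nu>) (x - t' *\<^sub>R \<nu>) = \<bar>t - t'\<bar>" using n\<nu> by simp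
      have "\<bar>dpart u [i] (x - t *\<^sub>R \<nu>) - dpart u [i] (x - t' *\<^sub>R \<nu>)\<bar> \<le> K * N * \<bar>t - t'\<bar> powr \<alpha>"
        using holder_modulus[OF u N _ convex_ball bO seg seg, of "[i]" t t'] m1 that di by auto
      moreover have "\<bar>\<nu> $ i\<bar> \<le> 1" using component_le_norm_cart[of \<nu> i] n\<nu> by simp
      ultimately have "\<bar>\<nu> $ i\<bar> * \<bar>dpart u [i] (x - t *\<^sub>R \<nu>) - dpart u [i] (x - t' *\<^sub>R \<nu>)\<bar> \<le> 1 * (K * N * \<bar>t - t'\<bar> powr \<alpha>)"
        by (intro mult_mono) auto
      then show "\<bar>\<nu> $ i * (dpart u [i] (x - t *\<^sub>R \<nu>) - dpart u [i] (x - t' *\<^sub>R \<nu>))\<bar> \<le> K * N * \<bar>t - t'\<bar> powr \<alpha>"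
        by (simp add: abs_mult)
    qed
    also have "\<dots> = C * \<bar>t - t'\<bar> powr \<alpha>" by (simp add: C_def)
    finally show ?thesis .
  qed
  \<comment> \<open>The Hoelder modulus extends \<open>p\<close> continuously to 0; the value
    \<open>g 0\<close> there will turn out to be the normal derivative.\<close>
  have "uniformly_continuous_on {0<..d} p"
    unfolding uniformly_continuous_on_def
  proof (intro allI impI)
    fix e :: real assume e: "e > 0"
    define \<delta> where "\<delta> = (e / (C + 1)) powr (1 / \<alpha>)"
    have \<delta>0: "\<delta> > 0" using e C0 by (simp add: \<delta>_def)
    show "\<exists>\<delta>>0. \<forall>t\<in>{0<..d}. \<forall>t'\<in>{0<..d}. dist t' t < \<delta> \<longrightarrow> dist (p t') (p t) < e"
    proof (intro exI[of _ \<delta>] conjI \<delta>0 ballI impI)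
      fix t t' assume t: "t \<in> {0<..d}" "t' \<in> {0<..d}" "dist t' t < \<delta>"
      have "\<bar>t' - t\<bar> powr \<alpha> \<le> \<delta> powr \<alpha>" using t \<alpha> by (intro powr_mono2) (auto simp: dist_real_def)
      also have "\<dots> = e / (C + 1)" using e C0 \<alpha> by (simp add: \<delta>_def powr_powr)
      finally have "C * \<bar>t' - t\<bar> powr \<alpha> \<le> C * (e / (C + 1))" using C0 by (intro mult_left_mono) auto
      also have "\<dots> < e" using e C0 by (simp add: field_simps)
      finally show "dist (p t') (p t) < e" using hp[OF t(2,1)] by (simp add: dist_real_def)
    qed
  qed
  then obtain g where g: "uniformly_continuous_on (closure {0<..d}) g" "\<And>t. t \<in> {0<..d} \<Longrightarrow> p t = g t"
    using uniformly_continuous_on_extension_on_closure by metis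
  have cl: "closure {0<..d} = {0..d}" using d0 by simp
  have "continuous_on {0..d} g" using g(1) cl uniformly_continuous_imp_continuous by metis
  then have "(g \<longlongrightarrow> g 0) (at 0 within {0..d})" using d0 by (auto simp: continuous_on_def)
  then have glim: "(g \<longlongrightarrow> g 0) (at_right 0)" using d0 by (simp add: at_within_Icc_at_right)
  have ev: "\<forall>\<^sub>F t in at_right 0. t \<in> {0<..d}"
    using d0 unfolding eventually_at_right_field by (intro exI[of _ d]) auto
  have plim: "(p \<longlongrightarrow> g 0) (at_right 0)"
    by (rule Lim_transform_eventually[OF glim]) (use ev in \<open>eventually_elim, simp add: g(2)\<close>)
  have rate: "\<bar>p d - g 0\<bar> \<le> C * d powr \<alpha>"
  proof (rule tendsto_upperbound)
    show "((\<lambda>t. \<bar>p d - p t\<bar>) \<longlongrightarrow> \<bar>p d - g 0\<bar>) (at_right 0)" by (intro tendsto_intros plim)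
    show "\<forall>\<^sub>F t in at_right 0. \<bar>p d - p t\<bar> \<le> C * d powr \<alpha>"
      using ev
    proof eventually_elim
      case (elim t)
      have "\<bar>p d - p t\<bar> \<le> C * \<bar>d - t\<bar> powr \<alpha>" using elim d0 by (intro hp) auto
      also have "\<dots> \<le> C * d powr \<alpha>" using elim \<alpha> C0 by (intro mult_left_mono powr_mono2) auto
      finally show ?case .
    qed
  qed simp
  \<comment> \<open>The difference quotient that defines \<open>normal_deriv\<close> is a value of
    \<open>p\<close> between 0 and \<open>t\<close>, so both have the same limit. At
    \<open>x\<close> itself continuity of \<open>u\<close> is all that the mean value theorem
    uses.\<close>
  have quot: "\<exists>z. 0 < z \<and> z < t \<and> (u x - u (x - t *\<^sub>R \<nu>)) / t = p z" if t: "t \<in> {0<..d}" for t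
  proof -
    let ?f = "\<lambda>t. u (x - t *\<^sub>R \<nu>)"
    have inc: "x - z *\<^sub>R \<nu> \<in> closure \<Omega>" if "0 \<le> z" "z \<le> d" for z
      using seg[of z] that bO closure_subset[of \<Omega>] frontier_in_closure[OF x] by (cases "z = 0") auto
    have "continuous_on {0..t} ?f"
    proof (rule continuous_on_compose2[where g = u and t = "closure \<Omega>" and f = "\<lambda>t. x - t *\<^sub>R \<nu>"])
      show "continuous_on (closure \<Omega>) u" using u by (simp add: holder_space_def)
      show "continuous_on {0..t} (\<lambda>t. x - t *\<^sub>R \<nu>)" by (intro continuous_intros)
      show "(\<lambda>t. x - t *\<^sub>R \<nu>) ` {0..t} \<subseteq> closure \<Omega>" using inc t by auto
    qed
    moreover have "(?f has_real_derivative - p z) (at z)" if z: "0 < z" "z < t" for z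
    proof -
      have zO: "x - z *\<^sub>R \<nu> \<in> \<Omega>" using seg[of z] z t bO by auto
      have D: "(dpart u [] has_derivative (\<lambda>v. \<Sum>i\<in>UNIV. dpart u [i] (x - z *\<^sub>R \<nu>) * v $ i)) (at (x - z *\<^sub>R \<nu>))"
        using Ck_has_derivative[OF op Ck _ zO, of "[]"] m1 by auto
      have "(?f has_derivative (\<lambda>h. \<Sum>i\<in>UNIV. dpart u [i] (x - z *\<^sub>R \<nu>) * (- (h *\<^sub>R \<nu>)) $ i)) (at z)"
        by (rule has_derivative_compose[of "\<lambda>t. x - t *\<^sub>R \<nu>", where g = u])
          (use D in \<open>auto intro!: derivative_eq_intros\<close>)
      moreover have "(\<lambda>h. \<Sum>i\<in>UNIV. dpart u [i] (x - z *\<^sub>R \<nu>) * (- (h *\<^sub>R \<nu>)) $ i) = (*) (- p z)"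
        by (rule ext) (simp add: p_def sum_distrib_left sum_negf mult_ac)
      ultimately show ?thesis by (simp add: has_field_derivative_def)
    qed
    ultimately obtain l z where z: "0 < z" "z < t" "DERIV ?f z :> l" "?f t - ?f 0 = (t - 0) * l"
      using MVT[of 0 t ?f] t by (auto simp: real_differentiable_def)
    have "l = - p z" using DERIV_unique[OF z(3)] \<open>\<And>z. 0 < z \<Longrightarrow> z < t \<Longrightarrow> (?f has_real_derivative - p z) (at z)\<close> z by blast
    then have "(u x - u (x - t *\<^sub>R \<nu>)) / t = p z" using z t by (simp add: field_simps)
    then show ?thesis using z by blast
  qed
  have "((\<lambda>t. (u x - u (x - t *\<^sub>R \<nu>)) / t) \<longlongrightarrow> g 0) (at_right 0)"
  proof (rule tendstoI)
    fix e :: real assume "e > 0"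
    then have "\<forall>\<^sub>F t in at_right 0. dist (p t) (g 0) < e" by (rule tendstoD[OF plim])
    then obtain b where b: "b > 0" "\<And>z. 0 < z \<Longrightarrow> z < b \<Longrightarrow> dist (p z) (g 0) < e"
      unfolding eventually_at_right_field by auto
    show "\<forall>\<^sub>F t in at_right 0. dist ((u x - u (x - t *\<^sub>R \<nu>)) / t) (g 0) < e"
      unfolding eventually_at_right_field
    proof (intro exI[of _ "min b d"] conjI allI impI)
      fix t assume "0 < t" "t < min b d"
      then obtain z where "0 < z" "z < t" "(u x - u (x - t *\<^sub>R \<nu>)) / t = p z" using quot[of t] by auto
      then show "dist ((u x - u (x - t *\<^sub>R \<nu>)) / t) (g 0) < e" using b(2)[of z] \<open>t < min b d\<close> by simp
    qed (use b d0 in auto)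
  qed
  then have "normal_deriv \<Omega> u x = g 0"
    unfolding normal_deriv_def \<nu>_def[symmetric] by (intro tendsto_Lim) auto
  then show ?thesis using rate by (simp add: p_def xy C_def d_def[symmetric] \<nu>_def[symmetric])
qed

text \<open>The difference of gradients at \<open>y\<close> is compared with the nearest boundary
  point \<open>x\<close>. There the gradient of \<open>\<rho>\<close> is normal and the normal
  derivatives agree, so the normal part is of order \<open>dist y x powr \<alpha>\<close>; the
  change of the gradient of \<open>\<rho>\<close> between \<open>x\<close> and \<open>y\<close> is
  controlled by uniform continuity.\<close>

lemma flux_decay:
  assumes sb: "smooth_boundary \<Omega>"
    and u1: "u1 \<in> holder_space s \<Omega>" and u2: "u2 \<in> holder_space s \<Omega>"
    and eq: "\<And>x. x \<in> frontier \<Omega> \<Longrightarrow> normal_deriv \<Omega> u1 x = normal_deriv \<Omega> u2 x"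
    and x0: "x0 \<in> frontier \<Omega>" and loc: "local_defining \<Omega> x0 r \<rho>" and r': "r' < r" and e: "e > 0"
  shows "\<exists>\<delta>>0. \<forall>y\<in>\<Omega> \<inter> cball x0 r'. infdist y (frontier \<Omega>) < \<delta> \<longrightarrow>
     \<bar>\<Sum>i\<in>UNIV. (dpart u1 [i] y - dpart u2 [i] y) * dpart \<rho> [i] y\<bar> \<le> e"
proof -
  define N where "N = max 1 (max (holder_norm s \<Omega> u1) (holder_norm s \<Omega> u2))"
  have N: "holder_norm s \<Omega> u1 \<le> N" "holder_norm s \<Omega> u2 \<le> N" "N \<ge> 1" by (auto simp: N_def)
  define P where "P i x = dpart \<rho> [i] x" for i x
  have Ck: "Ck 1 (ball x0 r) \<rho>" using loc unfolding local_defining_def smooth_on_def by auto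
  \<comment> \<open>The nearest boundary point of a \<open>y\<close> in the ball of radius
    \<open>r'\<close> may lie outside that ball; \<open>r1\<close> leaves room for it within
    \<open>r\<close>.\<close>
  define r1 where "r1 = (r' + r) / 2"
  have r1: "r' < r1" "r1 < r" using r' by (auto simp: r1_def)
  have sub: "cball x0 r1 \<subseteq> ball x0 r" using r1 by auto
  have cP: "continuous_on (cball x0 r1) (P i)" for i
    using Ck_continuous[OF Ck, of "[i]"] continuous_on_subset[OF _ sub] unfolding P_def[abs_def] by simp
  have "\<forall>i. \<exists>M. \<forall>x\<in>cball x0 r1. \<bar>P i x\<bar> \<le> M"
    using compact_imp_bounded[OF compact_continuous_image[OF cP compact_cball]]
    unfolding bounded_iff by auto
  then obtain M0 where M0: "\<And>i x. x \<in> cball x0 r1 \<Longrightarrow> \<bar>P i x\<bar> \<le> M0 i" by metis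
  define n where "n = real CARD('n)"
  have n1: "n \<ge> 1" by (simp add: n_def Suc_leI)
  define G where "G = 1 + (\<Sum>i\<in>UNIV. \<bar>M0 i\<bar>)"
  have G: "norm (grad \<rho> x) \<le> G" if "x \<in> cball x0 r1" for x
  proof -
    have "norm (grad \<rho> x) \<le> (\<Sum>i\<in>UNIV. \<bar>grad \<rho> x $ i\<bar>)" by (rule norm_le_l1_cart)
    also have "\<dots> \<le> (\<Sum>i\<in>UNIV. \<bar>M0 i\<bar>)"
      using M0[OF that] by (intro sum_mono) (auto simp: grad_def P_def intro: order_trans[OF _ abs_ge_self])
    finally show ?thesis by (simp add: G_def)
  qed
  have G1: "G \<ge> 1" unfolding G_def by (simp add: sum_nonneg)
  \<comment> \<open>There are \<open>n\<close> coordinates, each a component of size at most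
    \<open>2 * N\<close> times a change of at most \<open>e1\<close>; they add up to
    \<open>e / 2\<close>, and the normal part takes the other half.\<close>
  define e1 where "e1 = e / (4 * n * N)"
  have e1: "e1 > 0" using e n1 N by (simp add: e1_def)
  have "\<forall>i. \<exists>d>0. \<forall>x\<in>cball x0 r1. \<forall>x'\<in>cball x0 r1. dist x' x < d \<longrightarrow> dist (P i x') (P i x) < e1"
    using compact_uniformly_continuous[OF cP compact_cball] e1 unfolding uniformly_continuous_on_def by blast
  then obtain d where d: "\<And>i. d i > 0"
    "\<And>i x x'. x \<in> cball x0 r1 \<Longrightarrow> x' \<in> cball x0 r1 \<Longrightarrow> dist x' x < d i \<Longrightarrow> dist (P i x') (P i x) < e1"
    by metis
  define H where "H = 2 * n * (K * N)"
  have H: "H > 0" using n1 K1 N by (simp add: H_def)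
  \<comment> \<open>The bounds serve, in this order, the uniform continuity of the
    \<open>P i\<close>, the position of the nearest boundary point, and the size
    \<open>e / (2 * G)\<close> of the normal part.\<close>
  define \<delta> where "\<delta> = min (Min (range d)) (min (r1 - r') ((e / (2 * G * H)) powr (1 / \<alpha>)))"
  have \<delta>0: "\<delta> > 0" unfolding \<delta>_def using d(1) r1 e H G1 by (simp add: Min_gr_iff)
  have \<delta>d: "\<delta> \<le> d i" for i
  proof -
    have "Min (range d) \<le> d i" by (intro Min_le) auto
    then show ?thesis unfolding \<delta>_def by linarith
  qed
  show ?thesis
  proof (intro exI[of _ \<delta>] conjI \<delta>0 ballI impI)
    fix y assume y: "y \<in> \<Omega> \<inter> cball x0 r'" and dy: "infdist y (frontier \<Omega>) < \<delta>"
    obtain x where x: "x \<in> frontier \<Omega>" "dist y x = infdist y (frontier \<Omega>)" "dist y x > 0" "ball y (dist y x) \<subseteq> \<Omega>"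
      using nearest_frontier_point y by blast
    have dxy: "dist y x < \<delta>" using x dy by simp
    have yc: "y \<in> cball x0 r1" using y r1 by auto
    have "dist y x < r1 - r'" using dxy unfolding \<delta>_def by linarith
    moreover have "dist x0 x \<le> dist x0 y + dist y x" by (rule dist_triangle)
    ultimately have xc: "x \<in> cball x0 r1" using y by auto
    \<comment> \<open>The same \<open>\<rho>\<close> on a smaller ball, because
      \<open>local_defining_normal\<close> takes a ball centred at the touching point.\<close>
    have locx: "local_defining \<Omega> x (r - dist x0 x) \<rho>"
    proof -
      have bs: "ball x (r - dist x0 x) \<subseteq> ball x0 r"
      proof
        fix z assume "z \<in> ball x (r - dist x0 x)"
        then show "z \<in> ball x0 r" using dist_triangle[of x0 z x] by simp
      qed
      moreover have "r - dist x0 x > 0" using xc r1 by auto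
      moreover have "\<Omega> \<inter> ball x (r - dist x0 x) = {y \<in> ball x (r - dist x0 x). \<rho> y < 0}"
        using loc bs unfolding local_defining_def by blast
      ultimately show ?thesis
        using loc unfolding local_defining_def smooth_on_def by (auto intro: Ck_subset)
    qed
    define \<nu> where "\<nu> = outward_normal \<Omega> x"
    have \<nu>: "\<nu> = (x - y) /\<^sub>R dist y x" unfolding \<nu>_def by (rule outward_normal_eq[OF sb x(1,4,3)])
    have gr: "grad \<rho> x = norm (grad \<rho> x) *\<^sub>R \<nu>"
      unfolding \<nu> by (rule local_defining_normal[OF x(1) locx x(4,3)])
    define V where "V i = dpart u1 [i] y - dpart u2 [i] y" for i
    have VB: "\<bar>V i\<bar> \<le> 2 * N" for i
      using dpart_le_holder_norm[OF u1, of "[i]" y] dpart_le_holder_norm[OF u2, of "[i]" y] m1 y N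
      unfolding V_def by (auto simp del: dpart.simps)
    have "\<bar>\<Sum>i\<in>UNIV. \<nu> $ i * V i\<bar> \<le> H * dist y x powr \<alpha>"
    proof -
      have "(\<Sum>i\<in>UNIV. \<nu> $ i * V i) = ((\<Sum>i\<in>UNIV. \<nu> $ i * dpart u1 [i] y) - normal_deriv \<Omega> u1 x)
          - ((\<Sum>i\<in>UNIV. \<nu> $ i * dpart u2 [i] y) - normal_deriv \<Omega> u2 x)"
        using eq[OF x(1)] by (simp add: V_def sum_subtractf right_diff_distrib)
      then have "\<bar>\<Sum>i\<in>UNIV. \<nu> $ i * V i\<bar> \<le> n * (K * N) * dist y x powr \<alpha> + n * (K * N) * dist y x powr \<alpha>"
        using normal_derivative_limit[OF sb x(1,4,3) u1 N(1)] normal_derivative_limit[OF sb x(1,4,3) u2 N(2)]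
        unfolding \<nu>_def n_def by linarith
      then show ?thesis by (simp add: H_def algebra_simps)
    qed
    also have "H * dist y x powr \<alpha> \<le> H * (((e / (2 * G * H)) powr (1 / \<alpha>)) powr \<alpha>)"
    proof -
      have "dist y x \<le> (e / (2 * G * H)) powr (1 / \<alpha>)" using dxy unfolding \<delta>_def by linarith
      then show ?thesis using H \<alpha> by (intro mult_left_mono powr_mono2) auto
    qed
    also have "\<dots> = e / (2 * G)" using H G1 e \<alpha> by (simp add: powr_powr)
    finally have nor: "\<bar>\<Sum>i\<in>UNIV. \<nu> $ i * V i\<bar> \<le> e / (2 * G)" .
    have Px: "P i x = norm (grad \<rho> x) * \<nu> $ i" for i
      using arg_cong[OF gr, of "\<lambda>v. v $ i"] by (simp add: grad_def P_def)
    have "(\<Sum>i\<in>UNIV. V i * P i y) = norm (grad \<rho> x) * (\<Sum>i\<in>UNIV. \<nu> $ i * V i) + (\<Sum>i\<in>UNIV. V i * (P i y - P i x))"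
      by (simp add: Px sum_distrib_left sum.distrib[symmetric] algebra_simps)
    moreover have "\<bar>norm (grad \<rho> x) * (\<Sum>i\<in>UNIV. \<nu> $ i * V i)\<bar> \<le> G * (e / (2 * G))"
      unfolding abs_mult using G[OF xc] nor G1 by (intro mult_mono) auto
    moreover have "\<bar>\<Sum>i\<in>UNIV. V i * (P i y - P i x)\<bar> \<le> (\<Sum>i\<in>(UNIV::'n set). (2 * N) * e1)"
    proof (rule order_trans[OF sum_abs sum_mono])
      fix i
      have "\<bar>P i y - P i x\<bar> \<le> e1"
        using d(2)[OF xc yc, of i] dxy \<delta>d[of i] by (simp add: dist_real_def)
      then show "\<bar>V i * (P i y - P i x)\<bar> \<le> 2 * N * e1"
        unfolding abs_mult using VB[of i] N by (intro mult_mono) auto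
    qed
    moreover have "G * (e / (2 * G)) = e / 2" using G1 by simp
    moreover have "(\<Sum>i\<in>(UNIV::'n set). (2 * N) * e1) = e / 2"
      using n1 N by (simp add: e1_def n_def)
    ultimately have "\<bar>\<Sum>i\<in>UNIV. V i * P i y\<bar> \<le> e" by linarith
    then show "\<bar>\<Sum>i\<in>UNIV. (dpart u1 [i] y - dpart u2 [i] y) * dpart \<rho> [i] y\<bar> \<le> e"
      by (simp only: V_def P_def)
  qed
qed

text \<open>The field is the difference of the two gradients: its components are bounded by the
  Hoelder norms, its divergence by \<open>B\<close>, and its flux decays because the normal
  derivatives agree.\<close>

theorem laplacian_integral_eq_0:
  assumes sb: "smooth_boundary \<Omega>"
    and u1: "u1 \<in> holder_space s \<Omega>" "Ck 2 \<Omega> u1" and u2: "u2 \<in> holder_space s \<Omega>" "Ck 2 \<Omega> u2"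
    and eq: "\<And>x. x \<in> frontier \<Omega> \<Longrightarrow> normal_deriv \<Omega> u1 x = normal_deriv \<Omega> u2 x"
    and B: "\<And>x. x \<in> \<Omega> \<Longrightarrow> \<bar>laplacian u1 x - laplacian u2 x\<bar> \<le> B"
  shows "(LINT x:\<Omega>|lborel. laplacian u1 x - laplacian u2 x) = 0"
proof -
  define V where "V i x = dpart u1 [i] x - dpart u2 [i] x" for i x
  define D where "D i x = dpart u1 [i, i] x - dpart u2 [i, i] x" for i x
  define B' where "B' = max B (holder_norm s \<Omega> u1 + holder_norm s \<Omega> u2)"
  have lap: "laplacian u1 x - laplacian u2 x = (\<Sum>i\<in>UNIV. D i x)" for x
    by (simp add: laplacian_def D_def sum_subtractf)
  interpret vector_field \<Omega> V D B'
  proof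
    show "open \<Omega>" "bounded \<Omega>" by (rule op, rule bd)
    show "has_pd (V i) (D i x) i x" if "x \<in> \<Omega>" for i x
      unfolding V_def[abs_def] D_def
      using Ck_has_pd[OF u1(2), of "[i]" x i] Ck_has_pd[OF u2(2), of "[i]" x i] that
      by (intro has_pd_diff) auto
    show "continuous_on \<Omega> (V i)" "continuous_on \<Omega> (D i)" for i
      unfolding V_def[abs_def] D_def[abs_def]
      by (auto simp del: dpart.simps intro!: continuous_intros Ck_continuous[OF u1(2)] Ck_continuous[OF u2(2)])
    show "\<bar>V i x\<bar> \<le> B'" if "x \<in> \<Omega>" for i x
      using dpart_le_holder_norm[OF u1(1), of "[i]" x] dpart_le_holder_norm[OF u2(1), of "[i]" x] m1 that
      unfolding V_def B'_def by (auto simp del: dpart.simps)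
    show "\<bar>\<Sum>i\<in>UNIV. D i x\<bar> \<le> B'" if "x \<in> \<Omega>" for x
      using B[OF that] by (simp add: lap B'_def)
  qed
  have "(LINT x:\<Omega>|lborel. \<Sum>i\<in>UNIV. D i x) = 0"
  proof (rule divergence_integral_eq_0)
    fix x0 assume x0: "x0 \<in> frontier \<Omega>"
    then obtain r \<rho> where loc: "local_defining \<Omega> x0 r \<rho>" using sb unfolding smooth_boundary_def by blast
    show "\<exists>r \<rho>. local_defining \<Omega> x0 r \<rho> \<and> (\<forall>s e. s < r \<longrightarrow> e > 0 \<longrightarrow> (\<exists>\<delta>>0. \<forall>x\<in>\<Omega> \<inter> cball x0 s.
       infdist x (frontier \<Omega>) < \<delta> \<longrightarrow> \<bar>\<Sum>i\<in>UNIV. V i x * dpart \<rho> [i] x\<bar> \<le> e))"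
      using flux_decay[OF sb u1(1) u2(1) eq x0 loc] loc unfolding V_def by blast
  qed
  then show ?thesis by (simp add: lap)
qed

end

section \<open>Locally uniform convergence of derivatives\<close>

text \<open>A Cauchy condition instead of convergence: the limits of the derivatives are not known
  in advance, and two members of the sequence can be compared through the equation for their
  difference.\<close>

definition loc_cauchy :: "(real^'n) set \<Rightarrow> (nat \<Rightarrow> real^'n \<Rightarrow> real) \<Rightarrow> bool" where
  "loc_cauchy U f \<longleftrightarrow> (\<forall>x\<in>U. \<exists>r>0. cball x r \<subseteq> U \<and>
     (\<forall>e>0. \<exists>M. \<forall>k\<ge>M. \<forall>l\<ge>M. \<forall>y\<in>cball x r. \<bar>f k y - f l y\<bar> \<le> e))"

lemma loc_cauchyE:
  assumes "loc_cauchy U f" "x \<in> U"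
  obtains r where "r > 0" "cball x r \<subseteq> U"
    "\<And>e. e > 0 \<Longrightarrow> \<exists>M. \<forall>k\<ge>M. \<forall>l\<ge>M. \<forall>y\<in>cball x r. \<bar>f k y - f l y\<bar> \<le> e"
  using assms unfolding loc_cauchy_def by blast

lemma loc_cauchy_shrink:
  assumes "loc_cauchy U f" "loc_cauchy U g" "x \<in> U"
  obtains r where "r > 0" "cball x r \<subseteq> U"
    "\<And>e. e > 0 \<Longrightarrow> \<exists>M. \<forall>k\<ge>M. \<forall>l\<ge>M. \<forall>y\<in>cball x r. \<bar>f k y - f l y\<bar> \<le> e \<and> \<bar>g k y - g l y\<bar> \<le> e"
proof -
  obtain r where r: "r > 0" "cball x r \<subseteq> U"
    "\<And>e. e > 0 \<Longrightarrow> \<exists>M. \<forall>k\<ge>M. \<forall>l\<ge>M. \<forall>y\<in>cball x r. \<bar>f k y - f l y\<bar> \<le> e"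
    using loc_cauchyE[OF assms(1,3)] by blast
  obtain r' where r': "r' > 0" "cball x r' \<subseteq> U"
    "\<And>e. e > 0 \<Longrightarrow> \<exists>M. \<forall>k\<ge>M. \<forall>l\<ge>M. \<forall>y\<in>cball x r'. \<bar>g k y - g l y\<bar> \<le> e"
    using loc_cauchyE[OF assms(2,3)] by blast
  show ?thesis
  proof (rule that[of "min r r'"])
    fix e :: real assume e: "e > 0"
    then obtain M1 M2 where M: "\<And>k l y. k \<ge> M1 \<Longrightarrow> l \<ge> M1 \<Longrightarrow> y \<in> cball x r \<Longrightarrow> \<bar>f k y - f l y\<bar> \<le> e"
      "\<And>k l y. k \<ge> M2 \<Longrightarrow> l \<ge> M2 \<Longrightarrow> y \<in> cball x r' \<Longrightarrow> \<bar>g k y - g l y\<bar> \<le> e"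
      using r(3)[of e] r'(3)[of e] by metis
    then show "\<exists>M. \<forall>k\<ge>M. \<forall>l\<ge>M. \<forall>y\<in>cball x (min r r'). \<bar>f k y - f l y\<bar> \<le> e \<and> \<bar>g k y - g l y\<bar> \<le> e"
      by (intro exI[of _ "max M1 M2"]) auto
  qed (use r r' in auto)
qed

lemma loc_cauchy_add:
  assumes "loc_cauchy U f" "loc_cauchy U g"
  shows "loc_cauchy U (\<lambda>k x. f k x + g k x)"
  unfolding loc_cauchy_def
proof
  fix x assume x: "x \<in> U"
  obtain r where r: "r > 0" "cball x r \<subseteq> U"
    "\<And>e. e > 0 \<Longrightarrow> \<exists>M. \<forall>k\<ge>M. \<forall>l\<ge>M. \<forall>y\<in>cball x r. \<bar>f k y - f l y\<bar> \<le> e \<and> \<bar>g k y - g l y\<bar> \<le> e"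
    using loc_cauchy_shrink[OF assms x] by blast
  show "\<exists>r>0. cball x r \<subseteq> U \<and> (\<forall>e>0. \<exists>M. \<forall>k\<ge>M. \<forall>l\<ge>M. \<forall>y\<in>cball x r.
     \<bar>(f k y + g k y) - (f l y + g l y)\<bar> \<le> e)"
  proof (intro exI[of _ r] conjI allI impI r)
    fix e :: real assume e: "e > 0"
    then obtain M where M: "\<And>k l y. k \<ge> M \<Longrightarrow> l \<ge> M \<Longrightarrow> y \<in> cball x r \<Longrightarrow> \<bar>f k y - f l y\<bar> \<le> e/2 \<and> \<bar>g k y - g l y\<bar> \<le> e/2"
      using r(3)[of "e/2"] by (metis half_gt_zero)
    show "\<exists>M. \<forall>k\<ge>M. \<forall>l\<ge>M. \<forall>y\<in>cball x r. \<bar>(f k y + g k y) - (f l y + g l y)\<bar> \<le> e"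
    proof (intro exI[of _ M] allI impI ballI)
      fix k l y assume "k \<ge> M" "l \<ge> M" "y \<in> cball x r"
      then have "\<bar>f k y - f l y\<bar> \<le> e/2 \<and> \<bar>g k y - g l y\<bar> \<le> e/2" by (rule M)
      then show "\<bar>(f k y + g k y) - (f l y + g l y)\<bar> \<le> e" by linarith
    qed
  qed
qed

lemma loc_cauchy_mult:
  assumes "loc_cauchy U f" "loc_cauchy U g"
    and B: "\<And>k x. x \<in> U \<Longrightarrow> \<bar>f k x\<bar> \<le> B" "\<And>k x. x \<in> U \<Longrightarrow> \<bar>g k x\<bar> \<le> B"
  shows "loc_cauchy U (\<lambda>k x. f k x * g k x)"
  unfolding loc_cauchy_def
proof
  fix x assume x: "x \<in> U"
  obtain r where r: "r > 0" "cball x r \<subseteq> U"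
    "\<And>e. e > 0 \<Longrightarrow> \<exists>M. \<forall>k\<ge>M. \<forall>l\<ge>M. \<forall>y\<in>cball x r. \<bar>f k y - f l y\<bar> \<le> e \<and> \<bar>g k y - g l y\<bar> \<le> e"
    using loc_cauchy_shrink[OF assms(1,2) x] by blast
  have B0: "B \<ge> 0" using B(1)[OF x, of 0] by linarith
  show "\<exists>r>0. cball x r \<subseteq> U \<and> (\<forall>e>0. \<exists>M. \<forall>k\<ge>M. \<forall>l\<ge>M. \<forall>y\<in>cball x r.
     \<bar>(f k y * g k y) - (f l y * g l y)\<bar> \<le> e)"
  proof (intro exI[of _ r] conjI allI impI r)
    fix e :: real assume e: "e > 0"
    define e' where "e' = e / (2 * (B + 1))"
    have e': "e' > 0" using e B0 by (simp add: e'_def)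
    then obtain M where M: "\<And>k l y. k \<ge> M \<Longrightarrow> l \<ge> M \<Longrightarrow> y \<in> cball x r \<Longrightarrow> \<bar>f k y - f l y\<bar> \<le> e' \<and> \<bar>g k y - g l y\<bar> \<le> e'"
      using r(3)[of e'] by metis
    show "\<exists>M. \<forall>k\<ge>M. \<forall>l\<ge>M. \<forall>y\<in>cball x r. \<bar>(f k y * g k y) - (f l y * g l y)\<bar> \<le> e"
    proof (intro exI[of _ M] allI impI ballI)
      fix k l y assume *: "k \<ge> M" "l \<ge> M" "y \<in> cball x r"
      then have d: "\<bar>f k y - f l y\<bar> \<le> e'" "\<bar>g k y - g l y\<bar> \<le> e'" using M by auto
      have yU: "y \<in> U" using * r(2) by auto
      have "f k y * g k y - f l y * g l y = f k y * (g k y - g l y) + (f k y - f l y) * g l y"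
        by (simp add: algebra_simps)
      moreover have "\<bar>f k y * (g k y - g l y)\<bar> \<le> (B + 1) * e'"
        unfolding abs_mult using B(1)[OF yU, of k] d(2) B0 by (intro mult_mono) auto
      moreover have "\<bar>(f k y - f l y) * g l y\<bar> \<le> e' * (B + 1)"
        unfolding abs_mult using B(2)[OF yU, of l] d(1) e' by (intro mult_mono) auto
      moreover have "e' * (B + 1) = e / 2" using B0 unfolding e'_def by (simp add: divide_eq_eq)
      moreover have "(B + 1) * e' = e' * (B + 1)" by (rule mult.commute)
      ultimately show "\<bar>(f k y * g k y) - (f l y * g l y)\<bar> \<le> e" by linarith
    qed
  qed
qed

lemma loc_cauchy_cmult:
  assumes c: "continuous_on U c" and "loc_cauchy U f"
  shows "loc_cauchy U (\<lambda>k x. c x * f k x)"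
  unfolding loc_cauchy_def
proof
  fix x assume x: "x \<in> U"
  obtain r where r: "r > 0" "cball x r \<subseteq> U"
    "\<And>e. e > 0 \<Longrightarrow> \<exists>M. \<forall>k\<ge>M. \<forall>l\<ge>M. \<forall>y\<in>cball x r. \<bar>f k y - f l y\<bar> \<le> e"
    using loc_cauchyE[OF assms(2) x] by blast
  have "bounded (c ` cball x r)"
    by (intro compact_imp_bounded compact_continuous_image continuous_on_subset[OF c r(2)] compact_cball)
  then obtain B where B: "B > 0" "\<And>y. y \<in> cball x r \<Longrightarrow> \<bar>c y\<bar> \<le> B" unfolding bounded_pos by auto
  show "\<exists>r>0. cball x r \<subseteq> U \<and> (\<forall>e>0. \<exists>M. \<forall>k\<ge>M. \<forall>l\<ge>M. \<forall>y\<in>cball x r. \<bar>c y * f k y - c y * f l y\<bar> \<le> e)"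
  proof (intro exI[of _ r] conjI allI impI r)
    fix e :: real assume e: "e > 0"
    then obtain M where M: "\<And>k l y. k \<ge> M \<Longrightarrow> l \<ge> M \<Longrightarrow> y \<in> cball x r \<Longrightarrow> \<bar>f k y - f l y\<bar> \<le> e / B"
      using r(3)[of "e / B"] B(1) by (metis divide_pos_pos)
    show "\<exists>M. \<forall>k\<ge>M. \<forall>l\<ge>M. \<forall>y\<in>cball x r. \<bar>c y * f k y - c y * f l y\<bar> \<le> e"
    proof (intro exI[of _ M] allI impI ballI)
      fix k l y assume *: "k \<ge> M" "l \<ge> M" "y \<in> cball x r"
      have "\<bar>c y * (f k y - f l y)\<bar> \<le> B * (e / B)"
        unfolding abs_mult using B M[OF *] * by (intro mult_mono) auto
      then show "\<bar>c y * f k y - c y * f l y\<bar> \<le> e" using B(1) by (simp add: right_diff_distrib)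
    qed
  qed
qed

lemma dpart_translate: "dpart (\<lambda>z. u (z + a)) \<beta> = (\<lambda>z. dpart u \<beta> (z + a))"
  by (induction \<beta>) (simp_all add: add_ac)

lemma Ck_translate:
  assumes "Ck k V u" "\<And>z. z \<in> U \<Longrightarrow> z + a \<in> V"
  shows "Ck k U (\<lambda>z. u (z + a))"
proof (rule CkI)
  fix \<beta> :: "'a list" assume "length \<beta> \<le> k"
  then show "continuous_on U (dpart (\<lambda>z. u (z + a)) \<beta>)"
    unfolding dpart_translate
    using assms(2) by (intro continuous_on_compose2[OF Ck_continuous[OF assms(1)]] continuous_intros) auto
next
  fix \<beta> :: "'a list" and i x assume "length \<beta> < k" "x \<in> U"
  then show "\<exists>D. has_pd (dpart (\<lambda>z. u (z + a)) \<beta>) D i x"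
    unfolding dpart_translate
    using has_pd_translate[OF Ck_has_pd[OF assms(1), of \<beta> "x + a" i]] assms(2) by blast
qed

text \<open>Second derivatives are controlled by applying the gradient estimate to difference
  quotients, so that only first derivatives of the right hand side enter.\<close>
lemma loc_cauchy_second_derivatives:
  fixes u :: "nat \<Rightarrow> real^'n \<Rightarrow> real"
  assumes Om: "open \<Omega>" and Ck: "\<And>k. Ck 2 \<Omega> (u k)"
    and F: "\<And>k x. x \<in> \<Omega> \<Longrightarrow> laplacian (u k) x = F k x"
    and DF: "\<And>k x. x \<in> \<Omega> \<Longrightarrow> has_pd (F k) (DF k x) i x"
    and c1: "loc_cauchy \<Omega> (\<lambda>k. dpart (u k) [i])" and c2: "loc_cauchy \<Omega> DF"
  shows "loc_cauchy \<Omega> (\<lambda>k. dpart (u k) [i, j])"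
  unfolding loc_cauchy_def
proof
  fix x assume "x \<in> \<Omega>"
  then obtain r where r: "r > 0" "cball x r \<subseteq> \<Omega>" and
    cau: "\<And>e. e > 0 \<Longrightarrow> \<exists>M. \<forall>k\<ge>M. \<forall>l\<ge>M. \<forall>y\<in>cball x r.
       \<bar>dpart (u k) [i] y - dpart (u l) [i] y\<bar> \<le> e \<and> \<bar>DF k y - DF l y\<bar> \<le> e"
    using loc_cauchy_shrink[OF c1 c2] by metis
  define n where "n = real CARD('n)"
  have n1: "n \<ge> 1" by (simp add: n_def Suc_leI)
  \<comment> \<open>A cube of half side \<open>d\<close> has its points within
    \<open>n * d = r / 4\<close> of the centre.\<close>
  define d where "d = r / (4 * n)"
  have d: "d > 0" using r n1 by (simp add: d_def)
  \<comment> \<open>The constant of \<open>interior_gradient_estimate\<close> when function and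
    Laplacian have the same bound.\<close>
  define C where "C = n / d + d / 2"
  have C: "C > 0" using n1 d by (simp add: C_def add_pos_pos)
  have est: "\<bar>dpart (u k) [i, j] y - dpart (u l) [i, j] y\<bar> \<le> C * e"
    if e: "\<And>z. z \<in> cball x r \<Longrightarrow> \<bar>dpart (u k) [i] z - dpart (u l) [i] z\<bar> \<le> e \<and> \<bar>DF k z - DF l z\<bar> \<le> e"
      and y: "y \<in> cball x (r/4)" for k l e y
  proof -
    define w where "w z = u k z - u l z" for z
    have wk: "w = (\<lambda>z. 1 * u k z + (-1) * u l z)" by (auto simp: w_def)
    have wC: "Ck 2 \<Omega> w" unfolding wk by (rule Ck_combination[OF Om Ck Ck])
    have wd: "dpart w \<beta> z = dpart (u k) \<beta> z - dpart (u l) \<beta> z" if "z \<in> \<Omega>" "length \<beta> \<le> 2" for z \<beta>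
      unfolding wk using dpart_combination[OF Om Ck Ck that(2,1), of 1 k "-1" l] by simp
    \<comment> \<open>The cube around a point of the quarter ball lies in \<open>U\<close>, and a
      shift by \<open>h < r / 4\<close> does not lead from \<open>U\<close> out of the ball of
      radius \<open>r\<close>.\<close>
    define U where "U = ball x (3 * r / 4)"
    have U: "open U" "U \<subseteq> cball x r" "U \<subseteq> \<Omega>" using r by (auto simp: U_def)
    have yO: "y \<in> \<Omega>" using y r by (intro subsetD[OF r(2)]) auto
    have quot: "\<bar>(dpart w [j] (y + h *\<^sub>R axis i 1) - dpart w [j] y) / h\<bar> \<le> C * e" if h: "0 < h" "h < r / 4" for h
    proof -
      define a where "a = h *\<^sub>R (axis i 1 :: real^'n)"
      have na: "norm a = h" using h by (simp add: a_def)
      have Ua: "z + a \<in> cball x r" if "z \<in> U" for z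
      proof -
        have "norm (x - (z + a)) \<le> norm (x - z) + norm a" using norm_triangle_ineq4[of "x - z" a] by (simp add: diff_diff_eq)
        then show ?thesis using that h na by (simp add: U_def dist_norm)
      qed
      \<comment> \<open>The difference quotient of \<open>w\<close> in direction \<open>i\<close>:
        by the mean value theorem it takes values of a first derivative of \<open>w\<close>, and its
        Laplacian takes values of \<open>DF k - DF l\<close>.\<close>
      define v where "v = (\<lambda>z. (1/h) * w (z + a) + (- 1/h) * w z)"
      have wa: "Ck 2 U (\<lambda>z. w (z + a))" using Ua r by (intro Ck_translate[OF wC]) auto
      have wU: "Ck 2 U w" by (rule Ck_subset[OF wC U(3)])
      have vC: "Ck 2 U v" unfolding v_def by (rule Ck_combination[OF U(1) wa wU])
      have vd: "dpart v \<beta> z = (dpart w \<beta> (z + a) - dpart w \<beta> z) / h" if "z \<in> U" "length \<beta> \<le> 2" for z \<beta>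
        unfolding v_def using dpart_combination[OF U(1) wa wU that(2,1), of "1/h" "- 1/h"] h
        by (simp add: dpart_translate diff_divide_distrib)
      have vb: "\<bar>v z\<bar> \<le> e" if z: "z \<in> U" for z
      proof -
        have "\<exists>z'\<in>cball x r. norm (z' - z) \<le> \<bar>h\<bar> \<and> w (z + h *\<^sub>R axis i 1) - w z = h * dpart w [i] z'"
        proof (rule has_pd_mvt)
          show "z \<in> cball x r" using z U by auto
          show "z + h *\<^sub>R axis i 1 \<in> cball x r" using Ua[OF z] by (simp add: a_def)
          show "has_pd w (dpart w [i] y) i y" if "y \<in> cball x r" for y
            using Ck_has_pd[OF wC, of "[]" y i] that r by auto
        qed auto
        then obtain z' where z': "z' \<in> cball x r" "w (z + a) - w z = h * dpart w [i] z'" unfolding a_def by blast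
        have "v z = dpart w [i] z'" using z'(2) h unfolding v_def by (simp add: field_simps)
        moreover have "dpart w [i] z' = dpart (u k) [i] z' - dpart (u l) [i] z'"
          using z' r by (intro wd) auto
        ultimately show ?thesis using e[OF z'(1)] by simp
      qed
      have lb: "\<bar>laplacian v z\<bar> \<le> e" if z: "z \<in> U" for z
      proof -
        have lw: "laplacian w z = F k z - F l z" if "z \<in> \<Omega>" for z
        proof -
          have "laplacian w z = laplacian (u k) z - laplacian (u l) z"
            unfolding laplacian_def using wd[OF that] by (simp add: sum_subtractf del: dpart.simps)
          then show ?thesis using F[OF that] by simp
        qed
        have "laplacian v z = (laplacian w (z + a) - laplacian w z) / h"
          unfolding laplacian_def using vd[OF z]
          by (simp add: sum_subtractf sum_divide_distrib[symmetric] del: dpart.simps)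
        also have "\<dots> = ((F k (z + a) - F l (z + a)) - (F k z - F l z)) / h"
          using lw[of z] lw[of "z + a"] Ua[OF z] z U r by (simp add: subset_iff)
        finally have lv: "laplacian v z = \<dots>" .
        have "\<exists>z'\<in>cball x r. norm (z' - z) \<le> \<bar>h\<bar> \<and>
           (\<lambda>z. F k z - F l z) (z + h *\<^sub>R axis i 1) - (\<lambda>z. F k z - F l z) z = h * (DF k z' - DF l z')"
        proof (rule has_pd_mvt)
          show "z \<in> cball x r" using z U by auto
          show "z + h *\<^sub>R axis i 1 \<in> cball x r" using Ua[OF z] by (simp add: a_def)
          show "has_pd (\<lambda>z. F k z - F l z) (DF k y - DF l y) i y" if "y \<in> cball x r" for y
            using that r by (intro has_pd_diff DF) auto
        qed auto
        then obtain z' where z': "z' \<in> cball x r" "(F k (z + a) - F l (z + a)) - (F k z - F l z) = h * (DF k z' - DF l z')"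
          unfolding a_def by blast
        then have "laplacian v z = DF k z' - DF l z'" unfolding lv using h by simp
        then show ?thesis using e[OF z'(1)] by simp
      qed
      have cube: "z \<in> U" if "\<And>i. \<bar>z $ i - y $ i\<bar> \<le> d" for z
      proof -
        have "norm (z - y) \<le> (\<Sum>i\<in>UNIV. \<bar>(z - y) $ i\<bar>)" by (rule norm_le_l1_cart)
        also have "\<dots> \<le> (\<Sum>i\<in>(UNIV::'n set). d)" using that by (intro sum_mono) auto
        also have "\<dots> = r / 4" using n1 by (simp add: d_def n_def)
        finally have "dist y z \<le> r / 4" by (simp add: dist_norm norm_minus_commute)
        then have "dist x z < 3 * r / 4" using y dist_triangle[of x z y] r(1) by simp
        then show ?thesis by (simp add: U_def)
      qed
      have "\<bar>dpart v [j] y\<bar> \<le> CARD('n) * e / d + e * d / 2"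
        by (rule interior_gradient_estimate[OF U(1) vC d]) (use cube vb lb in auto)
      also have "\<dots> = C * e" by (simp add: C_def n_def field_simps)
      finally show ?thesis
        using vd[of y "[j]"] cube[of y] d by (simp add: a_def del: dpart.simps)
    qed
    \<comment> \<open>The head of a multi-index is the last derivative taken, so the quotients of
      \<open>dpart w [j]\<close> in direction \<open>i\<close> tend to the entry
      \<open>[i, j]\<close>.\<close>
    have "((\<lambda>h. (dpart w [j] (y + h *\<^sub>R axis i 1) - dpart w [j] y) / h) \<longlongrightarrow> dpart w [i, j] y) (at 0)"
      using Ck_has_pd[OF wC, of "[j]" y i] yO unfolding has_pd_def DERIV_def by simp
    then have "((\<lambda>h. (dpart w [j] (y + h *\<^sub>R axis i 1) - dpart w [j] y) / h) \<longlongrightarrow> dpart w [i, j] y) (at_right 0)"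
      using tendsto_within_subset by blast
    then have "\<bar>dpart w [i, j] y\<bar> \<le> C * e"
    proof (rule tendsto_upperbound[OF tendsto_rabs])
      show "\<forall>\<^sub>F h in at_right 0. \<bar>(dpart w [j] (y + h *\<^sub>R axis i 1) - dpart w [j] y) / h\<bar> \<le> C * e"
        unfolding eventually_at_right_field using quot r by (intro exI[of _ "r/4"]) auto
    qed simp
    then show ?thesis using wd[OF yO, of "[i, j]"] by (simp del: dpart.simps)
  qed
  show "\<exists>r>0. cball x r \<subseteq> \<Omega> \<and> (\<forall>e>0. \<exists>M. \<forall>k\<ge>M. \<forall>l\<ge>M. \<forall>y\<in>cball x r.
       \<bar>dpart (u k) [i, j] y - dpart (u l) [i, j] y\<bar> \<le> e)"
  proof (intro exI[of _ "r/4"] conjI allI impI)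
    show "cball x (r/4) \<subseteq> \<Omega>" using r by (auto intro!: subsetD[OF r(2)])
    fix e :: real assume "e > 0"
    then obtain M where M: "\<And>k l y. k \<ge> M \<Longrightarrow> l \<ge> M \<Longrightarrow> y \<in> cball x r \<Longrightarrow>
       \<bar>dpart (u k) [i] y - dpart (u l) [i] y\<bar> \<le> e / C \<and> \<bar>DF k y - DF l y\<bar> \<le> e / C"
      using cau[of "e / C"] C by (metis divide_pos_pos)
    show "\<exists>M. \<forall>k\<ge>M. \<forall>l\<ge>M. \<forall>y\<in>cball x (r/4). \<bar>dpart (u k) [i, j] y - dpart (u l) [i, j] y\<bar> \<le> e"
    proof (intro exI[of _ M] allI impI ballI)
      fix k l y assume "M \<le> k" "M \<le> l" "y \<in> cball x (r/4)"
      then have "\<bar>dpart (u k) [i, j] y - dpart (u l) [i, j] y\<bar> \<le> C * (e / C)"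
        using M by (intro est) auto
      then show "\<bar>dpart (u k) [i, j] y - dpart (u l) [i, j] y\<bar> \<le> e" using C by simp
    qed
  qed (use r in auto)
qed

lemma loc_cauchy_limit:
  assumes "loc_cauchy U f"
  obtains g where "\<And>x. x \<in> U \<Longrightarrow> (\<lambda>k. f k x) \<longlonglongrightarrow> g x"
    "\<And>x. x \<in> U \<Longrightarrow> \<exists>r>0. cball x r \<subseteq> U \<and> uniform_limit (cball x r) f g sequentially"
proof -
  have conv: "convergent (\<lambda>k. f k x)" if x: "x \<in> U" for x
  proof -
    obtain r where r: "r > 0" "cball x r \<subseteq> U" "\<And>e. e > 0 \<Longrightarrow> \<exists>M. \<forall>k\<ge>M. \<forall>l\<ge>M. \<forall>y\<in>cball x r. \<bar>f k y - f l y\<bar> \<le> e"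
      using loc_cauchyE[OF assms x] by blast
    have "Cauchy (\<lambda>k. f k x)"
    proof (rule metric_CauchyI)
      fix e :: real assume "e > 0"
      then obtain M where "\<forall>k\<ge>M. \<forall>l\<ge>M. \<forall>y\<in>cball x r. \<bar>f k y - f l y\<bar> \<le> e/2" using r(3)[of "e/2"] by auto
      then have "\<forall>k\<ge>M. \<forall>l\<ge>M. dist (f k x) (f l x) < e"
      proof (intro allI impI)
        fix k l assume "k \<ge> M" "l \<ge> M"
        then have "\<bar>f k x - f l x\<bar> \<le> e/2"
          using \<open>\<forall>k\<ge>M. \<forall>l\<ge>M. \<forall>y\<in>cball x r. \<bar>f k y - f l y\<bar> \<le> e/2\<close> r(1) by simp
        then show "dist (f k x) (f l x) < e" using \<open>e > 0\<close> by (simp add: dist_real_def)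
      qed
      then show "\<exists>M. \<forall>k\<ge>M. \<forall>l\<ge>M. dist (f k x) (f l x) < e" by blast
    qed
    then show ?thesis by (rule Cauchy_convergent)
  qed
  define g where "g x = lim (\<lambda>k. f k x)" for x
  have lim: "(\<lambda>k. f k x) \<longlonglongrightarrow> g x" if "x \<in> U" for x
    using conv[OF that] unfolding g_def by (simp add: convergent_LIMSEQ_iff)
  show ?thesis
  proof (rule that[OF lim])
    fix x assume x: "x \<in> U"
    obtain r where r: "r > 0" "cball x r \<subseteq> U" "\<And>e. e > 0 \<Longrightarrow> \<exists>M. \<forall>k\<ge>M. \<forall>l\<ge>M. \<forall>y\<in>cball x r. \<bar>f k y - f l y\<bar> \<le> e"
      using loc_cauchyE[OF assms x] by blast
    have "uniform_limit (cball x r) f g sequentially"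
    proof (rule uniform_limitI)
      fix e :: real assume e: "e > 0"
      then obtain M where M: "\<And>k l y. k \<ge> M \<Longrightarrow> l \<ge> M \<Longrightarrow> y \<in> cball x r \<Longrightarrow> \<bar>f k y - f l y\<bar> \<le> e/2"
        using r(3)[of "e/2"] by (metis half_gt_zero)
      have "dist (f k y) (g y) < e" if k: "k \<ge> M" and y: "y \<in> cball x r" for k y
      proof -
        have "(\<lambda>l. \<bar>f k y - f l y\<bar>) \<longlonglongrightarrow> \<bar>f k y - g y\<bar>"
          using y r by (intro tendsto_intros lim) auto
        then have "\<bar>f k y - g y\<bar> \<le> e/2"
          by (rule tendsto_upperbound) (use M[OF k _ y] in \<open>auto simp: eventually_sequentially\<close>)
        then show ?thesis using e by (simp add: dist_real_def)
      qed
      then show "\<forall>\<^sub>F k in sequentially. \<forall>y\<in>cball x r. dist (f k y) (g y) < e"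
        unfolding eventually_sequentially by blast
    qed
    then show "\<exists>r>0. cball x r \<subseteq> U \<and> uniform_limit (cball x r) f g sequentially" using r by blast
  qed blast
qed

text \<open>Restriction to the line through \<open>x\<close> reduces this to the one-variable
  theorem on uniformly convergent derivatives.\<close>

lemma has_pd_sequence:
  assumes r: "r > 0" and pd: "\<And>k y. y \<in> cball x r \<Longrightarrow> has_pd (f k) (D k y) i y"
    and lim: "\<And>y. y \<in> cball x r \<Longrightarrow> (\<lambda>k. f k y) \<longlonglongrightarrow> g y"
    and unif: "uniform_limit (cball x r) D G sequentially"
  shows "has_pd g (G x) i x"
proof -
  let ?l = "\<lambda>t. x + t *\<^sub>R axis i (1::real)"
  have inb: "?l t \<in> cball x r" if "t \<in> {-r..r}" for t
    using that by (auto simp: dist_norm)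
  have "\<exists>h. \<forall>t\<in>{-r..r}. (\<lambda>k. f k (?l t)) \<longlonglongrightarrow> h t \<and> (h has_derivative (\<lambda>s. G (?l t) * s)) (at t within {-r..r})"
  proof (rule has_derivative_sequence)
    show "((\<lambda>t. f k (?l t)) has_derivative (\<lambda>s. D k (?l t) * s)) (at t within {-r..r})" if "t \<in> {-r..r}" for k t
      using has_pd_line[OF pd[OF inb[OF that]], of k] unfolding has_field_derivative_def
      by (rule has_derivative_at_withinI)
    show "\<forall>\<^sub>F k in sequentially. \<forall>t\<in>{-r..r}. \<forall>s. norm (D k (?l t) * s - G (?l t) * s) \<le> e * norm s" if "e > 0" for e
      using uniform_limitD[OF unif that]
    proof eventually_elim
      case (elim k)
      show ?case
      proof (intro ballI allI)
        fix t s assume "t \<in> {-r..r}"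
        then have "\<bar>D k (?l t) - G (?l t)\<bar> \<le> e" using elim inb by (fastforce simp: dist_real_def)
        then show "norm (D k (?l t) * s - G (?l t) * s) \<le> e * norm s"
          by (simp add: left_diff_distrib[symmetric] abs_mult mult_right_mono)
      qed
    qed
    show "(\<lambda>k. f k (?l 0)) \<longlonglongrightarrow> g x" using lim[of x] r by simp
  qed (use r in auto)
  then obtain h where h: "\<And>t. t \<in> {-r..r} \<Longrightarrow> (\<lambda>k. f k (?l t)) \<longlonglongrightarrow> h t"
    "\<And>t. t \<in> {-r..r} \<Longrightarrow> (h has_derivative (\<lambda>s. G (?l t) * s)) (at t within {-r..r})" by blast
  have hg: "h t = g (?l t)" if "t \<in> {-r..r}" for t
    using h(1)[OF that] lim[OF inb[OF that]] LIMSEQ_unique by blast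
  have "(h has_derivative (\<lambda>s. G x * s)) (at 0)"
  proof -
    have "at 0 within {-r..r} = at 0"
      by (rule at_within_interior) (use r in simp)
    moreover have "0 \<in> {-r..r}" using r by simp
    ultimately show ?thesis using h(2)[of 0] by (metis add.right_neutral scale_zero_left)
  qed
  then have "(h has_real_derivative G x) (at 0)"
    unfolding has_field_derivative_def .
  moreover have "\<forall>\<^sub>F t in nhds 0. h t = g (?l t)"
    unfolding eventually_nhds_metric using r
    by (intro exI[of _ r]) (auto simp: dist_real_def abs_less_iff intro!: hg)
  ultimately show ?thesis
    unfolding has_pd_def by (subst (asm) DERIV_cong_ev[OF refl _ refl]) auto
qed

text \<open>One order at a time: the next derivatives, being Cauchy, converge locally uniformly to
  some \<open>G\<close>, and \<open>has_pd_sequence\<close> identifies \<open>G\<close> as the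
  derivative of the limit already found.\<close>

lemma Ck_limit:
  fixes u :: "nat \<Rightarrow> real^'n \<Rightarrow> real"
  assumes Om: "open \<Omega>" and Ck: "\<And>k. Ck p \<Omega> (u k)"
    and cau: "\<And>\<beta>. length \<beta> \<le> p \<Longrightarrow> loc_cauchy \<Omega> (\<lambda>k. dpart (u k) \<beta>)"
    and lim: "\<And>x. x \<in> \<Omega> \<Longrightarrow> (\<lambda>k. u k x) \<longlonglongrightarrow> g x"
  shows "Ck p \<Omega> g" "\<And>\<beta> x. length \<beta> \<le> p \<Longrightarrow> x \<in> \<Omega> \<Longrightarrow> (\<lambda>k. dpart (u k) \<beta> x) \<longlonglongrightarrow> dpart g \<beta> x"
proof -
  have key: "\<exists>r>0. cball x r \<subseteq> \<Omega> \<and> (\<forall>y\<in>cball x r. (\<lambda>k. dpart (u k) (i#\<beta>) y) \<longlonglongrightarrow> G y) \<and> has_pd (dpart g \<beta>) (G x) i x"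
    if l: "length \<beta> < p" and x: "x \<in> \<Omega>" and IH: "\<And>x. x \<in> \<Omega> \<Longrightarrow> (\<lambda>k. dpart (u k) \<beta> x) \<longlonglongrightarrow> dpart g \<beta> x"
      and G: "\<And>x. x \<in> \<Omega> \<Longrightarrow> (\<lambda>k. dpart (u k) (i#\<beta>) x) \<longlonglongrightarrow> G x"
        "\<And>x. x \<in> \<Omega> \<Longrightarrow> \<exists>r>0. cball x r \<subseteq> \<Omega> \<and> uniform_limit (cball x r) (\<lambda>k. dpart (u k) (i#\<beta>)) G sequentially"
    for \<beta> i x G
  proof -
    obtain r where r: "r > 0" "cball x r \<subseteq> \<Omega>" "uniform_limit (cball x r) (\<lambda>k. dpart (u k) (i#\<beta>)) G sequentially"
      using G(2)[OF x] by blast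
    have "has_pd (dpart g \<beta>) (G x) i x"
    proof (rule has_pd_sequence[OF r(1) _ _ r(3)])
      show "has_pd (dpart (u k) \<beta>) (dpart (u k) (i#\<beta>) y) i y" if "y \<in> cball x r" for k y
        using Ck_has_pd[OF Ck l] that r(2) by blast
      show "(\<lambda>k. dpart (u k) \<beta> y) \<longlonglongrightarrow> dpart g \<beta> y" if "y \<in> cball x r" for y
        using IH that r(2) by blast
    qed
    then show ?thesis using r G(1) by blast
  qed
  have main: "(\<forall>x\<in>\<Omega>. (\<lambda>k. dpart (u k) \<beta> x) \<longlonglongrightarrow> dpart g \<beta> x)" if "length \<beta> \<le> p" for \<beta>
    using that
  proof (induction \<beta>)
    case Nil
    then show ?case using lim by simp
  next
    case (Cons i \<beta>)
    obtain G where G: "\<And>x. x \<in> \<Omega> \<Longrightarrow> (\<lambda>k. dpart (u k) (i#\<beta>) x) \<longlonglongrightarrow> G x"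
        "\<And>x. x \<in> \<Omega> \<Longrightarrow> \<exists>r>0. cball x r \<subseteq> \<Omega> \<and> uniform_limit (cball x r) (\<lambda>k. dpart (u k) (i#\<beta>)) G sequentially"
      using loc_cauchy_limit[OF cau[OF Cons.prems]] by metis
    have IH: "\<And>x. x \<in> \<Omega> \<Longrightarrow> (\<lambda>k. dpart (u k) \<beta> x) \<longlonglongrightarrow> dpart g \<beta> x" using Cons by auto
    have l: "length \<beta> < p" using Cons.prems by simp
    show ?case
    proof
      fix x assume x: "x \<in> \<Omega>"
      have "has_pd (dpart g \<beta>) (G x) i x" using key[OF l x IH G] by blast
      then have "dpart g (i#\<beta>) x = G x" by (rule dpart_Cons_eq)
      then show "(\<lambda>k. dpart (u k) (i#\<beta>) x) \<longlonglongrightarrow> dpart g (i#\<beta>) x" using G(1)[OF x] by simp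
    qed
  qed
  show "\<And>\<beta> x. length \<beta> \<le> p \<Longrightarrow> x \<in> \<Omega> \<Longrightarrow> (\<lambda>k. dpart (u k) \<beta> x) \<longlonglongrightarrow> dpart g \<beta> x"
    using main by blast
  show "Ck p \<Omega> g"
  proof (rule CkI)
    fix \<beta> :: "'n list" assume l: "length \<beta> \<le> p"
    obtain G where G: "\<And>x. x \<in> \<Omega> \<Longrightarrow> (\<lambda>k. dpart (u k) \<beta> x) \<longlonglongrightarrow> G x"
        "\<And>x. x \<in> \<Omega> \<Longrightarrow> \<exists>r>0. cball x r \<subseteq> \<Omega> \<and> uniform_limit (cball x r) (\<lambda>k. dpart (u k) \<beta>) G sequentially"
      using loc_cauchy_limit[OF cau[OF l]] by metis
    have eq: "dpart g \<beta> x = G x" if "x \<in> \<Omega>" for x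
      using main[OF l] G(1)[OF that] that LIMSEQ_unique by blast
    have "isCont G x" if x: "x \<in> \<Omega>" for x
    proof -
      obtain r where r: "r > 0" "cball x r \<subseteq> \<Omega>" "uniform_limit (cball x r) (\<lambda>k. dpart (u k) \<beta>) G sequentially"
        using G(2)[OF x] by blast
      have "continuous_on (cball x r) G"
        by (rule uniform_limit_theorem[OF _ r(3)])
          (auto intro!: always_eventually continuous_on_subset[OF Ck_continuous[OF Ck l] r(2)])
      then have "continuous_on (ball x r) G" by (rule continuous_on_subset) auto
      then show ?thesis using r(1) by (simp add: continuous_on_eq_continuous_at)
    qed
    then have "continuous_on \<Omega> G" by (simp add: continuous_at_imp_continuous_on)
    then show "continuous_on \<Omega> (dpart g \<beta>)" by (rule continuous_on_eq) (simp add: eq)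
  next
    fix \<beta> :: "'n list" and i x assume l: "length \<beta> < p" and x: "x \<in> \<Omega>"
    have l': "length (i#\<beta>) \<le> p" using l by simp
    obtain G where G: "\<And>x. x \<in> \<Omega> \<Longrightarrow> (\<lambda>k. dpart (u k) (i#\<beta>) x) \<longlonglongrightarrow> G x"
        "\<And>x. x \<in> \<Omega> \<Longrightarrow> \<exists>r>0. cball x r \<subseteq> \<Omega> \<and> uniform_limit (cball x r) (\<lambda>k. dpart (u k) (i#\<beta>)) G sequentially"
      using loc_cauchy_limit[OF cau[OF l']] by metis
    show "\<exists>D. has_pd (dpart g \<beta>) D i x" using key[OF l x _ G] main[of \<beta>] l by fastforce
  qed
qed

context holder_domain
begin

text \<open>Interpolation between uniform convergence and a uniform Hoelder bound.\<close>
lemma loc_cauchy_next_derivative: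
  fixes u :: "nat \<Rightarrow> real^'n \<Rightarrow> real"
  assumes u: "\<And>k. u k \<in> holder_space s \<Omega>" and N: "\<And>k. holder_norm s \<Omega> (u k) \<le> N"
    and l: "length \<beta> < m" and cau: "loc_cauchy \<Omega> (\<lambda>k. dpart (u k) \<beta>)"
  shows "loc_cauchy \<Omega> (\<lambda>k. dpart (u k) (i#\<beta>))"
  unfolding loc_cauchy_def
proof
  fix x assume x: "x \<in> \<Omega>"
  obtain r where r: "r > 0" "cball x r \<subseteq> \<Omega>"
    "\<And>e. e > 0 \<Longrightarrow> \<exists>M. \<forall>k\<ge>M. \<forall>l\<ge>M. \<forall>y\<in>cball x r. \<bar>dpart (u k) \<beta> y - dpart (u l) \<beta> y\<bar> \<le> e"
    using loc_cauchyE[OF cau x] by blast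
  have N0: "N \<ge> 0" using N holder_norm_nonneg[OF u] order_trans by blast
  define C where "C = 2 * (K * N) + 1"
  have C: "C > 0" using K1 N0 by (simp add: C_def add_nonneg_pos)
  show "\<exists>r>0. cball x r \<subseteq> \<Omega> \<and> (\<forall>e>0. \<exists>M. \<forall>k\<ge>M. \<forall>l\<ge>M. \<forall>y\<in>cball x r.
     \<bar>dpart (u k) (i#\<beta>) y - dpart (u l) (i#\<beta>) y\<bar> \<le> e)"
  proof (intro exI[of _ "r/2"] conjI allI impI)
    show "cball x (r/2) \<subseteq> \<Omega>" using r by (auto intro!: subsetD[OF r(2)])
    fix e :: real assume e: "e > 0"
    \<comment> \<open>The step balances two errors. It is short enough for the Hoelder bound to
      contribute at most \<open>e / 2\<close>; the Cauchy estimate for order \<open>\<beta>\<close>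
      is then asked to be \<open>e * t / 4\<close>, which after division by \<open>t\<close>
      contributes the other half.\<close>
    define t where "t = min (r/2) ((e / (2 * C)) powr (1 / \<alpha>))"
    have t: "t > 0" "t \<le> r/2" using r e C by (auto simp: t_def)
    have "t powr \<alpha> \<le> ((e / (2 * C)) powr (1 / \<alpha>)) powr \<alpha>"
      using t \<alpha> by (intro powr_mono2) (auto simp: t_def)
    also have "\<dots> = e / (2 * C)" using e C \<alpha> by (simp add: powr_powr)
    finally have "C * t powr \<alpha> \<le> C * (e / (2 * C))" using C by (intro mult_left_mono) auto
    then have te: "C * t powr \<alpha> \<le> e / 2" using C by simp
    obtain M where M: "\<And>k l y. k \<ge> M \<Longrightarrow> l \<ge> M \<Longrightarrow> y \<in> cball x r \<Longrightarrow> \<bar>dpart (u k) \<beta> y - dpart (u l) \<beta> y\<bar> \<le> e * t / 4"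
      using r(3)[of "e * t / 4"] e t by (metis mult_pos_pos divide_pos_pos zero_less_numeral)
    show "\<exists>M. \<forall>k\<ge>M. \<forall>l\<ge>M. \<forall>y\<in>cball x (r/2). \<bar>dpart (u k) (i#\<beta>) y - dpart (u l) (i#\<beta>) y\<bar> \<le> e"
    proof (intro exI[of _ M] allI impI ballI)
      fix k k' y assume kl: "k \<ge> M" "k' \<ge> M" and y: "y \<in> cball x (r/2)"
      define w where "w z = dpart (u k) \<beta> z - dpart (u k') \<beta> z" for z
      define W where "W z = dpart (u k) (i#\<beta>) z - dpart (u k') (i#\<beta>) z" for z
      have yr: "y \<in> cball x r" using y r by auto
      have ytr: "y + t *\<^sub>R axis i 1 \<in> cball x r"
      proof -
        have "norm (x - (y + t *\<^sub>R axis i 1)) \<le> norm (x - y) + norm (t *\<^sub>R axis i (1::real) :: real^'n)"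
          using norm_triangle_ineq4[of "x - y" "t *\<^sub>R axis i 1"] by (simp add: diff_diff_eq)
        then show ?thesis using y t by (simp add: dist_norm)
      qed
      have pd: "has_pd w (W z) i z" if "z \<in> cball x r" for z
        unfolding w_def[abs_def] W_def using that r(2)
        by (intro has_pd_diff Ck_has_pd[OF holder_space_Ck[OF u] l]) auto
      obtain z where z: "z \<in> cball x r" "norm (z - y) \<le> \<bar>t\<bar>" "w (y + t *\<^sub>R axis i 1) - w y = t * W z"
        using has_pd_mvt[OF convex_cball yr ytr pd] by blast
      have "\<bar>w (y + t *\<^sub>R axis i 1)\<bar> \<le> e * t / 4" "\<bar>w y\<bar> \<le> e * t / 4"
        unfolding w_def using M[OF kl yr] M[OF kl ytr] by auto
      then have "\<bar>w (y + t *\<^sub>R axis i 1) - w y\<bar> \<le> e * t / 2" by linarith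
      then have "\<bar>t * W z\<bar> \<le> t * (e / 2)" unfolding z(3) by (simp add: mult.commute)
      then have Wz: "\<bar>W z\<bar> \<le> e / 2" using t by (simp add: abs_mult)
      have hol: "\<bar>dpart (u k) (i#\<beta>) z - dpart (u k) (i#\<beta>) y\<bar> \<le> K * N * t powr \<alpha>" for k
      proof -
        have "\<bar>dpart (u k) (i#\<beta>) z - dpart (u k) (i#\<beta>) y\<bar> \<le> K * N * dist z y powr \<alpha>"
          using l by (intro holder_modulus[OF u N _ convex_cball r(2) z(1) yr]) auto
        also have "\<dots> \<le> K * N * t powr \<alpha>"
          using z(2) t \<alpha> K1 N0 by (intro mult_left_mono powr_mono2) (auto simp: dist_norm)
        finally show ?thesis .
      qed
      have "\<bar>W z - W y\<bar> \<le> 2 * (K * N) * t powr \<alpha>"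
        using hol[of k] hol[of k'] unfolding W_def by linarith
      also have "\<dots> \<le> C * t powr \<alpha>" by (intro mult_right_mono) (auto simp: C_def)
      finally have "\<bar>W y\<bar> \<le> e" using Wz te by linarith
      then show "\<bar>dpart (u k) (i#\<beta>) y - dpart (u k') (i#\<beta>) y\<bar> \<le> e" by (simp only: W_def)
    qed
  qed (use r in auto)
qed

text \<open>The bound must survive with the same \<open>N\<close>, as uniqueness holds only in the
  ball of radius \<open>C * \<delta>0\<close>. The norm is a finite sum of suprema, so each is
  nearly attained at fixed points, and there the finite sum converges.\<close>

lemma holder_limit:
  fixes u :: "nat \<Rightarrow> real^'n \<Rightarrow> real"
  assumes u: "\<And>k. u k \<in> holder_space s \<Omega>" and N: "\<And>k. holder_norm s \<Omega> (u k) \<le> N"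
    and Ck: "Ck m \<Omega> g" and cont: "continuous_on (closure \<Omega>) g"
    and lim: "\<And>\<beta> x. length \<beta> \<le> m \<Longrightarrow> x \<in> \<Omega> \<Longrightarrow> (\<lambda>k. dpart (u k) \<beta> x) \<longlonglongrightarrow> dpart g \<beta> x"
  shows "g \<in> holder_space s \<Omega>" "holder_norm s \<Omega> g \<le> N"
proof -
  have b1: "\<bar>dpart g \<beta> x\<bar> \<le> N" if "length \<beta> \<le> m" "x \<in> \<Omega>" for \<beta> x
  proof (rule tendsto_upperbound[OF tendsto_rabs[OF lim[OF that]]])
    show "\<forall>\<^sub>F k in sequentially. \<bar>dpart (u k) \<beta> x\<bar> \<le> N"
      using dpart_le_holder_norm[OF u that] N order_trans by (intro always_eventually) blast
  qed simp
  have b2: "z \<le> N" if l: "length \<beta> = m" and z: "z \<in> hquot \<alpha> \<Omega> (dpart g \<beta>)" for \<beta> z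
  proof -
    obtain x y where xy: "x \<in> \<Omega>" "y \<in> \<Omega>" "x \<noteq> y" "z = \<bar>dpart g \<beta> x - dpart g \<beta> y\<bar> / dist x y powr \<alpha>"
      using z unfolding hquot_def by blast
    have "\<bar>dpart g \<beta> x - dpart g \<beta> y\<bar> \<le> N * dist x y powr \<alpha>"
    proof (rule tendsto_upperbound[OF tendsto_rabs[OF tendsto_diff[OF lim lim]]])
      show "\<forall>\<^sub>F k in sequentially. \<bar>dpart (u k) \<beta> x - dpart (u k) \<beta> y\<bar> \<le> N * dist x y powr \<alpha>"
      proof (intro always_eventually allI)
        fix k
        have "\<bar>dpart (u k) \<beta> x - dpart (u k) \<beta> y\<bar> \<le> holder_norm s \<Omega> (u k) * dist x y powr \<alpha>"
          by (rule hquot_le_holder_norm[OF u l xy(1,2)])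
        also have "\<dots> \<le> N * dist x y powr \<alpha>" by (intro mult_right_mono N) auto
        finally show "\<bar>dpart (u k) \<beta> x - dpart (u k) \<beta> y\<bar> \<le> N * dist x y powr \<alpha>" .
      qed
    qed (use l xy in auto)
    then show ?thesis using xy by (simp add: pos_divide_le_eq)
  qed
  show gs: "g \<in> holder_space s \<Omega>"
    unfolding holder_space_def m_def[symmetric] \<alpha>_def[symmetric]
  proof (intro CollectI conjI allI impI)
    show "bounded (dpart g \<beta> ` \<Omega>)" if "length \<beta> \<le> m" for \<beta>
      unfolding bounded_iff using b1[OF that] by (intro exI[of _ N]) auto
    show "bdd_above (hquot \<alpha> \<Omega> (dpart g \<beta>))" if "length \<beta> = m" for \<beta>
      using b2[OF that] by (intro bdd_aboveI[of _ N]) auto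
  qed (use Ck cont in auto)
  let ?A = "{\<beta> :: 'n list. length \<beta> \<le> m}" and ?B = "{\<beta> :: 'n list. length \<beta> = m}"
  show "holder_norm s \<Omega> g \<le> N"
  proof (rule field_le_epsilon)
    fix e :: real assume e: "e > 0"
    define e' where "e' = e / (card ?A + card ?B + 1)"
    have e': "e' > 0" unfolding e'_def using e by (intro divide_pos_pos) auto
    have "\<forall>\<beta>\<in>?A. \<exists>x\<in>\<Omega>. (SUP x\<in>\<Omega>. \<bar>dpart g \<beta> x\<bar>) - e' < \<bar>dpart g \<beta> x\<bar>"
    proof
      fix \<beta> :: "'n list" assume "\<beta> \<in> ?A"
      then have "bdd_above ((\<lambda>x. \<bar>dpart g \<beta> x\<bar>) ` \<Omega>)" using holder_space_bdd[OF gs] by auto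
      then show "\<exists>x\<in>\<Omega>. (SUP x\<in>\<Omega>. \<bar>dpart g \<beta> x\<bar>) - e' < \<bar>dpart g \<beta> x\<bar>"
        using less_cSUP_iff[OF ne, of "\<lambda>x. \<bar>dpart g \<beta> x\<bar>" "(SUP x\<in>\<Omega>. \<bar>dpart g \<beta> x\<bar>) - e'"] e' by auto
    qed
    then obtain X where X: "\<And>\<beta>. length \<beta> \<le> m \<Longrightarrow> X \<beta> \<in> \<Omega>"
      "\<And>\<beta>. length \<beta> \<le> m \<Longrightarrow> (SUP x\<in>\<Omega>. \<bar>dpart g \<beta> x\<bar>) \<le> \<bar>dpart g \<beta> (X \<beta>)\<bar> + e'"
      unfolding Ball_def Bex_def mem_Collect_eq by (metis diff_less_eq less_imp_le)
    have "\<forall>\<beta>\<in>?B. \<exists>y z. y \<in> \<Omega> \<and> z \<in> \<Omega> \<and> y \<noteq> z \<and>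
       Sup (hquot \<alpha> \<Omega> (dpart g \<beta>)) \<le> \<bar>dpart g \<beta> y - dpart g \<beta> z\<bar> / dist y z powr \<alpha> + e'"
    proof
      fix \<beta> :: "'n list" assume "\<beta> \<in> ?B"
      then have "bdd_above (hquot \<alpha> \<Omega> (dpart g \<beta>))" using holder_space_bdd_hquot[OF gs] by auto
      then obtain q where "q \<in> hquot \<alpha> \<Omega> (dpart g \<beta>)" "Sup (hquot \<alpha> \<Omega> (dpart g \<beta>)) - e' < q"
        using less_cSup_iff[OF hquot_nonempty, of \<alpha> "dpart g \<beta>" "Sup (hquot \<alpha> \<Omega> (dpart g \<beta>)) - e'"] e' by auto
      then show "\<exists>y z. y \<in> \<Omega> \<and> z \<in> \<Omega> \<and> y \<noteq> z \<and>
       Sup (hquot \<alpha> \<Omega> (dpart g \<beta>)) \<le> \<bar>dpart g \<beta> y - dpart g \<beta> z\<bar> / dist y z powr \<alpha> + e'"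
        unfolding hquot_def by fastforce
    qed
    then obtain Y Z where YZ: "\<And>\<beta>. length \<beta> = m \<Longrightarrow> Y \<beta> \<in> \<Omega> \<and> Z \<beta> \<in> \<Omega> \<and> Y \<beta> \<noteq> Z \<beta> \<and>
       Sup (hquot \<alpha> \<Omega> (dpart g \<beta>)) \<le> \<bar>dpart g \<beta> (Y \<beta>) - dpart g \<beta> (Z \<beta>)\<bar> / dist (Y \<beta>) (Z \<beta>) powr \<alpha> + e'"
      unfolding Ball_def mem_Collect_eq by metis
    define S where "S v = (\<Sum>\<beta>\<in>?A. \<bar>dpart v \<beta> (X \<beta>)\<bar>) +
      (\<Sum>\<beta>\<in>?B. \<bar>dpart v \<beta> (Y \<beta>) - dpart v \<beta> (Z \<beta>)\<bar> / dist (Y \<beta>) (Z \<beta>) powr \<alpha>)" for v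
    have "(\<lambda>k. S (u k)) \<longlonglongrightarrow> S g"
      unfolding S_def using X YZ
      by (intro tendsto_add tendsto_sum tendsto_divide tendsto_rabs tendsto_diff lim tendsto_const) auto
    moreover have "S (u k) \<le> N" for k
    proof -
      have "S (u k) \<le> holder_norm s \<Omega> (u k)"
        unfolding S_def holder_norm_eq
      proof (intro add_mono sum_mono)
        fix \<beta> :: "'n list" assume "\<beta> \<in> ?A"
        then show "\<bar>dpart (u k) \<beta> (X \<beta>)\<bar> \<le> (SUP x\<in>\<Omega>. \<bar>dpart (u k) \<beta> x\<bar>)"
          using X by (intro cSUP_upper holder_space_bdd[OF u]) auto
      next
        fix \<beta> :: "'n list" assume "\<beta> \<in> ?B"
        then show "\<bar>dpart (u k) \<beta> (Y \<beta>) - dpart (u k) \<beta> (Z \<beta>)\<bar> / dist (Y \<beta>) (Z \<beta>) powr \<alpha> \<le> Sup (hquot \<alpha> \<Omega> (dpart (u k) \<beta>))"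
          using YZ[of \<beta>] by (intro cSup_upper holder_space_bdd_hquot[OF u]) (auto simp: hquot_def)
      qed
      then show ?thesis using N order_trans by blast
    qed
    ultimately have SN: "S g \<le> N" by (intro tendsto_upperbound[of "\<lambda>k. S (u k)"]) auto
    have "holder_norm s \<Omega> g \<le> (\<Sum>\<beta>\<in>?A. \<bar>dpart g \<beta> (X \<beta>)\<bar> + e') +
      (\<Sum>\<beta>\<in>?B. \<bar>dpart g \<beta> (Y \<beta>) - dpart g \<beta> (Z \<beta>)\<bar> / dist (Y \<beta>) (Z \<beta>) powr \<alpha> + e')"
      unfolding holder_norm_eq using X YZ by (intro add_mono sum_mono) auto
    also have "\<dots> = S g + (card ?A + card ?B) * e'" by (simp add: S_def sum.distrib algebra_simps)
    also have "(card ?A + card ?B) * e' \<le> e"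
      using e by (simp add: e'_def field_simps)
    finally show "holder_norm s \<Omega> g \<le> N + e" using SN by linarith
  qed
qed

end

section \<open>Compactness of small solutions\<close>

lemma dpart_zero: "dpart (\<lambda>x. 0) \<beta> = (\<lambda>x. 0)"
  by (induction \<beta>) simp_all

context holder_domain
begin

section \<open>Scaling of Hoelder functions and of boundary data\<close>

lemma dpart_scale:
  assumes "u \<in> holder_space s \<Omega>" "length \<beta> \<le> m" "x \<in> \<Omega>"
  shows "dpart (\<lambda>x. c * u x) \<beta> x = c * dpart u \<beta> x"
  using dpart_combination[OF op holder_space_Ck[OF assms(1)] holder_space_Ck[OF assms(1)] assms(2,3), of c 0]
  by simp

lemma holder_scale:
  assumes u: "u \<in> holder_space s \<Omega>"
  shows "(\<lambda>x. c * u x) \<in> holder_space s \<Omega>"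
    and "holder_norm s \<Omega> (\<lambda>x. c * u x) \<le> \<bar>c\<bar> * holder_norm s \<Omega> u"
proof -
  have b1: "\<bar>dpart (\<lambda>x. c * u x) \<beta> x\<bar> \<le> \<bar>c\<bar> * (SUP x\<in>\<Omega>. \<bar>dpart u \<beta> x\<bar>)" if "length \<beta> \<le> m" "x \<in> \<Omega>" for \<beta> x
    unfolding dpart_scale[OF u that] abs_mult
    by (intro mult_left_mono cSUP_upper that holder_space_bdd[OF u]) auto
  have b2: "z \<le> \<bar>c\<bar> * Sup (hquot \<alpha> \<Omega> (dpart u \<beta>))"
    if l: "length \<beta> = m" and z: "z \<in> hquot \<alpha> \<Omega> (dpart (\<lambda>x. c * u x) \<beta>)" for \<beta> z
  proof -
    obtain x y where xy: "x \<in> \<Omega>" "y \<in> \<Omega>" "x \<noteq> y"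
      "z = \<bar>dpart (\<lambda>x. c * u x) \<beta> x - dpart (\<lambda>x. c * u x) \<beta> y\<bar> / dist x y powr \<alpha>"
      using z unfolding hquot_def by blast
    have "z = \<bar>c\<bar> * (\<bar>dpart u \<beta> x - dpart u \<beta> y\<bar> / dist x y powr \<alpha>)"
      using l xy by (simp add: dpart_scale[OF u] abs_mult right_diff_distrib[symmetric])
    also have "\<dots> \<le> \<bar>c\<bar> * Sup (hquot \<alpha> \<Omega> (dpart u \<beta>))"
      using xy by (intro mult_left_mono cSup_upper holder_space_bdd_hquot[OF u l]) (auto simp: hquot_def)
    finally show ?thesis .
  qed
  show "(\<lambda>x. c * u x) \<in> holder_space s \<Omega>"
    unfolding holder_space_def m_def[symmetric] \<alpha>_def[symmetric]
  proof (intro CollectI conjI allI impI)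
    show "continuous_on (closure \<Omega>) (\<lambda>x. c * u x)"
      using u by (auto simp: holder_space_def intro!: continuous_intros)
    show "Ck m \<Omega> (\<lambda>x. c * u x)"
      using Ck_combination[OF op holder_space_Ck[OF u] holder_space_Ck[OF u], of c 0] by simp
    show "bounded (dpart (\<lambda>x. c * u x) \<beta> ` \<Omega>)" if "length \<beta> \<le> m" for \<beta>
      unfolding bounded_iff using b1[OF that] by (intro exI[of _ "\<bar>c\<bar> * (SUP x\<in>\<Omega>. \<bar>dpart u \<beta> x\<bar>)"]) auto
    show "bdd_above (hquot \<alpha> \<Omega> (dpart (\<lambda>x. c * u x) \<beta>))" if "length \<beta> = m" for \<beta>
      using b2[OF that] by (rule bdd_aboveI)
  qed
  have "holder_norm s \<Omega> (\<lambda>x. c * u x) \<le>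
      (\<Sum>\<beta>\<in>{\<beta>. length \<beta> \<le> m}. \<bar>c\<bar> * (SUP x\<in>\<Omega>. \<bar>dpart u \<beta> x\<bar>)) +
      (\<Sum>\<beta>\<in>{\<beta>. length \<beta> = m}. \<bar>c\<bar> * Sup (hquot \<alpha> \<Omega> (dpart u \<beta>)))"
    unfolding holder_norm_eq
    by (intro add_mono sum_mono cSUP_least cSup_least ne hquot_nonempty) (auto intro: b1 b2)
  then show "holder_norm s \<Omega> (\<lambda>x. c * u x) \<le> \<bar>c\<bar> * holder_norm s \<Omega> u"
    by (simp add: holder_norm_eq sum_distrib_left algebra_simps)
qed

text \<open>The scaled function is itself an extension of the boundary data, so it competes in the
  infimum.\<close>

lemma bdry_holder_scale:
  assumes h: "h \<in> holder_space s \<Omega>"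
  shows "(\<lambda>x. c * h x) \<in> bdry_holder_space s \<Omega>"
    and "bdry_holder_norm s \<Omega> (\<lambda>x. c * h x) \<le> \<bar>c\<bar> * holder_norm s \<Omega> h"
proof -
  show "(\<lambda>x. c * h x) \<in> bdry_holder_space s \<Omega>"
    unfolding bdry_holder_space_def using holder_scale(1)[OF h, of c] by auto
  have "bdry_holder_norm s \<Omega> (\<lambda>x. c * h x) \<le> holder_norm s \<Omega> (\<lambda>x. c * h x)"
    unfolding bdry_holder_norm_def
  proof (rule cInf_lower)
    show "bdd_below {holder_norm s \<Omega> F |F. F \<in> holder_space s \<Omega> \<and> (\<forall>x\<in>frontier \<Omega>. F x = c * h x)}"
      by (rule bdd_belowI[of _ 0]) (auto intro: holder_norm_nonneg)
  qed (use holder_scale(1)[OF h, of c] in auto)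
  then show "bdry_holder_norm s \<Omega> (\<lambda>x. c * h x) \<le> \<bar>c\<bar> * holder_norm s \<Omega> h"
    using holder_scale(2)[OF h, of c] by linarith
qed

text \<open>The point \<open>x\<close> is approached along a radius of the touching ball, where the
  interior modulus applies; continuity on the closure gives the limit.\<close>

lemma boundary_modulus:
  assumes u: "u \<in> holder_space s \<Omega>" and N: "holder_norm s \<Omega> u \<le> N"
    and x: "x \<in> frontier \<Omega>" and ball: "ball y (dist y x) \<subseteq> \<Omega>" and d: "dist y x > 0"
  shows "\<bar>u y - u x\<bar> \<le> K * N * dist y x powr \<alpha>"
proof -
  have N0: "N \<ge> 0" using N holder_norm_nonneg[OF u] by simp
  let ?z = "\<lambda>t. x + t *\<^sub>R (y - x)"
  have dz: "dist y (?z t) = (1 - t) * dist y x" if "0 < t" "t < 1" for t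
  proof -
    have "y - ?z t = (1 - t) *\<^sub>R (y - x)" by (simp add: algebra_simps)
    then show ?thesis using that by (simp add: dist_norm)
  qed
  have zin: "?z t \<in> ball y (dist y x)" if "0 < t" "t < 1" for t
    using dz[OF that] d that by (simp add: mult_less_cancel_right1)
  have cu: "continuous_on (closure \<Omega>) u" using u by (simp add: holder_space_def)
  have "((\<lambda>t. u (?z t)) \<longlongrightarrow> u x) (at_right 0)"
  proof -
    have "(u \<longlongrightarrow> u x) (at x within closure \<Omega>)"
      using cu frontier_in_closure[OF x] by (auto simp: continuous_on_def)
    moreover have "filterlim ?z (at x within closure \<Omega>) (at_right 0)"
      unfolding filterlim_at
    proof
      have "(?z \<longlongrightarrow> x + 0 *\<^sub>R (y - x)) (at_right 0)" by (intro tendsto_intros)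
      then show "(?z \<longlongrightarrow> x) (at_right 0)" by simp
      show "\<forall>\<^sub>F t in at_right 0. ?z t \<in> closure \<Omega> \<and> ?z t \<noteq> x"
        unfolding eventually_at_right_field
      proof (intro exI[of _ 1] conjI allI impI)
        fix t :: real assume t: "0 < t" "t < 1"
        show "?z t \<in> closure \<Omega>" using zin[OF t] ball closure_subset by blast
        show "?z t \<noteq> x" using t d by auto
      qed simp
    qed
    ultimately show ?thesis by (rule filterlim_compose)
  qed
  then have "((\<lambda>t. \<bar>u y - u (?z t)\<bar>) \<longlongrightarrow> \<bar>u y - u x\<bar>) (at_right 0)"
    by (intro tendsto_intros)
  then show ?thesis
  proof (rule tendsto_upperbound)
    show "\<forall>\<^sub>F t in at_right 0. \<bar>u y - u (?z t)\<bar> \<le> K * N * dist y x powr \<alpha>"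
      unfolding eventually_at_right_field
    proof (intro exI[of _ 1] conjI allI impI)
      fix t :: real assume t: "0 < t" "t < 1"
      have "\<bar>dpart u [] y - dpart u [] (?z t)\<bar> \<le> K * N * dist y (?z t) powr \<alpha>"
        by (rule holder_modulus[OF u N _ convex_ball ball]) (use zin[OF t] d in auto)
      also have "\<dots> \<le> K * N * dist y x powr \<alpha>"
        unfolding dz[OF t] using t d K1 N0 \<alpha>
        by (intro mult_left_mono powr_mono2) (auto simp: mult_le_cancel_right1)
      finally show "\<bar>u y - u (?z t)\<bar> \<le> K * N * dist y x powr \<alpha>" by simp
    qed simp
  qed simp
qed

text \<open>Equicontinuity up to the boundary is delicate, since nearby points of \<Omega> need not
  be joined by a segment inside. After the boundary data are subtracted, the functions vanish on the
  frontier, so near it smallness replaces the comparison of two points.\<close>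

lemma holder_bounded_subsequence:
  assumes u: "\<And>k. u k \<in> holder_space s \<Omega>" and N: "\<And>k. holder_norm s \<Omega> (u k) \<le> N"
    and h: "h \<in> holder_space s \<Omega>" and eps: "eps \<longlonglongrightarrow> (0::real)"
    and bv: "\<And>k x. x \<in> frontier \<Omega> \<Longrightarrow> u k x = eps k * h x"
  obtains r g where "strict_mono (r :: nat \<Rightarrow> nat)" "continuous_on (closure \<Omega>) g"
    "\<And>x. x \<in> frontier \<Omega> \<Longrightarrow> g x = 0"
    "\<And>e. e > 0 \<Longrightarrow> \<exists>M. \<forall>j\<ge>M. \<forall>x\<in>closure \<Omega>. \<bar>u (r j) x - g x\<bar> \<le> e"
proof -
  define Nh where "Nh = holder_norm s \<Omega> h"
  have Nh: "Nh \<ge> 0" "holder_norm s \<Omega> h \<le> Nh" using holder_norm_nonneg[OF h] by (auto simp: Nh_def)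
  have N0: "N \<ge> 0" using N holder_norm_nonneg[OF u] order_trans by blast
  obtain E where E: "E > 0" "\<And>k. \<bar>eps k\<bar> \<le> E"
    using Bseq_eq_bounded[of eps] convergent_imp_Bseq[of eps] eps unfolding Bseq_def convergent_def by auto
  define F where "F k x = u k x - eps k * h x" for k x
  define L where "L = K * N + E * (K * Nh) + 1"
  have L: "L > 0" using K1 N0 Nh E unfolding L_def by (intro add_nonneg_pos add_nonneg_nonneg) auto
  have Fmod: "\<bar>F k x - F k y\<bar> \<le> L * d powr \<alpha>"
    if "\<bar>u k x - u k y\<bar> \<le> K * N * d powr \<alpha>" "\<bar>h x - h y\<bar> \<le> K * Nh * d powr \<alpha>" for k x y d
  proof -
    have "\<bar>eps k * (h x - h y)\<bar> \<le> E * (K * Nh * d powr \<alpha>)"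
      unfolding abs_mult using E that(2) by (intro mult_mono) auto
    moreover have "F k x - F k y = (u k x - u k y) - eps k * (h x - h y)" by (simp add: F_def algebra_simps)
    ultimately have "\<bar>F k x - F k y\<bar> \<le> K * N * d powr \<alpha> + E * (K * Nh * d powr \<alpha>)" using that(1) by linarith
    also have "\<dots> \<le> L * d powr \<alpha>" by (simp add: L_def algebra_simps)
    finally show ?thesis .
  qed
  have Fint: "\<bar>F k x - F k y\<bar> \<le> L * dist x y powr \<alpha>" if "x \<in> ball x r" "y \<in> ball x r" "ball x r \<subseteq> \<Omega>" for k x y r
    using holder_modulus[OF u N _ convex_ball that(3,1,2), of "[]" k]
      holder_modulus[OF h Nh(2) _ convex_ball that(3,1,2), of "[]"] by (intro Fmod) auto
  have Fbd: "F k x = 0" if "x \<in> frontier \<Omega>" for k x using bv[OF that] by (simp add: F_def)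
  have Fnear: "\<bar>F k y\<bar> \<le> L * infdist y (frontier \<Omega>) powr \<alpha>" if y: "y \<in> \<Omega>" for k y
  proof -
    obtain x where x: "x \<in> frontier \<Omega>" "dist y x = infdist y (frontier \<Omega>)" "dist y x > 0" "ball y (dist y x) \<subseteq> \<Omega>"
      using nearest_frontier_point[OF y] by blast
    have "\<bar>F k y - F k x\<bar> \<le> L * dist y x powr \<alpha>"
      using boundary_modulus[OF u N x(1,4,3)] boundary_modulus[OF h Nh(2) x(1,4,3)] by (rule Fmod)
    then show ?thesis using Fbd[OF x(1)] x(2) by simp
  qed
  have comp: "compact (closure \<Omega>)" using bd by simp
  have ub: "\<bar>u k x\<bar> \<le> N" "\<bar>h x\<bar> \<le> Nh" if "x \<in> \<Omega>" for k x
    using dpart_le_holder_norm[OF u, of "[]" x k] dpart_le_holder_norm[OF h, of "[]" x] that N[of k] by (auto simp: Nh_def)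
  obtain g r where g: "continuous_on (closure \<Omega>) g" and r: "strict_mono (r :: nat \<Rightarrow> nat)"
    and lim: "\<And>e. 0 < e \<Longrightarrow> \<exists>M. \<forall>n x. n \<ge> M \<and> x \<in> closure \<Omega> \<longrightarrow> norm (F (r n) x - g x) < e"
  proof (rule Arzela_Ascoli[OF comp, of F "N + E * Nh"])
    fix k x assume x: "x \<in> closure \<Omega>"
    show "norm (F k x) \<le> N + E * Nh"
    proof (cases "x \<in> \<Omega>")
      case True
      have "\<bar>eps k * h x\<bar> \<le> E * Nh" unfolding abs_mult using E ub(2)[OF True] by (intro mult_mono) auto
      then show ?thesis using ub(1)[OF True, of k] by (simp add: F_def)
    next
      case False
      then show ?thesis using Fbd closure_cases x N0 E Nh by simp
    qed
  next
    fix x and e :: real assume x: "x \<in> closure \<Omega>" and e: "0 < e"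
    define \<delta> where "\<delta> = (e / (2 * L)) powr (1 / \<alpha>)"
    have \<delta>: "\<delta> > 0" using e L by (simp add: \<delta>_def)
    have small: "L * d powr \<alpha> < e" if "0 \<le> d" "d < \<delta>" for d
    proof -
      have "d powr \<alpha> \<le> \<delta> powr \<alpha>" using that \<alpha> by (intro powr_mono2) auto
      also have "\<dots> = e / (2 * L)" using e L \<alpha> by (simp add: \<delta>_def powr_powr)
      finally have "L * d powr \<alpha> \<le> L * (e / (2 * L))" using L by (intro mult_left_mono) auto
      also have "\<dots> < e" using L e by simp
      finally show ?thesis .
    qed
    show "\<exists>d>0. \<forall>n y. y \<in> closure \<Omega> \<and> norm (x - y) < d \<longrightarrow> norm (F n x - F n y) < e"
    proof (cases "x \<in> \<Omega>")
      case True
      then obtain \<rho> where \<rho>: "\<rho> > 0" "ball x \<rho> \<subseteq> \<Omega>" using op open_contains_ball by metis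
      show ?thesis
      proof (intro exI[of _ "min \<rho> \<delta>"] conjI allI impI)
        fix k y assume "y \<in> closure \<Omega> \<and> norm (x - y) < min \<rho> \<delta>"
        then have y: "y \<in> ball x \<rho>" "dist x y < \<delta>" by (auto simp: dist_norm)
        show "norm (F k x - F k y) < e"
          using Fint[of x \<rho> y k] \<rho> y small[of "dist x y"] by simp
      qed (use \<rho> \<delta> in auto)
    next
      case False
      then have xf: "x \<in> frontier \<Omega>" using x closure_cases by blast
      show ?thesis
      proof (intro exI[of _ \<delta>] conjI allI impI \<delta>)
        fix k y assume y: "y \<in> closure \<Omega> \<and> norm (x - y) < \<delta>"
        show "norm (F k x - F k y) < e"
        proof (cases "y \<in> \<Omega>")
          case True
          have "infdist y (frontier \<Omega>) \<le> dist y x" by (rule infdist_le[OF xf])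
          also have "\<dots> < \<delta>" using y by (simp add: dist_norm norm_minus_commute)
          finally show ?thesis using Fnear[OF True, of k] small[of "infdist y (frontier \<Omega>)"] Fbd[OF xf] by (simp add: infdist_nonneg)
        next
          case False
          then show ?thesis using Fbd closure_cases y xf e by simp
        qed
      qed
    qed
  qed (use that in blast)
  have hb: "\<bar>h x\<bar> \<le> Nh" if "x \<in> closure \<Omega>" for x
  proof -
    have "continuous_on (closure \<Omega>) (\<lambda>x. \<bar>h x\<bar>)" using h by (auto simp: holder_space_def intro!: continuous_intros)
    then show ?thesis using continuous_le_on_closure[of \<Omega> "\<lambda>x. \<bar>h x\<bar>" x Nh] that ub(2) by blast
  qed
  show ?thesis
  proof (rule that[OF r g])
    fix x assume x: "x \<in> frontier \<Omega>"
    have "\<bar>g x\<bar> \<le> 0"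
    proof (rule field_le_epsilon)
      fix e :: real assume "e > 0"
      then obtain M where "norm (F (r M) x - g x) < e" using lim[of e] frontier_in_closure[OF x] by blast
      then show "\<bar>g x\<bar> \<le> 0 + e" using Fbd[OF x] by simp
    qed
    then show "g x = 0" by simp
  next
    fix e :: real assume e: "e > 0"
    \<comment> \<open>The subtracted data \<open>eps k * h\<close> tend to 0 uniformly, so
      \<open>u (r j)\<close> has the same limit as \<open>F (r j)\<close>.\<close>
    obtain M1 where M1: "\<And>n x. n \<ge> M1 \<Longrightarrow> x \<in> closure \<Omega> \<Longrightarrow> norm (F (r n) x - g x) < e / 2"
      using lim[of "e/2"] e by (metis half_gt_zero)
    have "\<forall>\<^sub>F k in sequentially. \<bar>eps k\<bar> < e / (2 * (Nh + 1))"
      using e Nh tendsto_rabs[OF eps] by (intro order_tendstoD(2)[of "\<lambda>k. \<bar>eps k\<bar>" 0]) auto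
    then obtain M2 where M2: "\<And>k. k \<ge> M2 \<Longrightarrow> \<bar>eps k\<bar> < e / (2 * (Nh + 1))" unfolding eventually_sequentially by blast
    show "\<exists>M. \<forall>j\<ge>M. \<forall>x\<in>closure \<Omega>. \<bar>u (r j) x - g x\<bar> \<le> e"
    proof (intro exI[of _ "max M1 M2"] allI impI ballI)
      fix j x assume j: "j \<ge> max M1 M2" and x: "x \<in> closure \<Omega>"
      have "r j \<ge> M2" using j seq_suble[OF r, of j] by linarith
      then have "\<bar>eps (r j) * h x\<bar> \<le> (e / (2 * (Nh + 1))) * (Nh + 1)"
        unfolding abs_mult using M2[of "r j"] hb[OF x] Nh e by (intro mult_mono) auto
      also have "\<dots> = e / 2" using Nh by (simp add: field_simps)
      finally have "\<bar>eps (r j) * h x\<bar> \<le> e / 2" .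
      moreover have "\<bar>F (r j) x - g x\<bar> < e / 2" using M1[of j x] j x by simp
      ultimately show "\<bar>u (r j) x - g x\<bar> \<le> e" unfolding F_def by linarith
    qed
  qed
qed

text \<open>Orders up to \<open>m\<close> converge by interpolation. If \<open>s < 2\<close> this
  stops at first derivatives, and the equation supplies the second ones; with them the limit
  satisfies the equation classically, as \<open>small_sol\<close> demands.\<close>

theorem small_solutions_subsequence_to_0:
  assumes wp: "well_posed s \<Omega> q \<delta>0 C" and q: "smooth_on \<Omega> q"
    and h: "h \<in> holder_space s \<Omega>" and eps: "eps \<longlonglongrightarrow> (0::real)"
    and sol: "\<And>k. small_sol s \<Omega> q C \<delta>0 (\<lambda>x. eps k * h x) (u k)"
  obtains r where "strict_mono (r :: nat \<Rightarrow> nat)"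
    "\<And>e. e > 0 \<Longrightarrow> \<exists>M. \<forall>j\<ge>M. \<forall>x\<in>closure \<Omega>. \<bar>u (r j) x\<bar> \<le> e"
proof -
  define N where "N = C * \<delta>0"
  have us: "u k \<in> holder_space s \<Omega>" and uN: "holder_norm s \<Omega> (u k) \<le> N" and uC: "Ck 2 \<Omega> (u k)"
    and ue: "\<And>x. x \<in> \<Omega> \<Longrightarrow> laplacian (u k) x + q x * (u k x)\<^sup>2 = 0"
    and ub: "\<And>x. x \<in> frontier \<Omega> \<Longrightarrow> u k x = eps k * h x" for k
    using sol[of k] unfolding small_sol_def N_def by auto
  have \<delta>0: "\<delta>0 > 0" "C > 0" using wp by (auto simp: well_posed_def)
  obtain r g where r: "strict_mono (r :: nat \<Rightarrow> nat)" and gc: "continuous_on (closure \<Omega>) g"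
    and gb: "\<And>x. x \<in> frontier \<Omega> \<Longrightarrow> g x = 0"
    and gl: "\<And>e. e > 0 \<Longrightarrow> \<exists>M. \<forall>j\<ge>M. \<forall>x\<in>closure \<Omega>. \<bar>u (r j) x - g x\<bar> \<le> e"
    using holder_bounded_subsequence[OF us uN h eps ub] by metis
  define v where "v j = u (r j)" for j
  have vs: "v j \<in> holder_space s \<Omega>" and vN: "holder_norm s \<Omega> (v j) \<le> N" and vC: "Ck 2 \<Omega> (v j)" for j
    unfolding v_def by (rule us uN uC)+
  have lim: "(\<lambda>j. v j x) \<longlonglongrightarrow> g x" if "x \<in> \<Omega>" for x
  proof (rule metric_LIMSEQ_I)
    fix e :: real assume "e > 0"
    then obtain M where "\<forall>j\<ge>M. \<forall>x\<in>closure \<Omega>. \<bar>u (r j) x - g x\<bar> \<le> e/2" using gl[of "e/2"] by auto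
    then have "\<forall>j\<ge>M. \<bar>v j x - g x\<bar> \<le> e/2" using that closure_subset[of \<Omega>] by (auto simp: v_def)
    then show "\<exists>M. \<forall>j\<ge>M. dist (v j x) (g x) < e"
      using \<open>e > 0\<close> by (intro exI[of _ M]) (fastforce simp: dist_real_def)
  qed
  have c0: "loc_cauchy \<Omega> v"
    unfolding loc_cauchy_def
  proof
    fix x assume "x \<in> \<Omega>"
    then obtain \<rho> where \<rho>: "\<rho> > 0" "cball x \<rho> \<subseteq> \<Omega>" using op open_contains_cball by metis
    show "\<exists>r>0. cball x r \<subseteq> \<Omega> \<and> (\<forall>e>0. \<exists>M. \<forall>k\<ge>M. \<forall>l\<ge>M. \<forall>y\<in>cball x r. \<bar>v k y - v l y\<bar> \<le> e)"
    proof (intro exI[of _ \<rho>] conjI \<rho> allI impI)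
      fix e :: real assume "e > 0"
      then obtain M where M: "\<And>j x. j \<ge> M \<Longrightarrow> x \<in> closure \<Omega> \<Longrightarrow> \<bar>u (r j) x - g x\<bar> \<le> e/2"
        using gl[of "e/2"] by (metis half_gt_zero)
      show "\<exists>M. \<forall>k\<ge>M. \<forall>l\<ge>M. \<forall>y\<in>cball x \<rho>. \<bar>v k y - v l y\<bar> \<le> e"
      proof (intro exI[of _ M] allI impI ballI)
        fix k l y assume kl: "k \<ge> M" "l \<ge> M" and "y \<in> cball x \<rho>"
        then have "y \<in> closure \<Omega>" using \<rho>(2) closure_subset by blast
        then show "\<bar>v k y - v l y\<bar> \<le> e" using M[OF kl(1), of y] M[OF kl(2), of y] unfolding v_def by linarith
      qed
    qed
  qed
  have cm: "loc_cauchy \<Omega> (\<lambda>k. dpart (v k) \<beta>)" if "length \<beta> \<le> m" for \<beta>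
    using that
  proof (induction \<beta>)
    case Nil
    then show ?case using c0 by simp
  next
    case (Cons i \<beta>)
    then show ?case using loc_cauchy_next_derivative[where u = v and i = i and \<beta> = \<beta>, OF vs vN] by (simp del: dpart.simps)
  qed
  have vb: "\<bar>v k x\<bar> \<le> N" "\<bar>dpart (v k) [i] x\<bar> \<le> N" if "x \<in> \<Omega>" for k i x
    using dpart_le_holder_norm[OF vs, of "[]" x k] dpart_le_holder_norm[OF vs, of "[i]" x k] that vN[of k] m1
    by (auto simp del: dpart.simps(2))
  have q1: "Ck 1 \<Omega> q" using q by (simp add: smooth_on_def)
  \<comment> \<open>Differentiating the right hand side \<open>- q u^2\<close> once involves only
    first derivatives of the solutions, whose convergence is already known.\<close>
  have c2: "loc_cauchy \<Omega> (\<lambda>k. dpart (v k) [i, j])" for i j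
  proof (rule loc_cauchy_second_derivatives[OF op vC])
    let ?F = "\<lambda>k x. (- 1) * (q x * (v k x * v k x))"
    let ?DF = "\<lambda>k x. (- dpart q [i] x) * (v k x * v k x) + (- 2 * q x) * (dpart (v k) [i] x * v k x)"
    show "laplacian (v k) x = ?F k x" if "x \<in> \<Omega>" for k x
      using ue[OF that, of "r k"] by (simp add: v_def power2_eq_square)
    show "has_pd (?F k) (?DF k x) i x" if "x \<in> \<Omega>" for k x
    proof -
      have pv: "has_pd (v k) (dpart (v k) [i] x) i x" using Ck_has_pd[OF vC[of k], of "[]" x i] that by simp
      have pq: "has_pd q (dpart q [i] x) i x" using Ck_has_pd[OF q1, of "[]" x i] that by simp
      have "has_pd (?F k) ((- 1) * (dpart q [i] x * (v k x * v k x)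
          + (dpart (v k) [i] x * v k x + dpart (v k) [i] x * v k x) * q x)) i x"
        by (intro has_pd_cmult has_pd_mult pv pq)
      then show ?thesis by (simp add: algebra_simps del: dpart.simps)
    qed
    show "loc_cauchy \<Omega> (\<lambda>k. dpart (v k) [i])" using cm[of "[i]"] m1 by (simp del: dpart.simps)
    show "loc_cauchy \<Omega> ?DF"
      using vb m1 Ck_continuous[OF q1, of "[]"] Ck_continuous[OF q1, of "[i]"]
      by (intro loc_cauchy_add loc_cauchy_cmult continuous_intros loc_cauchy_mult[where B = N] c0 cm)
        (auto simp del: dpart.simps(2))
  qed
  define p where "p = max m 2"
  have cp: "loc_cauchy \<Omega> (\<lambda>k. dpart (v k) \<beta>)" if "length \<beta> \<le> p" for \<beta>
  proof (cases "length \<beta> \<le> m")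
    case True then show ?thesis by (rule cm)
  next
    case False
    then have "length \<beta> = 2" using that m1 by (auto simp: p_def)
    then obtain i j where "\<beta> = [i, j]" by (auto simp: length_Suc_conv numeral_2_eq_2)
    then show ?thesis using c2 by simp
  qed
  have Cp: "Ck p \<Omega> (v k)" for k
    using holder_space_Ck[OF vs, of k] vC[of k] by (cases "m \<le> 2") (auto simp: p_def max_def)
  have gCp: "Ck p \<Omega> g" and gd: "\<And>\<beta> x. length \<beta> \<le> p \<Longrightarrow> x \<in> \<Omega> \<Longrightarrow> (\<lambda>k. dpart (v k) \<beta> x) \<longlonglongrightarrow> dpart g \<beta> x"
    using Ck_limit[OF op Cp cp lim] by blast+
  have gm: "Ck m \<Omega> g" and g2: "Ck 2 \<Omega> g" using Ck_mono[OF gCp] by (auto simp: p_def)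
  have gh: "g \<in> holder_space s \<Omega>" "holder_norm s \<Omega> g \<le> N"
    by (rule holder_limit[where u = v, OF vs vN gm gc gd]; simp add: p_def)+
  have ge: "laplacian g x + q x * (g x)\<^sup>2 = 0" if x: "x \<in> \<Omega>" for x
  proof -
    have "(\<lambda>k. laplacian (v k) x + q x * (v k x)\<^sup>2) \<longlonglongrightarrow> laplacian g x + q x * (g x)\<^sup>2"
      unfolding laplacian_def
      by (intro tendsto_intros lim x gd) (auto simp: p_def)
    moreover have "laplacian (v k) x + q x * (v k x)\<^sup>2 = 0" for k using ue[OF x] by (simp add: v_def)
    ultimately have "(\<lambda>k. 0) \<longlonglongrightarrow> laplacian g x + q x * (g x)\<^sup>2" by simp
    then show ?thesis using LIMSEQ_unique[OF tendsto_const] by metis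
  qed
  have "small_sol s \<Omega> q C \<delta>0 (\<lambda>x. 0) g"
    unfolding small_sol_def using gh g2 ge gb by (auto simp: N_def)
  \<comment> \<open>The zero function has the same boundary data as \<open>g\<close>, and uniqueness
    makes them equal.\<close>
  moreover have "small_sol s \<Omega> q C \<delta>0 (\<lambda>x. 0) (\<lambda>x. 0)"
    unfolding small_sol_def using holder_scale[OF h, of 0] \<delta>0
    by (auto simp: dpart_zero laplacian_def Ck_def simp del: dpart.simps intro: order_trans)
  moreover have "(\<lambda>x. 0) \<in> bdry_holder_space s \<Omega>" "bdry_holder_norm s \<Omega> (\<lambda>x. 0) < \<delta>0"
    using bdry_holder_scale[OF h, of 0] \<delta>0 by auto
  ultimately have g0: "g x = 0" if "x \<in> closure \<Omega>" for x
    using wp that unfolding well_posed_def by blast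
  show ?thesis
  proof (rule that[OF r])
    fix e :: real assume "e > 0"
    then show "\<exists>M. \<forall>j\<ge>M. \<forall>x\<in>closure \<Omega>. \<bar>u (r j) x\<bar> \<le> e" using gl[of e] g0 by simp
  qed
qed

end

section \<open>Exponential harmonic functions\<close>

text \<open>The real part of \<open>exp ((a + i b) . x + i c)\<close>. The phase \<open>c\<close>
  keeps derivatives in the family, since \<open>- sin\<close> is \<open>cos\<close> shifted by
  \<open>pi / 2\<close>.\<close>

definition expcos :: "real^'n \<Rightarrow> real^'n \<Rightarrow> real \<Rightarrow> real^'n \<Rightarrow> real" where
  "expcos a b c x = exp (a \<bullet> x) * cos (b \<bullet> x + c)"

lemma has_pd_expcos:
  "has_pd (expcos a b c) (a $ i * expcos a b c x + b $ i * expcos a b (c + pi / 2) x) i x"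
proof -
  have "has_pd (\<lambda>x. exp (a \<bullet> x) * cos (b \<bullet> x + c))
      (a $ i * (exp (a \<bullet> x) * cos (b \<bullet> x + c)) + b $ i * (exp (a \<bullet> x) * (- sin (b \<bullet> x + c)))) i x"
    unfolding has_pd_def inner_add_right inner_scaleR_right inner_axis
    by (auto intro!: derivative_eq_intros)
  then show ?thesis by (simp add: expcos_def[abs_def] minus_sin_cos_eq add.assoc)
qed

text \<open>Linear combinations with arbitrary phases and with exponents from \<open>A\<close>. Two
  choices of \<open>A\<close> matter: \<open>harmonic_exponents\<close> for the test solutions, and
  \<open>{0} \<times> UNIV\<close> for trigonometric polynomials.\<close>

inductive_set expcos_span :: "((real^'n) \<times> (real^'n)) set \<Rightarrow> (real^'n \<Rightarrow> real) set"
  for A :: "((real^'n) \<times> (real^'n)) set" where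
  base: "(a, b) \<in> A \<Longrightarrow> expcos a b c \<in> expcos_span A"
| add: "f \<in> expcos_span A \<Longrightarrow> g \<in> expcos_span A \<Longrightarrow> (\<lambda>x. f x + g x) \<in> expcos_span A"
| scale: "f \<in> expcos_span A \<Longrightarrow> (\<lambda>x. k * f x) \<in> expcos_span A"

lemma expcos_span_continuous: "f \<in> expcos_span A \<Longrightarrow> continuous_on S f"
  by (induction rule: expcos_span.induct) (auto simp: expcos_def[abs_def] intro!: continuous_intros)

lemma expcos_span_has_pd:
  "f \<in> expcos_span A \<Longrightarrow> \<exists>g\<in>expcos_span A. \<forall>x. has_pd f (g x) i x"
proof (induction rule: expcos_span.induct)
  case (base a b c)
  have "(\<lambda>x. a $ i * expcos a b c x + b $ i * expcos a b (c + pi / 2) x) \<in> expcos_span A"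
    by (intro expcos_span.intros base)
  then show ?case by (rule bexI[rotated]) (simp add: has_pd_expcos)
next
  case (add f g)
  then obtain f' g' where fg: "f' \<in> expcos_span A" "g' \<in> expcos_span A"
    "\<forall>x. has_pd f (f' x) i x" "\<forall>x. has_pd g (g' x) i x" by blast
  have "(\<lambda>x. f' x + g' x) \<in> expcos_span A" by (intro expcos_span.add fg)
  moreover have "\<forall>x. has_pd (\<lambda>x. f x + g x) (f' x + g' x) i x" using fg by (auto intro: has_pd_add)
  ultimately show ?case by (intro bexI[of _ "\<lambda>x. f' x + g' x"])
next
  case (scale f k)
  then obtain f' where f: "f' \<in> expcos_span A" "\<forall>x. has_pd f (f' x) i x" by blast
  have "(\<lambda>x. k * f' x) \<in> expcos_span A" by (intro expcos_span.scale f)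
  moreover have "\<forall>x. has_pd (\<lambda>x. k * f x) (k * f' x) i x" using f by (auto intro: has_pd_cmult)
  ultimately show ?case by (intro bexI[of _ "\<lambda>x. k * f' x"])
qed

lemma expcos_span_dpart: "f \<in> expcos_span A \<Longrightarrow> dpart f \<beta> \<in> expcos_span A"
proof (induction \<beta>)
  case (Cons i \<beta>)
  then obtain g where g: "g \<in> expcos_span A" "\<forall>x. has_pd (dpart f \<beta>) (g x) i x"
    using expcos_span_has_pd by blast
  then have "dpart f (i#\<beta>) = g" using dpart_Cons_eq by blast
  then show ?case using g by simp
qed simp

lemma expcos_span_Ck:
  assumes "f \<in> expcos_span A" shows "Ck k U f"
proof (rule CkI)
  show "continuous_on U (dpart f \<beta>)" for \<beta> by (rule expcos_span_continuous[OF expcos_span_dpart[OF assms]])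
  show "\<exists>D. has_pd (dpart f \<beta>) D i x" for \<beta> i x
    using expcos_span_has_pd[OF expcos_span_dpart[OF assms]] by blast
qed

text \<open>For \<open>zeta = a + i b\<close> the Laplacian multiplies \<open>exp (zeta . x)\<close>
  by \<open>zeta . zeta = a . a - b . b + 2 i (a . b)\<close>.\<close>

lemma laplacian_expcos:
  assumes "a \<bullet> a = b \<bullet> b" "a \<bullet> b = 0"
  shows "laplacian (expcos a b c) x = 0"
proof -
  let ?G = "\<lambda>i x. a $ i * expcos a b c x + b $ i * expcos a b (c + pi / 2) x"
  have 1: "dpart (expcos a b c) [i] = ?G i" for i
  proof
    fix x show "dpart (expcos a b c) [i] x = ?G i x"
      using dpart_Cons_eq[of "expcos a b c" "[]" _ i x] has_pd_expcos[of a b c i x] by simp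
  qed
  have pi: "expcos a b (c + pi / 2 + pi / 2) x = - expcos a b c x"
  proof -
    have "c + pi / 2 + pi / 2 = c + pi" by simp
    then show ?thesis by (simp add: expcos_def cos_add sin_add algebra_simps)
  qed
  have "dpart (expcos a b c) [i, i] x = (a $ i * a $ i - b $ i * b $ i) * expcos a b c x
      + 2 * (a $ i * b $ i) * expcos a b (c + pi / 2) x" for i
  proof -
    have "has_pd (?G i) (a $ i * ?G i x + b $ i * (a $ i * expcos a b (c + pi / 2) x
        + b $ i * expcos a b (c + pi / 2 + pi / 2) x)) i x"
      by (intro has_pd_add has_pd_cmult has_pd_expcos)
    then have "has_pd (dpart (expcos a b c) [i]) (a $ i * ?G i x + b $ i * (a $ i * expcos a b (c + pi / 2) x
        + b $ i * expcos a b (c + pi / 2 + pi / 2) x)) i x" by (simp only: 1)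
    then have "dpart (expcos a b c) [i, i] x = a $ i * ?G i x + b $ i * (a $ i * expcos a b (c + pi / 2) x
        + b $ i * expcos a b (c + pi / 2 + pi / 2) x)" by (rule dpart_Cons_eq)
    then show ?thesis unfolding pi by (simp add: algebra_simps del: dpart.simps)
  qed
  then have "laplacian (expcos a b c) x = (\<Sum>i\<in>UNIV. a $ i * a $ i - b $ i * b $ i) * expcos a b c x
      + 2 * (\<Sum>i\<in>UNIV. a $ i * b $ i) * expcos a b (c + pi / 2) x"
    by (simp add: laplacian_def sum.distrib sum_distrib_right sum_distrib_left del: dpart.simps)
  also have "(\<Sum>i\<in>UNIV. a $ i * a $ i - b $ i * b $ i) = 0"
    using assms(1) by (simp add: inner_vec_def sum_subtractf)
  also have "(\<Sum>i\<in>UNIV. a $ i * b $ i) = 0" using assms(2) by (simp add: inner_vec_def)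
  finally show ?thesis by simp
qed

text \<open>Real and imaginary parts of the complex null vectors, the exponents in Calderon's
  exponential solutions.\<close>

definition harmonic_exponents :: "((real^'n) \<times> (real^'n)) set" where
  "harmonic_exponents = {(a, b). a \<bullet> a = b \<bullet> b \<and> a \<bullet> b = 0}"

lemma laplacian_expcos_span:
  assumes "f \<in> expcos_span harmonic_exponents" shows "laplacian f x = 0"
  using assms
proof (induction rule: expcos_span.induct)
  case (base a b c)
  then show ?case by (intro laplacian_expcos) (auto simp: harmonic_exponents_def)
next
  case (add f g)
  have "dpart (\<lambda>x. 1 * f x + 1 * g x) [i, i] x = 1 * dpart f [i, i] x + 1 * dpart g [i, i] x" for i
    using add.hyps by (intro dpart_combination[OF open_UNIV expcos_span_Ck[of _ _ 2] expcos_span_Ck[of _ _ 2]]) auto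
  then show ?case using add.IH by (simp add: laplacian_def sum.distrib del: dpart.simps)
next
  case (scale f k)
  have "dpart (\<lambda>x. k * f x + 0 * f x) [i, i] x = k * dpart f [i, i] x + 0 * dpart f [i, i] x" for i
    using scale.hyps by (intro dpart_combination[OF open_UNIV expcos_span_Ck[of _ _ 2] expcos_span_Ck[of _ _ 2]]) auto
  then show ?case using scale.IH by (simp add: laplacian_def sum_distrib_left[symmetric] del: dpart.simps)
qed

text \<open>The product-to-sum formula for cosines; exponential factors are absent as the real
  exponents are 0. Stone-Weierstrass asks for this closure under products.\<close>

lemma cos_mult_span:
  assumes "f \<in> expcos_span ({0} \<times> UNIV)" "g \<in> expcos_span ({0} \<times> UNIV)"
  shows "(\<lambda>x. f x * g x) \<in> expcos_span ({0} \<times> UNIV)"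
  using assms(1)
proof (induction rule: expcos_span.induct)
  case (base a b c)
  show ?case using assms(2)
  proof (induction rule: expcos_span.induct)
    case (base a' b' c')
    have "(\<lambda>x. (1/2) * expcos 0 (b - b') (c - c') x + (1/2) * expcos 0 (b + b') (c + c') x) \<in> expcos_span ({0} \<times> UNIV)"
      by (intro expcos_span.intros) auto
    moreover have "(\<lambda>x. expcos a b c x * expcos a' b' c' x) =
       (\<lambda>x. (1/2) * expcos 0 (b - b') (c - c') x + (1/2) * expcos 0 (b + b') (c + c') x)"
    proof
      fix x
      have eq: "b \<bullet> x + c - (b' \<bullet> x + c') = (b - b') \<bullet> x + (c - c')" "b \<bullet> x + c + (b' \<bullet> x + c') = (b + b') \<bullet> x + (c + c')"
        by (simp_all add: inner_diff_left inner_add_left)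
      then show "expcos a b c x * expcos a' b' c' x = (1/2) * expcos 0 (b - b') (c - c') x + (1/2) * expcos 0 (b + b') (c + c') x"
        using base \<open>(a, b) \<in> {0} \<times> UNIV\<close> cos_times_cos[of "b \<bullet> x + c" "b' \<bullet> x + c'"]
        unfolding eq by (auto simp: expcos_def)
    qed
    ultimately show ?case by simp
  next
    case (add f g)
    then have "(\<lambda>x. expcos a b c x * f x + expcos a b c x * g x) \<in> expcos_span ({0} \<times> UNIV)"
      by (intro expcos_span.add)
    then show ?case by (simp add: algebra_simps)
  next
    case (scale f k)
    then have "(\<lambda>x. k * (expcos a b c x * f x)) \<in> expcos_span ({0} \<times> UNIV)" by (intro expcos_span.scale)
    then show ?case by (simp add: algebra_simps)
  qed
next
  case (add f f')
  then have "(\<lambda>x. f x * g x + f' x * g x) \<in> expcos_span ({0} \<times> UNIV)"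
    by (intro expcos_span.add)
  then show ?case by (simp add: algebra_simps)
next
  case (scale f k)
  then have "(\<lambda>x. k * (f x * g x)) \<in> expcos_span ({0} \<times> UNIV)" by (intro expcos_span.scale)
  then show ?case by (simp add: algebra_simps)
qed

lemma cos_span_dense:
  fixes S :: "(real^'n) set"
  assumes "compact S" "continuous_on S Q" "e > 0"
  obtains f where "f \<in> expcos_span ({0} \<times> UNIV)" "\<And>x. x \<in> S \<Longrightarrow> \<bar>Q x - f x\<bar> < e"
proof -
  interpret function_ring_on "expcos_span ({0} \<times> UNIV)" S
  proof
    show "compact S" by fact
    show "continuous_on S f" if "f \<in> expcos_span ({0} \<times> UNIV)" for f by (rule expcos_span_continuous[OF that])
    show "(\<lambda>x. f x + g x) \<in> expcos_span ({0} \<times> UNIV)"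
      if "f \<in> expcos_span ({0} \<times> UNIV)" "g \<in> expcos_span ({0} \<times> UNIV)" for f g :: "real^'n \<Rightarrow> real"
      by (rule expcos_span.add[OF that])
    show "(\<lambda>x. f x * g x) \<in> expcos_span ({0} \<times> UNIV)"
      if "f \<in> expcos_span ({0} \<times> UNIV)" "g \<in> expcos_span ({0} \<times> UNIV)" for f g :: "real^'n \<Rightarrow> real"
      by (rule cos_mult_span[OF that])
    show "(\<lambda>_::real^'n. c) \<in> expcos_span ({0} \<times> UNIV)" for c
    proof -
      have "(\<lambda>x. c * expcos 0 0 0 x) \<in> expcos_span ({0} \<times> (UNIV :: (real^'n) set))"
        by (intro expcos_span.intros) auto
      then show ?thesis by (simp add: expcos_def)
    qed
    show "\<exists>f\<in>expcos_span ({0} \<times> UNIV). f x \<noteq> f y" if "x \<noteq> y" for x y :: "real^'n"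
    proof -
      \<comment> \<open>Normalised so that \<open>b \<bullet> y - b \<bullet> x = 1\<close>; with
        the phase chosen below, the two values are \<open>cos 0\<close> and
        \<open>cos 1\<close>.\<close>
      define b where "b = (y - x) /\<^sub>R ((y - x) \<bullet> (y - x))"
      have "b \<bullet> y - b \<bullet> x = b \<bullet> (y - x)" by (simp only: inner_diff_right)
      also have "\<dots> = 1" using that unfolding b_def inner_scaleR_left by simp
      finally have "b \<bullet> y - b \<bullet> x = 1" .
      then have "expcos 0 b (- (b \<bullet> x)) x = 1" "expcos 0 b (- (b \<bullet> x)) y = cos 1" by (auto simp: expcos_def)
      moreover have "cos (1::real) < cos 0" using pi_gt3 by (intro cos_monotone_0_pi) auto
      moreover have "expcos 0 b (- (b \<bullet> x)) \<in> expcos_span ({0} \<times> UNIV)" by (intro expcos_span.base) auto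
      ultimately show ?thesis by (metis cos_zero less_irrefl)
    qed
  qed
  show ?thesis using Stone_Weierstrass_basic[OF assms(2,3)] that by blast
qed

context holder_domain
begin

text \<open>Functions of the span are smooth everywhere, so Lipschitz bounds are taken on a large
  ball containing \<Omega>, which is convex even if \<Omega> is not.\<close>

lemma expcos_span_holder:
  assumes f: "f \<in> expcos_span A" shows "f \<in> holder_space s \<Omega>"
  unfolding holder_space_def m_def[symmetric] \<alpha>_def[symmetric]
proof (intro CollectI conjI allI impI)
  obtain R where R: "\<And>x. x \<in> \<Omega> \<Longrightarrow> norm x \<le> R" using bd bounded_iff by metis
  have sub: "\<Omega> \<subseteq> cball 0 R" using R by auto
  have bound: "\<exists>M. \<forall>x\<in>cball 0 R. \<bar>dpart f \<beta> x\<bar> \<le> M" for \<beta>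
    using compact_imp_bounded[OF compact_continuous_image[OF expcos_span_continuous[OF expcos_span_dpart[OF f]] compact_cball]]
    unfolding bounded_iff by auto
  show "continuous_on (closure \<Omega>) f" by (rule expcos_span_continuous[OF f])
  show "Ck m \<Omega> f" by (rule expcos_span_Ck[OF f])
  show "bounded (dpart f \<beta> ` \<Omega>)" for \<beta>
  proof -
    obtain M where "\<forall>x\<in>cball 0 R. \<bar>dpart f \<beta> x\<bar> \<le> M" using bound by blast
    then show ?thesis unfolding bounded_iff using sub by (intro exI[of _ M]) auto
  qed
  show "bdd_above (hquot \<alpha> \<Omega> (dpart f \<beta>))" for \<beta>
  proof -
    have "\<forall>i. \<exists>M. \<forall>x\<in>cball 0 R. \<bar>dpart f (i#\<beta>) x\<bar> \<le> M" using bound by blast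
    then obtain M where M: "\<And>i x. x \<in> cball 0 R \<Longrightarrow> \<bar>dpart f (i#\<beta>) x\<bar> \<le> M i" by metis
    define B where "B = (\<Sum>i\<in>UNIV. \<bar>M i\<bar>)"
    have MB: "M i \<le> B" for i
    proof -
      have "\<bar>M i\<bar> \<le> B" unfolding B_def by (rule member_le_sum) auto
      then show ?thesis by linarith
    qed
    have B0: "B \<ge> 0" by (simp add: B_def sum_nonneg)
    show ?thesis
    proof (rule bdd_aboveI[of _ "CARD('n) * B * diam"])
      fix z assume "z \<in> hquot \<alpha> \<Omega> (dpart f \<beta>)"
      then obtain x y where xy: "x \<in> \<Omega>" "y \<in> \<Omega>" "x \<noteq> y" "z = \<bar>dpart f \<beta> x - dpart f \<beta> y\<bar> / dist x y powr \<alpha>"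
        unfolding hquot_def by blast
      have "\<bar>dpart f \<beta> x - dpart f \<beta> y\<bar> \<le> CARD('n) * B * norm (x - y)"
        by (rule Ck_lipschitz[OF open_UNIV expcos_span_Ck[OF f, of "Suc (length \<beta>)"] _ convex_cball[of 0 R]])
          (use xy sub M MB order_trans in \<open>auto simp del: dpart.simps, blast\<close>)
      also have "\<dots> \<le> CARD('n) * B * (diam * dist x y powr \<alpha>)"
        using dist_le_powr[OF xy(1,2)] B0 by (intro mult_left_mono) (auto simp: dist_norm)
      finally show "z \<le> CARD('n) * B * diam" using xy by (simp add: pos_divide_le_eq mult.assoc)
    qed
  qed
qed

text \<open>\<open>u - e * h\<close> vanishes on the boundary and has Laplacian
  \<open>- q * u^2\<close>, so it is at most \<open>Q * Mu^2 * R^2\<close>, \<open>Mu\<close> being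
  the maximum of \<open>\<bar>u\<bar>\<close>. A priori smallness makes this at most
  \<open>Mu / 2\<close>, which is absorbed and gives the linear bound; inserting that once more
  gives the quadratic one.\<close>

lemma small_solution_asymptotics:
  assumes q: "\<And>x. x \<in> \<Omega> \<Longrightarrow> \<bar>q x\<bar> \<le> Q" and R: "\<And>x. x \<in> closure \<Omega> \<Longrightarrow> norm x \<le> R"
    and h: "Ck 2 \<Omega> h" "continuous_on (closure \<Omega>) h" "\<And>x. x \<in> \<Omega> \<Longrightarrow> laplacian h x = 0"
    and H: "\<And>x. x \<in> closure \<Omega> \<Longrightarrow> \<bar>h x\<bar> \<le> H"
    and u: "continuous_on (closure \<Omega>) u" "Ck 2 \<Omega> u" "\<And>x. x \<in> \<Omega> \<Longrightarrow> laplacian u x + q x * (u x)\<^sup>2 = 0"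
      "\<And>x. x \<in> frontier \<Omega> \<Longrightarrow> u x = e * h x"
    and e: "e > 0"
    and small: "\<And>x. x \<in> closure \<Omega> \<Longrightarrow> \<bar>u x\<bar> \<le> \<kappa>" and \<kappa>: "Q * R\<^sup>2 * \<kappa> \<le> 1 / 2"
    and x: "x \<in> \<Omega>"
  shows "\<bar>u x\<bar> \<le> 2 * e * H" "\<bar>u x - e * h x\<bar> \<le> 4 * Q * R\<^sup>2 * H\<^sup>2 * e\<^sup>2"
proof -
  have comp: "compact (closure \<Omega>)" using bd by simp
  have cne: "closure \<Omega> \<noteq> {}" using ne by simp
  have Q0: "Q \<ge> 0" using q[OF x] by linarith
  have "continuous_on (closure \<Omega>) (\<lambda>x. \<bar>u x\<bar>)" by (intro continuous_intros u)
  then obtain z where z: "z \<in> closure \<Omega>" "\<And>y. y \<in> closure \<Omega> \<Longrightarrow> \<bar>u y\<bar> \<le> \<bar>u z\<bar>"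
    using continuous_attains_sup[OF comp cne] by metis
  define Mu where "Mu = \<bar>u z\<bar>"
  have v: "\<bar>u y - e * h y\<bar> \<le> (Q * Mu\<^sup>2) * R\<^sup>2" if "y \<in> closure \<Omega>" for y
  proof (rule maximum_principle_bound[OF op bd _ _ _ _ R _ that])
    show "continuous_on (closure \<Omega>) (\<lambda>y. u y - e * h y)" by (intro continuous_intros u h)
    show "has_pd2 (\<lambda>y. u y - e * h y) (dpart u [i, i] y - e * dpart h [i, i] y) i y" if "y \<in> \<Omega>" for i y
      by (intro has_pd2_diff has_pd2_cmult Ck_has_pd2[OF op] u h that)
    show "\<bar>\<Sum>i\<in>UNIV. dpart u [i, i] y - e * dpart h [i, i] y\<bar> \<le> Q * Mu\<^sup>2" if y: "y \<in> \<Omega>" for y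
    proof -
      have "(\<Sum>i\<in>UNIV. dpart u [i, i] y - e * dpart h [i, i] y) = laplacian u y - e * laplacian h y"
        by (simp add: laplacian_def sum_subtractf sum_distrib_left del: dpart.simps)
      also have "\<dots> = - (q y * (u y)\<^sup>2)" using u(3)[OF y] h(3)[OF y] by simp
      finally have "\<bar>\<Sum>i\<in>UNIV. dpart u [i, i] y - e * dpart h [i, i] y\<bar> = \<bar>q y\<bar> * (u y)\<^sup>2"
        by (simp add: abs_mult del: dpart.simps)
      also have "\<dots> \<le> Q * Mu\<^sup>2"
        using q[OF y] z(2)[of y] y closure_subset[of \<Omega>] Q0
        by (intro mult_mono) (auto simp: Mu_def abs_le_square_iff[symmetric] simp del: power2_abs)
      finally show ?thesis .
    qed
    show "u y - e * h y = 0" if "y \<in> frontier \<Omega>" for y using u(4)[OF that] by simp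
    show "0 \<le> Q * Mu\<^sup>2" using Q0 by simp
  qed auto
  have "Q * R\<^sup>2 * Mu \<le> Q * R\<^sup>2 * \<kappa>" using small[OF z(1)] Q0 by (intro mult_left_mono) (auto simp: Mu_def)
  then have "(Q * R\<^sup>2 * Mu) * Mu \<le> (1 / 2) * Mu" using \<kappa> by (intro mult_right_mono) (auto simp: Mu_def)
  then have "(Q * Mu\<^sup>2) * R\<^sup>2 \<le> Mu / 2" by (simp add: power2_eq_square mult_ac)
  moreover have "\<bar>e * h z\<bar> \<le> e * H" using H[OF z(1)] e by (simp add: abs_mult)
  moreover have "Mu \<le> \<bar>u z - e * h z\<bar> + \<bar>e * h z\<bar>" unfolding Mu_def by linarith
  ultimately have Mu: "Mu \<le> 2 * e * H" using v[OF z(1)] by linarith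
  have xc: "x \<in> closure \<Omega>" using x closure_subset by blast
  show "\<bar>u x\<bar> \<le> 2 * e * H" using z(2)[OF xc] Mu by (simp add: Mu_def)
  have "(Q * Mu\<^sup>2) * R\<^sup>2 \<le> (Q * (2 * e * H)\<^sup>2) * R\<^sup>2"
    using Mu Q0 by (intro mult_right_mono mult_left_mono power_mono) (auto simp: Mu_def)
  then show "\<bar>u x - e * h x\<bar> \<le> 4 * Q * R\<^sup>2 * H\<^sup>2 * e\<^sup>2"
    using v[OF xc] by (simp add: power_mult_distrib mult_ac)
qed

end

section \<open>Uniqueness of the potential\<close>

context holder_domain
begin

lemma closure_integrable:
  assumes "continuous_on (closure \<Omega>) f"
  shows "set_integrable lborel \<Omega> (f :: real^'n \<Rightarrow> real)"
proof -
  have "bounded (f ` closure \<Omega>)"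
    using bd by (intro compact_imp_bounded compact_continuous_image assms) auto
  then obtain M where "\<And>x. x \<in> closure \<Omega> \<Longrightarrow> \<bar>f x\<bar> \<le> M" unfolding bounded_iff by auto
  then show ?thesis
    using closure_subset by (intro continuous_bounded_set_integrable[OF op bd continuous_on_subset[OF assms]]) auto
qed

lemma set_integral_abs_le:
  fixes f :: "real^'n \<Rightarrow> real"
  assumes "continuous_on (closure \<Omega>) f" "\<And>x. x \<in> \<Omega> \<Longrightarrow> \<bar>f x\<bar> \<le> B"
  shows "\<bar>LINT x:\<Omega>|lborel. f x\<bar> \<le> B * measure lborel \<Omega>"
proof -
  have fin: "emeasure lborel \<Omega> < \<infinity>" using emeasure_bounded_finite[OF bd] by simp
  have i: "set_integrable lborel \<Omega> f" by (rule closure_integrable[OF assms(1)])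
  have "\<bar>LINT x:\<Omega>|lborel. f x\<bar> \<le> (LINT x:\<Omega>|lborel. \<bar>f x\<bar>)"
    using set_integral_norm_bound[OF i] by simp
  also have "\<dots> \<le> (LINT x:\<Omega>|lborel. B)"
    using assms(2) i op fin by (intro set_integral_mono set_integrable_abs) (auto simp: set_integrable_def)
  also have "\<dots> = B * measure lborel \<Omega>" using fin op by (simp add: set_lebesgue_integral_def)
  finally show ?thesis .
qed

text \<open>One \<open>h\<close> is fixed and scaled by a sequence tending to 0. Squares of single
  functions suffice at this stage, as the span contains sums and products are recovered from squares
  afterwards.\<close>

lemma integral_square_harmonic_eq_0:
  assumes sb: "smooth_boundary \<Omega>"
    and q: "smooth_closure \<Omega> q1" "smooth_closure \<Omega> q2"
    and wp: "well_posed s \<Omega> q1 \<delta>1 C1" "well_posed s \<Omega> q2 \<delta>2 C2"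
    and \<delta>: "0 < \<delta>" "\<delta> \<le> \<delta>1" "\<delta> \<le> \<delta>2"
    and DN: "\<forall>f\<in>bdry_holder_space s \<Omega>. bdry_holder_norm s \<Omega> f < \<delta> \<longrightarrow>
               (\<forall>x\<in>frontier \<Omega>. DN_map s \<Omega> q1 \<delta>1 C1 f x = DN_map s \<Omega> q2 \<delta>2 C2 f x)"
    and h: "h \<in> expcos_span harmonic_exponents"
  shows "(LINT x:\<Omega>|lborel. (q1 x - q2 x) * (h x)\<^sup>2) = 0"
proof -
  have comp: "compact (closure \<Omega>)" using bd by simp
  have bounded_on_closure: "\<exists>M\<ge>0. \<forall>x\<in>closure \<Omega>. \<bar>f x\<bar> \<le> M" if "continuous_on (closure \<Omega>) f" for f :: "real^'n \<Rightarrow> real"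
  proof -
    have "bounded (f ` closure \<Omega>)" by (intro compact_imp_bounded compact_continuous_image that comp)
    then obtain M where "\<And>x. x \<in> closure \<Omega> \<Longrightarrow> \<bar>f x\<bar> \<le> M" unfolding bounded_iff by auto
    then show ?thesis by (intro exI[of _ "\<bar>M\<bar>"]) fastforce
  qed
  have qc: "continuous_on (closure \<Omega>) q1" "continuous_on (closure \<Omega>) q2" and qs: "smooth_on \<Omega> q1" "smooth_on \<Omega> q2"
    using q by (auto simp: smooth_closure_def)
  obtain Q1 Q2 where Q12: "Q1 \<ge> 0" "\<And>x. x \<in> closure \<Omega> \<Longrightarrow> \<bar>q1 x\<bar> \<le> Q1" "Q2 \<ge> 0" "\<And>x. x \<in> closure \<Omega> \<Longrightarrow> \<bar>q2 x\<bar> \<le> Q2"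
    using bounded_on_closure[OF qc(1)] bounded_on_closure[OF qc(2)] by metis
  define Q where "Q = max Q1 Q2"
  have Q: "Q \<ge> 0" "\<And>x. x \<in> \<Omega> \<Longrightarrow> \<bar>q1 x\<bar> \<le> Q" "\<And>x. x \<in> \<Omega> \<Longrightarrow> \<bar>q2 x\<bar> \<le> Q"
    using Q12 closure_subset[of \<Omega>] unfolding Q_def by (fastforce simp: le_max_iff_disj)+
  have hc: "continuous_on (closure \<Omega>) h" by (rule expcos_span_continuous[OF h])
  obtain H where H: "H \<ge> 0" "\<And>x. x \<in> closure \<Omega> \<Longrightarrow> \<bar>h x\<bar> \<le> H" using bounded_on_closure[OF hc] by blast
  obtain R where R: "\<And>x. x \<in> closure \<Omega> \<Longrightarrow> norm x \<le> R" using compact_imp_bounded[OF comp] bounded_iff by metis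
  have hs: "h \<in> holder_space s \<Omega>" by (rule expcos_span_holder[OF h])
  define Nh where "Nh = holder_norm s \<Omega> h"
  have Nh: "Nh \<ge> 0" using holder_norm_nonneg[OF hs] by (simp add: Nh_def)
  \<comment> \<open>This keeps the boundary norms below \<open>\<delta>\<close>:
    \<open>eps k * (Nh + 1)\<close> is at most \<open>\<delta> / 2\<close>, the summand 1 guarding
    against \<open>Nh = 0\<close>.\<close>
  define eps where "eps k = \<delta> / (2 * (Nh + 1)) * inverse (real (Suc k))" for k
  have eps0: "eps k > 0" for k using \<delta> Nh by (simp add: eps_def)
  have epsN: "\<bar>eps k\<bar> * Nh < \<delta>" for k
  proof -
    have "eps k \<le> \<delta> / (2 * (Nh + 1)) * 1"
      unfolding eps_def using \<delta> Nh by (intro mult_left_mono) (auto simp: field_simps)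
    then have "eps k * (Nh + 1) \<le> \<delta> / (2 * (Nh + 1)) * (Nh + 1)" using Nh by (intro mult_right_mono) auto
    also have "\<dots> = \<delta> / 2" using Nh by (simp add: field_simps)
    finally show ?thesis using eps0[of k] \<delta> by (simp add: algebra_simps)
  qed
  have epslim: "eps \<longlonglongrightarrow> 0"
    unfolding eps_def by (rule tendsto_mult_right_zero[OF LIMSEQ_inverse_real_of_nat])
  define f where "f k = (\<lambda>x. eps k * h x)" for k
  have f: "f k \<in> bdry_holder_space s \<Omega>" "bdry_holder_norm s \<Omega> (f k) < \<delta>" for k
    using bdry_holder_scale[OF hs, of "eps k"] epsN[of k] by (auto simp: f_def Nh_def)
  \<comment> \<open>Literally the choice made inside \<open>DN_map\<close>, so \<open>DN\<close>
    speaks about these very solutions.\<close>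
  define u1 where "u1 k = (SOME u. small_sol s \<Omega> q1 C1 \<delta>1 (f k) u)" for k
  define u2 where "u2 k = (SOME u. small_sol s \<Omega> q2 C2 \<delta>2 (f k) u)" for k
  have s1: "small_sol s \<Omega> q1 C1 \<delta>1 (f k) (u1 k)" for k
  proof -
    have "bdry_holder_norm s \<Omega> (f k) < \<delta>1" using f(2)[of k] \<delta> by linarith
    then have "\<exists>u. small_sol s \<Omega> q1 C1 \<delta>1 (f k) u" using wp(1) f(1)[of k] unfolding well_posed_def by blast
    then show ?thesis unfolding u1_def by (rule someI_ex)
  qed
  have s2: "small_sol s \<Omega> q2 C2 \<delta>2 (f k) (u2 k)" for k
  proof -
    have "bdry_holder_norm s \<Omega> (f k) < \<delta>2" using f(2)[of k] \<delta> by linarith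
    then have "\<exists>u. small_sol s \<Omega> q2 C2 \<delta>2 (f k) u" using wp(2) f(1)[of k] unfolding well_posed_def by blast
    then show ?thesis unfolding u2_def by (rule someI_ex)
  qed
  have u1: "u1 k \<in> holder_space s \<Omega>" "Ck 2 \<Omega> (u1 k)" "\<And>x. x \<in> \<Omega> \<Longrightarrow> laplacian (u1 k) x + q1 x * (u1 k x)\<^sup>2 = 0"
    "\<And>x. x \<in> frontier \<Omega> \<Longrightarrow> u1 k x = eps k * h x" for k
    using s1[of k] by (auto simp: small_sol_def f_def)
  have u2: "u2 k \<in> holder_space s \<Omega>" "Ck 2 \<Omega> (u2 k)" "\<And>x. x \<in> \<Omega> \<Longrightarrow> laplacian (u2 k) x + q2 x * (u2 k x)\<^sup>2 = 0"
    "\<And>x. x \<in> frontier \<Omega> \<Longrightarrow> u2 k x = eps k * h x" for k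
    using s2[of k] by (auto simp: small_sol_def f_def)
  have uc: "continuous_on (closure \<Omega>) (u1 k)" "continuous_on (closure \<Omega>) (u2 k)" for k
    using u1(1)[of k] u2(1)[of k] by (auto simp: holder_space_def)
  have nd: "normal_deriv \<Omega> (u1 k) x = normal_deriv \<Omega> (u2 k) x" if "x \<in> frontier \<Omega>" for k x
    using DN f[of k] that unfolding DN_map_def u1_def u2_def by blast
  have lap: "laplacian (u1 k) x - laplacian (u2 k) x = - (q1 x * (u1 k x)\<^sup>2 - q2 x * (u2 k x)\<^sup>2)" if "x \<in> \<Omega>" for k x
    using u1(3)[OF that, of k] u2(3)[OF that, of k] by simp
  have zero: "(LINT x:\<Omega>|lborel. q1 x * (u1 k x)\<^sup>2 - q2 x * (u2 k x)\<^sup>2) = 0" for k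
  proof -
    have "continuous_on (closure \<Omega>) (\<lambda>x. q1 x * (u1 k x)\<^sup>2 - q2 x * (u2 k x)\<^sup>2)"
      by (intro continuous_intros qc uc)
    then obtain B where "\<And>x. x \<in> closure \<Omega> \<Longrightarrow> \<bar>q1 x * (u1 k x)\<^sup>2 - q2 x * (u2 k x)\<^sup>2\<bar> \<le> B"
      using bounded_on_closure by blast
    then have "\<bar>laplacian (u1 k) x - laplacian (u2 k) x\<bar> \<le> B" if "x \<in> \<Omega>" for x
      unfolding lap[OF that] abs_minus_cancel using that closure_subset by blast
    then have "(LINT x:\<Omega>|lborel. laplacian (u1 k) x - laplacian (u2 k) x) = 0"
      using laplacian_integral_eq_0[OF sb u1(1,2) u2(1,2) nd] by blast
    moreover have "(LINT x:\<Omega>|lborel. laplacian (u1 k) x - laplacian (u2 k) x)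
       = (LINT x:\<Omega>|lborel. - (q1 x * (u1 k x)\<^sup>2 - q2 x * (u2 k x)\<^sup>2))"
      using op by (intro set_lebesgue_integral_cong) (auto simp: lap)
    moreover have "\<dots> = - (LINT x:\<Omega>|lborel. q1 x * (u1 k x)\<^sup>2 - q2 x * (u2 k x)\<^sup>2)"
      unfolding set_lebesgue_integral_def scaleR_minus_right by (rule Bochner_Integration.integral_minus)
    ultimately show ?thesis by simp
  qed
  obtain r1 where r1: "strict_mono (r1 :: nat \<Rightarrow> nat)"
    "\<And>e. e > 0 \<Longrightarrow> \<exists>M. \<forall>j\<ge>M. \<forall>x\<in>closure \<Omega>. \<bar>u1 (r1 j) x\<bar> \<le> e"
    using small_solutions_subsequence_to_0[OF wp(1) qs(1) hs epslim s1[unfolded f_def]] by metis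
  \<comment> \<open>A subsequence of the subsequence, so that both families become small along
    common indices.\<close>
  obtain r2 where r2: "strict_mono (r2 :: nat \<Rightarrow> nat)"
    "\<And>e. e > 0 \<Longrightarrow> \<exists>M. \<forall>j\<ge>M. \<forall>x\<in>closure \<Omega>. \<bar>u2 (r1 (r2 j)) x\<bar> \<le> e"
    using small_solutions_subsequence_to_0[OF wp(2) qs(2) hs, of "\<lambda>j. eps (r1 j)" "\<lambda>j. u2 (r1 j)"]
      LIMSEQ_subseq_LIMSEQ[OF epslim r1(1)] s2 unfolding f_def comp_def by metis
  define k where "k j = r1 (r2 j)" for j
  have "strict_mono k" unfolding k_def using r1(1) r2(1) by (auto simp: strict_mono_def)
  then have elim: "(\<lambda>j. eps (k j)) \<longlonglongrightarrow> 0" using LIMSEQ_subseq_LIMSEQ[OF epslim] by (simp add: comp_def)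
  \<comment> \<open>The threshold below which \<open>small_solution_asymptotics\<close> can absorb
    the quadratic term.\<close>
  define \<kappa> where "\<kappa> = 1 / (2 * (Q * R\<^sup>2 + 1))"
  have QR: "Q * R\<^sup>2 \<ge> 0" using Q by simp
  have \<kappa>: "\<kappa> > 0" "Q * R\<^sup>2 * \<kappa> \<le> 1 / 2" using QR by (auto simp: \<kappa>_def field_simps)
  obtain M1 where M1: "\<And>j x. j \<ge> M1 \<Longrightarrow> x \<in> closure \<Omega> \<Longrightarrow> \<bar>u1 (r1 j) x\<bar> \<le> \<kappa>" using r1(2)[OF \<kappa>(1)] by blast
  obtain M2 where M2: "\<And>j x. j \<ge> M2 \<Longrightarrow> x \<in> closure \<Omega> \<Longrightarrow> \<bar>u2 (r1 (r2 j)) x\<bar> \<le> \<kappa>" using r2(2)[OF \<kappa>(1)] by blast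
  define A where "A = 4 * Q * R\<^sup>2 * H\<^sup>2"
  have A: "A \<ge> 0" using QR by (simp add: A_def)
  define J where "J = (LINT x:\<Omega>|lborel. (q1 x - q2 x) * (h x)\<^sup>2)"
  \<comment> \<open>Two potentials, each bounded by \<open>Q\<close>, times the factors
    \<open>A\<close> and \<open>3 * H\<close> from the difference of squares in
    \<open>sq\<close>.\<close>
  define W where "W = 2 * (Q * (A * (3 * H))) * measure lborel \<Omega>"
  have est: "\<bar>J\<bar> \<le> W * eps (k j)" if j: "j \<ge> max M1 M2" for j
  proof -
    define e where "e = eps (k j)"
    have e: "e > 0" by (simp add: e_def eps0)
    have "r2 j \<ge> M1" using seq_suble[OF r2(1), of j] j by linarith
    then have k1: "\<bar>u1 (k j) x\<bar> \<le> \<kappa>" if "x \<in> closure \<Omega>" for x using M1[OF _ that] by (simp add: k_def)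
    have k2: "\<bar>u2 (k j) x\<bar> \<le> \<kappa>" if "x \<in> closure \<Omega>" for x using M2[OF _ that] j by (simp add: k_def)
    have p1: "Ck 2 \<Omega> (u1 (k j))" "\<And>x. x \<in> \<Omega> \<Longrightarrow> laplacian (u1 (k j)) x + q1 x * (u1 (k j) x)\<^sup>2 = 0"
      "\<And>x. x \<in> frontier \<Omega> \<Longrightarrow> u1 (k j) x = eps (k j) * h x"
      by (rule u1; assumption)+
    have p2: "Ck 2 \<Omega> (u2 (k j))" "\<And>x. x \<in> \<Omega> \<Longrightarrow> laplacian (u2 (k j)) x + q2 x * (u2 (k j) x)\<^sup>2 = 0"
      "\<And>x. x \<in> frontier \<Omega> \<Longrightarrow> u2 (k j) x = eps (k j) * h x"
      by (rule u2; assumption)+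
    note hh = expcos_span_Ck[OF h, of 2 \<Omega>] hc laplacian_expcos_span[OF h]
    \<comment> \<open>Difference of squares: \<open>e * h x - a\<close> is of order
      \<open>e^2\<close> and \<open>e * h x + a\<close> of order \<open>e\<close>.\<close>
    have sq: "\<bar>(e * h x)\<^sup>2 - a\<^sup>2\<bar> \<le> (A * e\<^sup>2) * (3 * e * H)"
      if "\<bar>a\<bar> \<le> 2 * e * H" "\<bar>a - e * h x\<bar> \<le> 4 * Q * R\<^sup>2 * H\<^sup>2 * e\<^sup>2" "x \<in> \<Omega>" for a x
    proof -
      have "\<bar>e * h x\<bar> \<le> e * H" using H(2)[of x] e that(3) closure_subset by (auto simp: abs_mult)
      then have "\<bar>e * h x + a\<bar> \<le> 3 * e * H" using that(1) by linarith
      moreover have "\<bar>e * h x - a\<bar> \<le> A * e\<^sup>2" using that(2) by (simp add: A_def abs_minus_commute)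
      ultimately have "\<bar>(e * h x - a) * (e * h x + a)\<bar> \<le> (A * e\<^sup>2) * (3 * e * H)"
        unfolding abs_mult using A by (intro mult_mono) auto
      then show ?thesis by (simp add: power2_eq_square algebra_simps)
    qed
    let ?g = "\<lambda>x. e\<^sup>2 * ((q1 x - q2 x) * (h x)\<^sup>2)"
    let ?z = "\<lambda>x. q1 x * (u1 (k j) x)\<^sup>2 - q2 x * (u2 (k j) x)\<^sup>2"
    have c: "continuous_on (closure \<Omega>) ?g" "continuous_on (closure \<Omega>) ?z" by (intro continuous_intros qc uc hc)+
    have bnd: "\<bar>?g x - ?z x\<bar> \<le> 2 * (Q * ((A * e\<^sup>2) * (3 * e * H)))" if x: "x \<in> \<Omega>" for x
    proof -
      have "\<bar>(e * h x)\<^sup>2 - (u1 (k j) x)\<^sup>2\<bar> \<le> (A * e\<^sup>2) * (3 * e * H)"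
        using small_solution_asymptotics[OF Q(2) R hh H(2) uc(1) p1 eps0 k1 \<kappa>(2) x] x
        by (intro sq) (auto simp: e_def)
      then have "\<bar>q1 x * ((e * h x)\<^sup>2 - (u1 (k j) x)\<^sup>2)\<bar> \<le> Q * ((A * e\<^sup>2) * (3 * e * H))"
        unfolding abs_mult using Q(2)[OF x] Q(1) by (intro mult_mono) auto
      moreover have "\<bar>(e * h x)\<^sup>2 - (u2 (k j) x)\<^sup>2\<bar> \<le> (A * e\<^sup>2) * (3 * e * H)"
        using small_solution_asymptotics[OF Q(3) R hh H(2) uc(2) p2 eps0 k2 \<kappa>(2) x] x
        by (intro sq) (auto simp: e_def)
      then have "\<bar>q2 x * ((e * h x)\<^sup>2 - (u2 (k j) x)\<^sup>2)\<bar> \<le> Q * ((A * e\<^sup>2) * (3 * e * H))"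
        unfolding abs_mult using Q(3)[OF x] Q(1) by (intro mult_mono) auto
      moreover have "?g x - ?z x = q1 x * ((e * h x)\<^sup>2 - (u1 (k j) x)\<^sup>2) - q2 x * ((e * h x)\<^sup>2 - (u2 (k j) x)\<^sup>2)"
        by (simp add: power_mult_distrib algebra_simps)
      ultimately show ?thesis by linarith
    qed
    have "e\<^sup>2 * J = (LINT x:\<Omega>|lborel. ?g x)" unfolding J_def by simp
    also have "\<dots> = (LINT x:\<Omega>|lborel. ?g x - ?z x)"
      using set_integral_diff(2)[OF closure_integrable[OF c(1)] closure_integrable[OF c(2)]] zero[of "k j"] by simp
    finally have "\<bar>e\<^sup>2 * J\<bar> \<le> 2 * (Q * ((A * e\<^sup>2) * (3 * e * H))) * measure lborel \<Omega>"
      using set_integral_abs_le[OF continuous_on_diff[OF c] bnd] by simp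
    also have "\<dots> = e\<^sup>2 * (W * e)" by (simp add: W_def mult_ac)
    finally have "e\<^sup>2 * \<bar>J\<bar> \<le> e\<^sup>2 * (W * e)" by (simp add: abs_mult)
    then show ?thesis using e by (simp add: e_def)
  qed
  have "(\<lambda>j. W * eps (k j)) \<longlonglongrightarrow> 0" by (rule tendsto_mult_right_zero[OF elim])
  then have "\<bar>J\<bar> \<le> 0"
    by (rule tendsto_lowerbound) (use est in \<open>auto simp: eventually_sequentially intro!: exI[of _ "max M1 M2"]\<close>)
  then show ?thesis by (simp add: J_def)
qed

end

text \<open>This is where the dimension enters: \<open>a\<close> is a vector orthogonal to
  \<open>b\<close>, rescaled to the same length. Both signs are wanted so that the exponential
  growth cancels in a product.\<close>

lemma harmonic_exponents_exist:
  fixes b :: "real^'n"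
  assumes "CARD('n) \<ge> 2"
  obtains a where "(a, b) \<in> harmonic_exponents" "(- a, b) \<in> harmonic_exponents"
proof (cases "b = 0")
  case True
  then show ?thesis using that[of 0] by (simp add: harmonic_exponents_def)
next
  case False
  obtain y where y: "y \<noteq> 0" "orthogonal b y"
    using orthogonal_to_vector_exists[of b] assms by auto
  define a where "a = (norm b / norm y) *\<^sub>R y"
  have "norm a = norm b" using y by (simp add: a_def)
  then have "a \<bullet> a = b \<bullet> b" by (metis power2_norm_eq_inner)
  moreover have "a \<bullet> b = 0" using y(2) by (simp add: a_def orthogonal_def inner_commute)
  ultimately show ?thesis using that[of a] by (simp add: harmonic_exponents_def)
qed

theorem theorem1p1:
  fixes \<Omega> :: "(real^'n) set" and q1 q2 :: "real^'n \<Rightarrow> real"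
    and s \<delta> \<delta>1 \<delta>2 C1 C2 :: real
  assumes n2: "CARD('n) \<ge> 2"
    and dom: "open \<Omega>" "connected \<Omega>" "\<Omega> \<noteq> {}" "bounded \<Omega>"
    and bdry: "smooth_boundary \<Omega>"
    and s: "s > 1" "s \<notin> \<nat>"
    and q: "smooth_closure \<Omega> q1" "smooth_closure \<Omega> q2"
    and wp: "well_posed s \<Omega> q1 \<delta>1 C1" "well_posed s \<Omega> q2 \<delta>2 C2"
    and \<delta>: "0 < \<delta>" "\<delta> \<le> \<delta>1" "\<delta> \<le> \<delta>2"
    and DN: "\<forall>f\<in>bdry_holder_space s \<Omega>. bdry_holder_norm s \<Omega> f < \<delta> \<longrightarrow>
               (\<forall>x\<in>frontier \<Omega>. DN_map s \<Omega> q1 \<delta>1 C1 f x = DN_map s \<Omega> q2 \<delta>2 C2 f x)"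
  shows "\<forall>x\<in>\<Omega>. q1 x = q2 x"
proof -
  interpret holder_domain \<Omega> s
    using dom s by unfold_locales
  define Q where "Q x = q1 x - q2 x" for x
  have Qc: "continuous_on (closure \<Omega>) Q"
    unfolding Q_def using q by (auto simp: smooth_closure_def intro!: continuous_intros)
  have sq: "(LINT x:\<Omega>|lborel. Q x * (h x)\<^sup>2) = 0" if "h \<in> expcos_span harmonic_exponents" for h
    unfolding Q_def by (rule integral_square_harmonic_eq_0[OF bdry q wp \<delta> DN that])
  have int: "set_integrable lborel \<Omega> (\<lambda>x. Q x * f x)" if "continuous_on (closure \<Omega>) f" for f
    using that by (intro closure_integrable continuous_intros Qc)
  \<comment> \<open>The sum of two members of the span is again in it, so the square of the sum is
    covered by \<open>sq\<close>.\<close>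
  have prod: "(LINT x:\<Omega>|lborel. Q x * (f x * g x)) = 0"
    if f: "f \<in> expcos_span harmonic_exponents" and g: "g \<in> expcos_span harmonic_exponents" for f g
  proof -
    have c: "continuous_on (closure \<Omega>) f" "continuous_on (closure \<Omega>) g" using f g by (auto intro: expcos_span_continuous)
    have i: "set_integrable lborel \<Omega> (\<lambda>x. Q x * (f x)\<^sup>2)" "set_integrable lborel \<Omega> (\<lambda>x. Q x * (g x)\<^sup>2)"
      "set_integrable lborel \<Omega> (\<lambda>x. Q x * (f x * g x))"
      by (intro int continuous_intros c)+
    have "Q x * (f x + g x)\<^sup>2 = Q x * (f x)\<^sup>2 + Q x * (g x)\<^sup>2 + 2 * (Q x * (f x * g x))" for x
      by (simp add: power2_eq_square algebra_simps)
    then have "(LINT x:\<Omega>|lborel. Q x * (f x + g x)\<^sup>2)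
      = (LINT x:\<Omega>|lborel. Q x * (f x)\<^sup>2) + (LINT x:\<Omega>|lborel. Q x * (g x)\<^sup>2) + 2 * (LINT x:\<Omega>|lborel. Q x * (f x * g x))"
      using i by (simp add: set_integral_add)
    then show ?thesis using sq[OF f] sq[OF g] sq[OF expcos_span.add[OF f g]] by simp
  qed
  have plane: "(LINT x:\<Omega>|lborel. Q x * expcos 0 b c x) = 0" for b :: "real^'n" and c
  proof -
    \<comment> \<open>Half the frequency, since the product of two factors doubles it.\<close>
    define b' where "b' = (1/2) *\<^sub>R b"
    obtain a where a: "(a, b') \<in> harmonic_exponents" "(- a, b') \<in> harmonic_exponents"
      using harmonic_exponents_exist[OF n2] by blast
    \<comment> \<open>The addition formula for the cosine with angles
      \<open>b' \<bullet> x + c\<close> and \<open>b' \<bullet> x\<close>: \<open>?p\<close> is the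
      product of cosines, and \<open>?r\<close> the product of sines, written as cosines with phases
      lowered by \<open>pi / 2\<close>.\<close>
    let ?p = "\<lambda>x. expcos a b' c x * expcos (- a) b' 0 x"
    let ?r = "\<lambda>x. expcos a b' (c - pi / 2) x * expcos (- a) b' (- pi / 2) x"
    have e: "expcos 0 b c x = ?p x - ?r x" for x
    proof -
      have bx: "b \<bullet> x = b' \<bullet> x + b' \<bullet> x" by (simp add: b'_def inner_add_left[symmetric] scaleR_add_left[symmetric])
      have "exp (a \<bullet> x) * exp (- a \<bullet> x) = 1" by (simp add: exp_minus)
      moreover have "?p x - ?r x = (exp (a \<bullet> x) * exp (- a \<bullet> x)) *
          (cos (b' \<bullet> x + c) * cos (b' \<bullet> x) - cos (b' \<bullet> x + c - pi / 2) * cos (b' \<bullet> x - pi / 2))"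
        unfolding expcos_def by (simp add: algebra_simps)
      ultimately have "?p x - ?r x = cos (b' \<bullet> x + c) * cos (b' \<bullet> x) - cos (b' \<bullet> x + c - pi / 2) * cos (b' \<bullet> x - pi / 2)"
        by simp
      also have "\<dots> = cos (b' \<bullet> x + c) * cos (b' \<bullet> x) - sin (b' \<bullet> x + c) * sin (b' \<bullet> x)"
        by (simp add: cos_diff)
      also have "\<dots> = cos ((b' \<bullet> x + c) + b' \<bullet> x)" by (rule cos_add[symmetric])
      finally show ?thesis by (simp add: expcos_def bx algebra_simps)
    qed
    have "set_integrable lborel \<Omega> (\<lambda>x. Q x * ?p x)" "set_integrable lborel \<Omega> (\<lambda>x. Q x * ?r x)"
      by (intro int continuous_intros expcos_span_continuous[OF expcos_span.base[OF a(1)]]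
          expcos_span_continuous[OF expcos_span.base[OF a(2)]])+
    then have "(LINT x:\<Omega>|lborel. Q x * expcos 0 b c x) = (LINT x:\<Omega>|lborel. Q x * ?p x) - (LINT x:\<Omega>|lborel. Q x * ?r x)"
      unfolding e right_diff_distrib by (rule set_integral_diff(2))
    then show ?thesis
      using prod[OF expcos_span.base[OF a(1)] expcos_span.base[OF a(2)]] by simp
  qed
  have span: "(LINT x:\<Omega>|lborel. Q x * f x) = 0" if "f \<in> expcos_span ({0} \<times> UNIV)" for f
    using that
  proof (induction rule: expcos_span.induct)
    case (base a b c)
    then show ?case using plane by simp
  next
    case (add f g)
    then show ?case
      using set_integral_add(2)[OF int int, of f g] expcos_span_continuous[OF add.hyps(1)]
        expcos_span_continuous[OF add.hyps(2)] by (simp add: distrib_left)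
  next
    case (scale f k)
    then show ?case by (simp add: mult.left_commute[of _ k])
  qed
  \<comment> \<open>\<open>Q\<close> itself serves as test function: it differs by less than
    \<open>e'\<close> from a trigonometric polynomial, to which it is orthogonal.\<close>
  have QQ: "(LINT x:\<Omega>|lborel. Q x * Q x) \<le> 0"
  proof (rule field_le_epsilon)
    fix e :: real assume e: "e > 0"
    define B where "B = (LINT x:\<Omega>|lborel. \<bar>Q x\<bar>)"
    have iQ: "set_integrable lborel \<Omega> (\<lambda>x. \<bar>Q x\<bar>)" by (intro closure_integrable continuous_intros Qc)
    have B0: "B \<ge> 0" unfolding B_def set_lebesgue_integral_def by (intro integral_nonneg_AE) auto
    define e' where "e' = e / (B + 1)"
    have e': "e' > 0" using e B0 by (simp add: e'_def)
    have comp: "compact (closure \<Omega>)" using dom(4) by simp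
    obtain f where f: "f \<in> expcos_span ({0} \<times> UNIV)" "\<And>x. x \<in> closure \<Omega> \<Longrightarrow> \<bar>Q x - f x\<bar> < e'"
      using cos_span_dense[OF comp Qc e'] by metis
    have fc: "continuous_on (closure \<Omega>) f" by (rule expcos_span_continuous[OF f(1)])
    have "(LINT x:\<Omega>|lborel. Q x * Q x) = (LINT x:\<Omega>|lborel. Q x * (Q x - f x))"
      using set_integral_diff(2)[OF int[OF Qc] int[OF fc]] span[OF f(1)] by (simp add: right_diff_distrib)
    also have "\<dots> \<le> (LINT x:\<Omega>|lborel. e' * \<bar>Q x\<bar>)"
    proof (rule set_integral_mono)
      show "set_integrable lborel \<Omega> (\<lambda>x. Q x * (Q x - f x))" by (intro int continuous_intros Qc fc)
      show "set_integrable lborel \<Omega> (\<lambda>x. e' * \<bar>Q x\<bar>)" using iQ by simp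
      fix x assume "x \<in> \<Omega>"
      then have "\<bar>Q x - f x\<bar> \<le> e'" using f(2)[of x] closure_subset by fastforce
      then have "\<bar>Q x * (Q x - f x)\<bar> \<le> \<bar>Q x\<bar> * e'" unfolding abs_mult by (intro mult_left_mono) auto
      then show "Q x * (Q x - f x) \<le> e' * \<bar>Q x\<bar>" by (simp add: mult.commute)
    qed
    also have "\<dots> = e' * B" by (simp add: B_def)
    also have "\<dots> \<le> e" using e B0 by (simp add: e'_def field_simps)
    finally show "(LINT x:\<Omega>|lborel. Q x * Q x) \<le> 0 + e" by simp
  qed
  show ?thesis
  proof (rule ccontr)
    assume "\<not> ?thesis"
    then obtain x0 where x0: "x0 \<in> \<Omega>" "Q x0 \<noteq> 0" by (auto simp: Q_def)
    \<comment> \<open>By continuity the square of \<open>Q\<close> exceeds half its value at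
      \<open>x0\<close> on a ball around \<open>x0\<close>, which would make its integral
      positive.\<close>
    define c where "c = (Q x0)\<^sup>2 / 2"
    have c: "c > 0" using x0 by (simp add: c_def)
    have "continuous_on \<Omega> (\<lambda>x. Q x * Q x)"
      using continuous_on_subset[OF Qc closure_subset] by (intro continuous_intros)
    then have "isCont (\<lambda>x. Q x * Q x) x0" using x0 dom(1) by (simp add: continuous_on_eq_continuous_at)
    then have "((\<lambda>x. Q x * Q x) \<longlongrightarrow> Q x0 * Q x0) (nhds x0)" 
      using tendsto_at_iff_tendsto_nhds[of "\<lambda>x. Q x * Q x" x0] by (simp add: isCont_def)
    moreover have "c < Q x0 * Q x0" using c unfolding c_def power2_eq_square by linarith
    ultimately have "\<forall>\<^sub>F x in nhds x0. c < Q x * Q x" by (rule order_tendstoD(1))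
    moreover have "\<forall>\<^sub>F x in nhds x0. x \<in> \<Omega>" using dom(1) x0 by (intro eventually_nhds_in_open)
    ultimately have "\<forall>\<^sub>F x in nhds x0. c < Q x * Q x \<and> x \<in> \<Omega>" by (rule eventually_conj)
    then obtain r where r: "r > 0" "\<And>x. dist x x0 < r \<Longrightarrow> c < Q x * Q x \<and> x \<in> \<Omega>"
      unfolding eventually_nhds_metric by blast
    have fin: "emeasure lborel (ball x0 r) < \<infinity>" using emeasure_bounded_finite[OF bounded_ball] by simp
    have "c * measure lborel (ball x0 r) = (\<integral>x. indicator (ball x0 r) x * c \<partial>lborel)"
      using fin by simp
    also have "\<dots> \<le> (\<integral>x. indicator \<Omega> x *\<^sub>R (Q x * Q x) \<partial>lborel)"
    proof (rule integral_mono)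
      show "integrable lborel (\<lambda>x. indicator (ball x0 r) x * c)" using fin by simp
      show "integrable lborel (\<lambda>x. indicator \<Omega> x *\<^sub>R (Q x * Q x))" using int[OF Qc] by (simp add: set_integrable_def)
      show "indicator (ball x0 r) x * c \<le> indicator \<Omega> x *\<^sub>R (Q x * Q x)" for x
        using r(2)[of x] by (auto simp: dist_commute less_imp_le split: split_indicator)
    qed
    also have "\<dots> \<le> 0" using QQ by (simp add: set_lebesgue_integral_def)
    finally have "c * measure lborel (ball x0 r) \<le> 0" .
    moreover have "measure lborel (ball x0 r) > 0" using content_ball_pos[OF r(1), of x0] by simp
    ultimately show False using c by (simp add: mult_le_0_iff)
  qed
qed

end
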